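(* Let $k$ be any fixed number. There is a polynomial-time algorithm solving the Tree Cutting Problem: given a tree $T$ rooted in a vertex $r$ and nonnegative integers $s_1,\dots,s_k$, find (or decide that none exists) a cover of $E(T)$ by connected subgraphs $T_1,\dots,T_k$ of $T$, each containing $r$, with $|E(T_i)|=s_i$ for $i=1,\dots,k$.
   Context: The Tree Cutting Problem is the graph cutting problem restricted to trees: a cover of $E(T)$ by $T_1,\dots,T_k$ means $E(T)=\bigcup_i E(T_i)$ (the subgraphs may overlap); sizes are numbers of edges. *)

theory Defs
  imports
    "HOL-Library.Log_Nat"
    "HOL-Computational_Algebra.Polynomial"
begin

section \<open>Undirected graphs and trees\<close>

type_synonym 'a ugraph = "'a set \<times> 'a set set"

abbreviation verts :: "'a ugraph \<Rightarrow> 'a set" where "verts G \<equiv> fst G"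
abbreviation edges :: "'a ugraph \<Rightarrow> 'a set set" where "edges G \<equiv> snd G"

definition simple_graph :: "'a ugraph \<Rightarrow> bool" where
  "simple_graph G \<longleftrightarrow> finite (verts G) \<and> (\<forall>e \<in> edges G. e \<subseteq> verts G \<and> card e = 2)"

definition connected_graph :: "'a ugraph \<Rightarrow> bool" where
  "connected_graph G \<longleftrightarrow> verts G \<noteq> {} \<and>
     (\<forall>u \<in> verts G. \<forall>v \<in> verts G. (u, v) \<in> {(x, y). {x, y} \<in> edges G}\<^sup>*)"

text \<open>The last vertex of the list is joined to the first one.\<close>

definition is_cycle :: "'a ugraph \<Rightarrow> 'a list \<Rightarrow> bool" where
  "is_cycle G vs \<longleftrightarrow> 3 \<le> length vs \<and> distinct vs \<and>
     (\<forall>i < length vs. {vs ! i, vs ! (Suc i mod length vs)} \<in> edges G)"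

definition tree :: "'a ugraph \<Rightarrow> bool" where
  "tree G \<longleftrightarrow> simple_graph G \<and> connected_graph G \<and> (\<nexists>vs. is_cycle G vs)"

definition subgraph :: "'a ugraph \<Rightarrow> 'a ugraph \<Rightarrow> bool" where
  "subgraph H G \<longleftrightarrow> simple_graph H \<and> verts H \<subseteq> verts G \<and> edges H \<subseteq> edges G"

definition tree_cutting :: "'a ugraph \<Rightarrow> 'a \<Rightarrow> nat list \<Rightarrow> 'a ugraph list \<Rightarrow> bool" where
  "tree_cutting T r ss Ts \<longleftrightarrow> length Ts = length ss \<and>
     (\<forall>i < length ss. subgraph (Ts ! i) T \<and> connected_graph (Ts ! i) \<and> r \<in> verts (Ts ! i) \<and>
        card (edges (Ts ! i)) = ss ! i) \<and>
     edges T = (\<Union>i < length ss. edges (Ts ! i))"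

section \<open>Random access machines with logarithmic cost\<close>

text \<open>
  Programs are structured (while) programs over an infinite memory of natural numbers with
  indirect addressing. The input is a read-only, randomly accessible sequence of numbers; the
  output is a write-only sequence. \<open>Sub\<close> is truncated subtraction, and \<open>Load\<close>, \<open>Store\<close>
  and \<open>Read\<close> take the address from a memory cell.
\<close>

datatype instr =
    Const nat nat
  | Add nat nat nat
  | Sub nat nat nat
  | Load nat nat
  | Store nat nat
  | Read nat nat
  | Print nat

datatype prog =
    Skip
  | Instr instr
  | Seq prog prog
  | IfNZ nat prog prog
  | WhileNZ nat prog

type_synonym state = "(nat \<Rightarrow> nat) \<times> nat list"

definition input_at :: "nat list \<Rightarrow> nat \<Rightarrow> nat" where
  "input_at xs i = (if i < length xs then xs ! i else 0)"

fun step :: "nat list \<Rightarrow> instr \<Rightarrow> state \<Rightarrow> state" where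
  "step xs (Const d c) (m, out) = (m(d := c), out)"
| "step xs (Add d a b) (m, out) = (m(d := m a + m b), out)"
| "step xs (Sub d a b) (m, out) = (m(d := m a - m b), out)"
| "step xs (Load d a) (m, out) = (m(d := m (m a)), out)"
| "step xs (Store a b) (m, out) = (m(m a := m b), out)"
| "step xs (Read d a) (m, out) = (m(d := input_at xs (m a)), out)"
| "step xs (Print a) (m, out) = (m, out @ [m a])"

text \<open>Length of the binary representation, where \<open>0\<close> has length 1.\<close>

definition bits :: "nat \<Rightarrow> nat" where
  "bits n = max 1 (floorlog 2 n)"

text \<open>
  An instruction is charged the bit lengths of all numbers and addresses it handles at run time;
  the addresses and constants occurring in the program text only contribute a constant, and are
  subsumed under the summand 1.
\<close>

fun cost :: "nat list \<Rightarrow> instr \<Rightarrow> state \<Rightarrow> nat" where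
  "cost xs (Const d c) (m, out) = 1"
| "cost xs (Add d a b) (m, out) = 1 + bits (m a) + bits (m b)"
| "cost xs (Sub d a b) (m, out) = 1 + bits (m a) + bits (m b)"
| "cost xs (Load d a) (m, out) = 1 + bits (m a) + bits (m (m a))"
| "cost xs (Store a b) (m, out) = 1 + bits (m a) + bits (m b)"
| "cost xs (Read d a) (m, out) = 1 + bits (m a) + bits (input_at xs (m a))"
| "cost xs (Print a) (m, out) = 1 + bits (m a)"

text \<open>\<open>exec xs c s t s'\<close>: on input \<open>xs\<close>, program \<open>c\<close> started in \<open>s\<close> halts in \<open>s'\<close> after time \<open>t\<close>.\<close>

inductive exec :: "nat list \<Rightarrow> prog \<Rightarrow> state \<Rightarrow> nat \<Rightarrow> state \<Rightarrow> bool" for xs where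
  Skip: "exec xs Skip s 1 s"
| Instr: "exec xs (Instr i) s (cost xs i s) (step xs i s)"
| Seq: "exec xs c1 s t1 s' \<Longrightarrow> exec xs c2 s' t2 s'' \<Longrightarrow> exec xs (Seq c1 c2) s (t1 + t2) s''"
| IfTrue: "fst s a \<noteq> 0 \<Longrightarrow> exec xs c1 s t s' \<Longrightarrow>
    exec xs (IfNZ a c1 c2) s (1 + bits (fst s a) + t) s'"
| IfFalse: "fst s a = 0 \<Longrightarrow> exec xs c2 s t s' \<Longrightarrow>
    exec xs (IfNZ a c1 c2) s (1 + bits (fst s a) + t) s'"
| WhileFalse: "fst s a = 0 \<Longrightarrow> exec xs (WhileNZ a c) s (1 + bits (fst s a)) s"
| WhileTrue: "fst s a \<noteq> 0 \<Longrightarrow> exec xs c s t1 s' \<Longrightarrow> exec xs (WhileNZ a c) s' t2 s'' \<Longrightarrow>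
    exec xs (WhileNZ a c) s (1 + bits (fst s a) + t1 + t2) s''"

inductive_cases exec_SkipE: "exec xs Skip s t s'"
inductive_cases exec_InstrE: "exec xs (Instr i) s t s'"
inductive_cases exec_SeqE: "exec xs (Seq c1 c2) s t s'"
inductive_cases exec_IfE: "exec xs (IfNZ a c1 c2) s t s'"
inductive_cases exec_WhileE: "exec xs (WhileNZ a c) s t s'"

lemma exec_deterministic:
  "exec xs c s t s' \<Longrightarrow> exec xs c s u s'' \<Longrightarrow> u = t \<and> s'' = s'"
proof (induction arbitrary: u s'' rule: exec.induct)
  case (Skip s)
  then show ?case by (rule exec_SkipE) simp
next
  case (Instr i s)
  then show ?case by (rule exec_InstrE) simp
next
  case (Seq c1 s t1 s1 c2 t2 s2)
  from Seq.prems obtain v1 v2 r where *: "exec xs c1 s v1 r" "exec xs c2 r v2 s''" "u = v1 + v2"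
    by (rule exec_SeqE)
  from Seq.IH(1)[OF *(1)] *(2) Seq.IH(2)[of v2 s''] *(3) show ?case by simp
next
  case (IfTrue s a c1 t s1 c2)
  from IfTrue.prems obtain v where "exec xs c1 s v s''" "u = 1 + bits (fst s a) + v"
    by (rule exec_IfE) (use IfTrue.hyps in simp_all)
  with IfTrue.IH[of v s''] show ?case by simp
next
  case (IfFalse s a c2 t s1 c1)
  from IfFalse.prems obtain v where "exec xs c2 s v s''" "u = 1 + bits (fst s a) + v"
    by (rule exec_IfE) (use IfFalse.hyps in simp_all)
  with IfFalse.IH[of v s''] show ?case by simp
next
  case (WhileFalse s a c)
  from WhileFalse.prems show ?case by (rule exec_WhileE) (use WhileFalse.hyps in simp_all)
next
  case (WhileTrue s a c t1 s1 t2 s2)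
  from WhileTrue.prems obtain v1 v2 r where
    *: "exec xs c s v1 r" "exec xs (WhileNZ a c) r v2 s''" "u = 1 + bits (fst s a) + v1 + v2"
    by (rule exec_WhileE) (use WhileTrue.hyps in simp_all)
  from WhileTrue.IH(1)[OF *(1)] *(2) WhileTrue.IH(2)[of v2 s''] *(3) show ?case by simp
qed

definition input_size :: "nat list \<Rightarrow> nat" where
  "input_size xs = sum_list (map bits xs)"

text \<open>
  The problem consists of a set \<open>Inst\<close> of instances, their encoding \<open>enc\<close>, and the relation
  \<open>acc\<close> between instances and correct outputs. Since execution is deterministic, exhibiting a
  halting execution amounts to describing the behaviour of the program.
\<close>

definition poly_time_solvable ::
  "'i set \<Rightarrow> ('i \<Rightarrow> nat list) \<Rightarrow> ('i \<Rightarrow> nat list \<Rightarrow> bool) \<Rightarrow> bool" where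
  "poly_time_solvable Inst enc acc \<longleftrightarrow>
     (\<exists>(c :: prog) (p :: nat poly). \<forall>x \<in> Inst. \<exists>t m out.
        exec (enc x) c (\<lambda>_. 0, []) t (m, out) \<and>
        t \<le> poly p (input_size (enc x)) \<and>
        acc x out)"

section \<open>The Tree Cutting Problem\<close>

text \<open>
  The tree is presented by its number of vertices, which are \<open>0, \<dots>, nverts - 1\<close>, and a list
  containing every edge exactly once, in an arbitrary order and orientation.
\<close>

record tcp_input =
  nverts :: nat
  edge_list :: "(nat \<times> nat) list"
  root :: nat
  sizes :: "nat list"

definition input_graph :: "tcp_input \<Rightarrow> nat ugraph" where
  "input_graph I = ({..<nverts I}, (\<lambda>(u, v). {u, v}) ` set (edge_list I))"

definition tcp_instances :: "nat \<Rightarrow> tcp_input set" where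
  "tcp_instances k = {I. tree (input_graph I) \<and> distinct (map (\<lambda>(u, v). {u, v}) (edge_list I)) \<and>
     root I < nverts I \<and> length (sizes I) = k}"

definition encode_input :: "tcp_input \<Rightarrow> nat list" where
  "encode_input I = [nverts I, length (edge_list I)] @
     concat (map (\<lambda>(u, v). [u, v]) (edge_list I)) @ [root I] @ sizes I"

text \<open>A subgraph is output as the 0/1 table of its vertices followed by that of its edges.\<close>

definition encode_subgraph :: "tcp_input \<Rightarrow> nat ugraph \<Rightarrow> nat list" where
  "encode_subgraph I H =
     map (\<lambda>v. of_bool (v \<in> verts H)) [0..<nverts I] @
     map (\<lambda>(u, v). of_bool ({u, v} \<in> edges H)) (edge_list I)"

definition tcp_solution :: "tcp_input \<Rightarrow> nat ugraph list \<Rightarrow> bool" where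
  "tcp_solution I Ts \<longleftrightarrow> tree_cutting (input_graph I) (root I) (sizes I) Ts"

text \<open>Output \<open>1\<close> followed by a solution if there is one, and \<open>0\<close> otherwise.\<close>

definition tcp_answer :: "tcp_input \<Rightarrow> nat list \<Rightarrow> bool" where
  "tcp_answer I out \<longleftrightarrow>
     (if \<exists>Ts. tcp_solution I Ts
      then \<exists>Ts. tcp_solution I Ts \<and> out = 1 # concat (map (encode_subgraph I) Ts)
      else out = [0])"

end

theory Submission
  imports Defs
begin

text \<open>
  Order the edges such that each of them attaches a new vertex to the part of the tree reached so
  far from the root, and then cut off the last edge again and again. For each vertex \<open>v\<close> keep the set
  of all vectors \<open>x\<close> such that the part of the tree already cut off below \<open>v\<close> can be covered using
  exactly \<open>x i\<close> edges for \<open>T\<^sub>i\<close>, where only parts containing \<open>v\<close> are used. Cutting off a leaf \<open>c\<close> with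
  parent \<open>p\<close> adds a vector \<open>z \<noteq> 0\<close> to the vectors of \<open>p\<close>, where \<open>z\<close> is positive exactly for the parts
  containing the edge, and decrementing its positive entries gives a vector of \<open>c\<close>. There are only
  polynomially many vectors, as \<open>k\<close> is fixed and no entry exceeds the number of edges. Storing one
  summand \<open>z\<close> for every sum makes it possible to trace a solution back.

  The random access machine program is written in a language of loops with bounded iteration,
  whose running time is bounded syntactically by a polynomial in the loop bounds.
\<close>

text \<open>Treating all parts at once makes coverage a local condition: every edge must contribute
  a summand \<open>z \<noteq> 0\<close>. The decrement alone loses information, since the entries 0
  and 1 both become 0; \<open>z\<close> itself tells whether a part stops above the edge or contains
  it and nothing below. Vectors are numbers in base \<open>n + 1\<close>, so that adding two of them
  is a single addition, provided that no carry occurs; this is why the edges cut off below each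
  vertex have to be bounded. The machine has neither multiplication nor division: products become
  loops, and digits are looked up in tables. Moreover, a register bounding a loop must not be
  written by the same program, but the number \<open>(n + 1) ^ k\<close> of vectors is only known at
  run time; hence the program runs in three phases, each preparing the loop bounds of the next.
  Finally, the number of vertices is given in binary and could be huge by itself; it is polynomial
  in the input size because a tree has \<open>n - 1\<close> edges, all of which are listed.\<close>

section \<open>Unit cost\<close>

text \<open>Separates counting steps from bounding bit lengths: programs are analysed with this
  measure, and \<open>exec_unit_imp_exec\<close> converts the result to logarithmic cost once and
  for all.\<close>

inductive exec_unit :: "nat list \<Rightarrow> prog \<Rightarrow> state \<Rightarrow> nat \<Rightarrow> state \<Rightarrow> bool" for xs where
  Skip: "exec_unit xs Skip s 1 s"
| Instr: "exec_unit xs (Instr i) s 1 (step xs i s)"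
| Seq: "exec_unit xs c1 s n1 s' \<Longrightarrow> exec_unit xs c2 s' n2 s'' \<Longrightarrow>
    exec_unit xs (Seq c1 c2) s (n1 + n2) s''"
| IfTrue: "fst s a \<noteq> 0 \<Longrightarrow> exec_unit xs c1 s n s' \<Longrightarrow> exec_unit xs (IfNZ a c1 c2) s (1 + n) s'"
| IfFalse: "fst s a = 0 \<Longrightarrow> exec_unit xs c2 s n s' \<Longrightarrow> exec_unit xs (IfNZ a c1 c2) s (1 + n) s'"
| WhileFalse: "fst s a = 0 \<Longrightarrow> exec_unit xs (WhileNZ a c) s 1 s"
| WhileTrue: "fst s a \<noteq> 0 \<Longrightarrow> exec_unit xs c s n1 s' \<Longrightarrow> exec_unit xs (WhileNZ a c) s' n2 s'' \<Longrightarrow>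
    exec_unit xs (WhileNZ a c) s (1 + n1 + n2) s''"

text \<open>Immediate constants are the only source of large numbers besides the memory and the
  input, so they have to enter the estimate of bit lengths.\<close>

fun const_bound :: "prog \<Rightarrow> nat" where
  "const_bound (Instr (Const d c)) = c"
| "const_bound (Seq c1 c2) = max (const_bound c1) (const_bound c2)"
| "const_bound (IfNZ a c1 c2) = max (const_bound c1) (const_bound c2)"
| "const_bound (WhileNZ a c) = const_bound c"
| "const_bound _ = 0"

lemma bits_le: "v < 2 ^ b \<Longrightarrow> 1 \<le> b \<Longrightarrow> bits v \<le> b"
  by (simp add: bits_def floorlog_leI)

lemma less_two_power_bits: "v < 2 ^ bits v"
proof (cases "v = 0")
  case False
  have "v < 2 ^ floorlog 2 v" using floorlog_leD[of 2 v] by simp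
  also have "\<dots> \<le> 2 ^ bits v" by (intro power_increasing) (simp_all add: bits_def)
  finally show ?thesis .
qed simp

lemma less_power_add: "(v::nat) < 2 ^ b \<Longrightarrow> v < 2 ^ (b + n)"
  by (erule less_le_trans) simp

lemma step_less:
  assumes "\<forall>a. fst s a < 2 ^ b" "const_bound (Instr i) < 2 ^ b" "\<forall>j. input_at xs j < 2 ^ b"
  shows "fst (step xs i s) a < 2 ^ Suc b"
proof -
  obtain m out where s: "s = (m, out)" by fastforce
  have m: "m a < 2 ^ b" for a using assms(1) by (simp add: s)
  have S: "v < 2 ^ Suc b" if "v < 2 ^ b" for v :: nat using that by simp
  have "m a + m c < 2 ^ Suc b" for a c using m[of a] m[of c] by simp
  moreover have "m a - m c < 2 ^ Suc b" for a c using S[OF m[of a]] by simp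
  ultimately show ?thesis
    using assms(2,3) m S unfolding s by (cases i) (simp_all del: power_Suc)
qed

lemma cost_le:
  assumes "\<forall>a. fst s a < 2 ^ b" "\<forall>j. input_at xs j < 2 ^ b" "1 \<le> b"
  shows "cost xs i s \<le> 1 + 2 * b"
proof -
  obtain m out where s: "s = (m, out)" by fastforce
  have "bits (m a) \<le> b" for a using assms by (auto simp: s intro: bits_le)
  moreover have "bits (input_at xs j) \<le> b" for j using assms by (auto intro: bits_le)
  ultimately have "bits (m a) + bits (m c) \<le> 2 * b" "bits (m a) + bits (input_at xs j) \<le> 2 * b"
    "bits (m a) \<le> 2 * b" for a c j
    by (metis add_mono mult_2, metis add_mono mult_2, metis le_add1 le_trans mult_2)
  then show ?thesis unfolding s by (cases i) simp_all
qed

text \<open>The estimate \<open>n * (3 + 2 * (b + n))\<close> for \<open>n\<close> steps on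
  \<open>b\<close>-bit numbers is chosen to compose: the second run starts with
  \<open>b + n1\<close> bits, as each step of the first may have added one.\<close>

lemma cost_add:
  fixes t1 t2 :: nat
  assumes "t1 \<le> n1 * (3 + 2 * (b + n1))" "t2 \<le> n2 * (3 + 2 * (b + n1 + n2))"
  shows "t1 + t2 \<le> (n1 + n2) * (3 + 2 * (b + (n1 + n2)))"
proof -
  have "t1 \<le> n1 * (3 + 2 * (b + (n1 + n2)))"
    using assms(1) by (rule order_trans) (intro mult_mono; simp)
  moreover have "t2 \<le> n2 * (3 + 2 * (b + (n1 + n2)))"
    using assms(2) by (simp add: add.assoc)
  ultimately show ?thesis unfolding add_mult_distrib by (rule add_mono)
qed

lemma cost_add_test:
  fixes t :: nat
  assumes "e \<le> b" "t \<le> n * (3 + 2 * (b + n))"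
  shows "1 + e + t \<le> (1 + n) * (3 + 2 * (b + (1 + n)))"
  using cost_add[of "1 + e" 1 b t n] assms
  by (simp add: add_mult_distrib add_mult_distrib2)

text \<open>Without multiplication a step adds at most one bit to the largest number in memory, so a
  polynomial number of steps is enough for polynomial logarithmic cost.\<close>

lemma exec_unit_imp_exec:
  assumes "exec_unit xs c s n s'" "\<forall>a. fst s a < 2 ^ b" "const_bound c < 2 ^ b"
    "\<forall>j. input_at xs j < 2 ^ b" "1 \<le> b"
  shows "(\<forall>a. fst s' a < 2 ^ (b + n)) \<and> (\<exists>t. exec xs c s t s' \<and> t \<le> n * (3 + 2 * (b + n)))"
  using assms
proof (induction arbitrary: b rule: exec_unit.induct)
  case (Skip s)
  then have "\<forall>a. fst s a < 2 ^ (b + 1)" using less_power_add by blast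
  then show ?case using exec.Skip[of xs s] by (auto simp del: power_add)
next
  case (Instr i s)
  have "cost xs i s \<le> 1 + 2 * b" by (rule cost_le) (use Instr in auto)
  moreover have "\<forall>a. fst (step xs i s) a < 2 ^ Suc b" using step_less Instr by blast
  ultimately show ?case by (auto intro!: exI[of _ "cost xs i s"] exec.Instr)
next
  case (Seq c1 s n1 s' c2 n2 s'')
  from Seq.IH(1)[of b] Seq.prems obtain t1 where
    1: "\<forall>a. fst s' a < 2 ^ (b + n1)" "exec xs c1 s t1 s'" "t1 \<le> n1 * (3 + 2 * (b + n1))" by auto
  from Seq.IH(2)[of "b + n1"] Seq.prems 1(1) obtain t2 where
    2: "\<forall>a. fst s'' a < 2 ^ (b + n1 + n2)" "exec xs c2 s' t2 s''"
      "t2 \<le> n2 * (3 + 2 * (b + n1 + n2))" by (auto intro!: less_power_add simp del: power_add)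
  from 1(3) 2(3) have "t1 + t2 \<le> (n1 + n2) * (3 + 2 * (b + (n1 + n2)))"
    by (rule cost_add)
  with 1 2 show ?case by (auto simp: add.assoc intro!: exI[of _ "t1 + t2"] exec.Seq)
next
  case (IfTrue s a c1 n s' c2)
  from IfTrue.IH[of b] IfTrue.prems obtain t where
    1: "\<forall>a. fst s' a < 2 ^ (b + n)" "exec xs c1 s t s'" "t \<le> n * (3 + 2 * (b + n))" by auto
  have "bits (fst s a) \<le> b" using IfTrue.prems by (auto intro: bits_le)
  from this 1(3) have "1 + bits (fst s a) + t \<le> (1 + n) * (3 + 2 * (b + (1 + n)))"
    by (rule cost_add_test)
  moreover have "\<forall>a. fst s' a < 2 ^ (b + n + 1)" using 1 less_power_add by blast
  ultimately show ?case using exec.IfTrue[OF IfTrue.hyps(1) 1(2), of c2] by (auto simp: add_ac)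
next
  case (IfFalse s a c2 n s' c1)
  from IfFalse.IH[of b] IfFalse.prems obtain t where
    1: "\<forall>a. fst s' a < 2 ^ (b + n)" "exec xs c2 s t s'" "t \<le> n * (3 + 2 * (b + n))" by auto
  have "bits (fst s a) \<le> b" using IfFalse.prems by (auto intro: bits_le)
  from this 1(3) have "1 + bits (fst s a) + t \<le> (1 + n) * (3 + 2 * (b + (1 + n)))"
    by (rule cost_add_test)
  moreover have "\<forall>a. fst s' a < 2 ^ (b + n + 1)" using 1 less_power_add by blast
  ultimately show ?case using exec.IfFalse[OF IfFalse.hyps(1) 1(2), of c1] by (auto simp: add_ac)
next
  case (WhileFalse s a c)
  have "bits (fst s a) \<le> b" using WhileFalse.prems by (auto intro: bits_le)
  moreover have "\<forall>a. fst s a < 2 ^ (b + 1)" using WhileFalse.prems less_power_add by blast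
  ultimately show ?case using exec.WhileFalse[OF WhileFalse.hyps(1), of xs c]
    by (auto simp del: power_add)
next
  case (WhileTrue s a c n1 s' n2 s'')
  from WhileTrue.IH(1)[of b] WhileTrue.prems obtain t1 where
    1: "\<forall>a. fst s' a < 2 ^ (b + n1)" "exec xs c s t1 s'" "t1 \<le> n1 * (3 + 2 * (b + n1))" by auto
  from WhileTrue.IH(2)[of "b + n1"] WhileTrue.prems 1(1) obtain t2 where
    2: "\<forall>a. fst s'' a < 2 ^ (b + n1 + n2)" "exec xs (WhileNZ a c) s' t2 s''"
      "t2 \<le> n2 * (3 + 2 * (b + n1 + n2))" by (auto intro!: less_power_add simp del: power_add)
  have "bits (fst s a) \<le> b" using WhileTrue.prems by (auto intro: bits_le)
  moreover have "t1 + t2 \<le> (n1 + n2) * (3 + 2 * (b + (n1 + n2)))"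
    using 1(3) 2(3) by (rule cost_add)
  ultimately have "1 + bits (fst s a) + (t1 + t2) \<le>
      (1 + (n1 + n2)) * (3 + 2 * (b + (1 + (n1 + n2))))"
    by (rule cost_add_test)
  moreover have "\<forall>a. fst s'' a < 2 ^ (b + (1 + n1 + n2))"
    using 2(1) less_power_add[of _ "b + (n1 + n2)" 1] by (simp only: add_ac) blast
  ultimately show ?case using exec.WhileTrue[OF WhileTrue.hyps(1) 1(2) 2(2)]
    by (auto simp only: add.assoc)
qed

definition runs :: "nat list \<Rightarrow> prog \<Rightarrow> state \<Rightarrow> nat \<Rightarrow> (state \<Rightarrow> bool) \<Rightarrow> bool" where
  "runs xs c s N Q \<longleftrightarrow> (\<exists>n s'. exec_unit xs c s n s' \<and> n \<le> N \<and> Q s')"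

lemma runs_mono:
  "runs xs c s N Q \<Longrightarrow> N \<le> N' \<Longrightarrow> (\<And>s'. Q s' \<Longrightarrow> Q' s') \<Longrightarrow> runs xs c s N' Q'"
  unfolding runs_def by (meson le_trans)

lemma runs_Skip: "Q s \<Longrightarrow> runs xs Skip s 1 Q"
  unfolding runs_def using exec_unit.Skip by blast

lemma runs_Instr: "Q (step xs i s) \<Longrightarrow> runs xs (Instr i) s 1 Q"
  unfolding runs_def using exec_unit.Instr by blast

text \<open>The intermediate condition is itself a \<open>runs\<close> statement, as in a calculus
  of weakest preconditions; chains of instructions thus unfold from left to right.\<close>

lemma runs_Seq:
  "runs xs c1 s N1 (\<lambda>s'. runs xs c2 s' N2 Q) \<Longrightarrow> runs xs (Seq c1 c2) s (N1 + N2) Q"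
  unfolding runs_def by (meson add_mono exec_unit.Seq)

lemma runs_Instr_Seq:
  "runs xs c (step xs i s) N Q \<Longrightarrow> runs xs (Seq (Instr i) c) s (Suc N) Q"
  using runs_Seq[OF runs_Instr, of xs c i s N Q] by simp

lemma runs_If:
  assumes "runs xs (if fst s a \<noteq> 0 then c1 else c2) s N Q"
  shows "runs xs (IfNZ a c1 c2) s (Suc N) Q"
proof -
  obtain n s' where *: "exec_unit xs (if fst s a \<noteq> 0 then c1 else c2) s n s'" "n \<le> N" "Q s'"
    using assms unfolding runs_def by blast
  then have "exec_unit xs (IfNZ a c1 c2) s (1 + n) s'"
    using exec_unit.IfTrue[of s a xs c1 n s' c2] exec_unit.IfFalse[of s a xs c2 n s' c1]
    by (cases "fst s a = 0") simp_all
  with * show ?thesis unfolding runs_def by (intro exI[of _ "1 + n"] exI[of _ s']) simp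
qed

text \<open>\<open>Inv\<close> is indexed by the number of iterations left, so it also proves
  termination. \<open>Suc N\<close> includes the test of each iteration, and the final
  \<open>1\<close> is the test that leaves the loop.\<close>

lemma runs_While:
  assumes "Inv n s"
    and "\<And>i s. Inv (Suc i) s \<Longrightarrow> i < n \<Longrightarrow> fst s a \<noteq> 0 \<and> runs xs c s N (Inv i)"
    and "\<And>s. Inv 0 s \<Longrightarrow> fst s a = 0 \<and> Q s"
  shows "runs xs (WhileNZ a c) s (n * Suc N + 1) Q"
proof -
  have "runs xs (WhileNZ a c) s (i * Suc N + 1) Q" if "Inv i s" "i \<le> n" for i s
    using that
  proof (induction i arbitrary: s)
    case 0
    with assms(3) have "fst s a = 0" "Q s" by auto
    with exec_unit.WhileFalse[of s a xs c] show ?case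
      unfolding runs_def by (intro exI[of _ 1] exI[of _ s]) simp
  next
    case (Suc i)
    then obtain n1 s1 where 1: "fst s a \<noteq> 0" "exec_unit xs c s n1 s1" "n1 \<le> N" "Inv i s1"
      using assms(2) unfolding runs_def by (metis Suc_le_lessD)
    with Suc obtain n2 s2 where 2: "exec_unit xs (WhileNZ a c) s1 n2 s2" "n2 \<le> i * Suc N + 1" "Q s2"
      unfolding runs_def by (metis Suc_leD)
    show ?case using exec_unit.WhileTrue[OF 1(1,2) 2(1)] 1 2 unfolding runs_def
      by (intro exI[of _ "1 + n1 + n2"] exI[of _ s2]) simp
  qed
  from this[OF assms(1)] show ?thesis by simp
qed

section \<open>A language of bounded loops with arrays\<close>

text \<open>One factor of a product must be a register because it becomes the iteration count of the
  addition loop that computes the product.\<close>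

datatype exp =
    Num nat
  | Var nat
  | Plus exp exp (infixl "\<oplus>" 65)
  | Minus exp exp (infixl "\<ominus>" 65)
  | Times nat exp
  | Arr nat exp
  | Inp exp

text \<open>With counted loops only, the meaning of a program is a total function defined by
  recursion on syntax, and its running time can be read off the syntax.\<close>

datatype com =
    Nop
  | Assign nat exp ("_ ::= _" [80, 60] 60)
  | Update nat exp exp
  | Out exp
  | Then com com (infixr ";;" 50)
  | Cond exp com com
  | For nat nat com

record store =
  reg :: "nat \<Rightarrow> nat"
  arr :: "nat \<Rightarrow> nat \<Rightarrow> nat"
  out :: "nat list"

fun val :: "nat list \<Rightarrow> exp \<Rightarrow> store \<Rightarrow> nat" where
  "val xs (Num c) s = c"
| "val xs (Var x) s = reg s x"
| "val xs (e1 \<oplus> e2) s = val xs e1 s + val xs e2 s"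
| "val xs (e1 \<ominus> e2) s = val xs e1 s - val xs e2 s"
| "val xs (Times b e) s = reg s b * val xs e s"
| "val xs (Arr a e) s = arr s a (val xs e s)"
| "val xs (Inp e) s = input_at xs (val xs e s)"

definition set_reg :: "nat \<Rightarrow> nat \<Rightarrow> store \<Rightarrow> store" where
  "set_reg x v s = s\<lparr>reg := (reg s)(x := v)\<rparr>"

definition set_arr :: "nat \<Rightarrow> nat \<Rightarrow> nat \<Rightarrow> store \<Rightarrow> store" where
  "set_arr a i v s = s\<lparr>arr := (arr s)(a := (arr s a)(i := v))\<rparr>"

definition emit :: "nat \<Rightarrow> store \<Rightarrow> store" where
  "emit v s = s\<lparr>out := out s @ [v]\<rparr>"

lemma store_simps [simp]:
  "reg (set_reg x v s) y = (if y = x then v else reg s y)"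
  "arr (set_reg x v s) = arr s" "out (set_reg x v s) = out s"
  "reg (set_arr a i v s) = reg s"
  "arr (set_arr a i v s) b = (if b = a then (arr s a)(i := v) else arr s b)"
  "out (set_arr a i v s) = out s"
  "reg (emit v s) = reg s" "arr (emit v s) = arr s" "out (emit v s) = out s @ [v]"
  by (simp_all add: set_reg_def set_arr_def emit_def)

fun den :: "nat list \<Rightarrow> com \<Rightarrow> store \<Rightarrow> store" where
  "den xs Nop s = s"
| "den xs (x ::= e) s = set_reg x (val xs e s) s"
| "den xs (Update a e1 e2) s = set_arr a (val xs e1 s) (val xs e2 s) s"
| "den xs (Out e) s = emit (val xs e s) s"
| "den xs (c1 ;; c2) s = den xs c2 (den xs c1 s)"
| "den xs (Cond e c1 c2) s = (if val xs e s \<noteq> 0 then den xs c1 s else den xs c2 s)"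
| "den xs (For x b c) s = fold (\<lambda>i s. den xs c (set_reg x i s)) [0..<reg s b] s"

text \<open>Registers whose values limit how often some loop runs, including the hidden loops of
  products. A common upper bound of them is the argument of the polynomials \<open>exp_steps\<close>
  and \<open>steps\<close>.\<close>

fun exp_bounds :: "exp \<Rightarrow> nat set" where
  "exp_bounds (e1 \<oplus> e2) = exp_bounds e1 \<union> exp_bounds e2"
| "exp_bounds (e1 \<ominus> e2) = exp_bounds e1 \<union> exp_bounds e2"
| "exp_bounds (Times b e) = insert b (exp_bounds e)"
| "exp_bounds (Arr a e) = exp_bounds e"
| "exp_bounds (Inp e) = exp_bounds e"
| "exp_bounds _ = {}"

fun bounds :: "com \<Rightarrow> nat set" where
  "bounds Nop = {}"
| "bounds (x ::= e) = exp_bounds e"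
| "bounds (Update a e1 e2) = exp_bounds e1 \<union> exp_bounds e2"
| "bounds (Out e) = exp_bounds e"
| "bounds (c1 ;; c2) = bounds c1 \<union> bounds c2"
| "bounds (Cond e c1 c2) = exp_bounds e \<union> bounds c1 \<union> bounds c2"
| "bounds (For x b c) = insert b (bounds c)"

fun reg_writes :: "com \<Rightarrow> nat set" where
  "reg_writes (x ::= e) = {x}"
| "reg_writes (c1 ;; c2) = reg_writes c1 \<union> reg_writes c2"
| "reg_writes (Cond e c1 c2) = reg_writes c1 \<union> reg_writes c2"
| "reg_writes (For x b c) = insert x (reg_writes c)"
| "reg_writes _ = {}"

fun arr_writes :: "com \<Rightarrow> nat set" where
  "arr_writes (Update a e1 e2) = {a}"
| "arr_writes (c1 ;; c2) = arr_writes c1 \<union> arr_writes c2"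
| "arr_writes (Cond e c1 c2) = arr_writes c1 \<union> arr_writes c2"
| "arr_writes (For x b c) = arr_writes c"
| "arr_writes _ = {}"

fun silent :: "com \<Rightarrow> bool" where
  "silent (Out e) = False"
| "silent (c1 ;; c2) = (silent c1 \<and> silent c2)"
| "silent (Cond e c1 c2) = (silent c1 \<and> silent c2)"
| "silent (For x b c) = silent c"
| "silent _ = True"

definition frame :: "com \<Rightarrow> store \<Rightarrow> store \<Rightarrow> bool" where
  "frame c s s' \<longleftrightarrow> (\<forall>x. x \<notin> reg_writes c \<longrightarrow> reg s' x = reg s x) \<and>
     (\<forall>a. a \<notin> arr_writes c \<longrightarrow> arr s' a = arr s a) \<and> (silent c \<longrightarrow> out s' = out s)"

lemma fold_upt_invariant:
  assumes "I 0 s" and "\<And>i s. i < n \<Longrightarrow> I i s \<Longrightarrow> I (Suc i) (f i s)"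
  shows "I n (fold f [0..<n] s)"
  using assms by (induction n) auto

lemma frame_fold:
  assumes "\<And>s. frame c s (den xs c s)"
  shows "frame (For x b c) s (fold (\<lambda>i s. den xs c (set_reg x i s)) [0..<n] s)"
proof (rule fold_upt_invariant[where I = "\<lambda>_. frame (For x b c) s"])
  fix i s'
  assume "frame (For x b c) s s'"
  then show "frame (For x b c) s (den xs c (set_reg x i s'))"
    using assms[of "set_reg x i s'"] by (auto simp: frame_def)
qed (simp add: frame_def)

lemma frame_den: "frame c s (den xs c s)"
proof (induction c arbitrary: s)
  case (Then c1 c2)
  from Then(1)[of s] Then(2)[of "den xs c1 s"] show ?case by (simp add: frame_def)
next
  case (Cond e c1 c2)
  from Cond(1)[of s] Cond(2)[of s] show ?case by (simp add: frame_def)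
next
  case (For x b c)
  then show ?case unfolding den.simps by (rule frame_fold)
qed (auto simp: frame_def)

text \<open>Each iteration may assume the frame relative to the initial store \<open>s\<close>, so
  \<open>I\<close> has to mention only what the loop changes.\<close>

lemma den_For_invariant:
  assumes "I 0 s"
    and "\<And>i s'. i < reg s b \<Longrightarrow> I i s' \<Longrightarrow> frame (For x b c) s s' \<Longrightarrow>
      I (Suc i) (den xs c (set_reg x i s'))"
  shows "I (reg s b) (den xs (For x b c) s)"
proof -
  have "I n (fold (\<lambda>i s. den xs c (set_reg x i s)) [0..<n] s)" if "n \<le> reg s b" for n
    using that
  proof (induction n)
    case (Suc n)
    then show ?case using assms(2)[OF _ _ frame_fold[OF frame_den]] by simp
  qed (simp add: assms(1))
  then show ?thesis by simp
qed

section \<open>Compilation of bounded loops to machine programs\<close>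

text \<open>Registers are the addresses below 32, array \<open>a < 16\<close> occupies the addresses
  \<open>64 + a + 16 * i\<close>, and the addresses from 32 to 63 hold temporaries.\<close>

definition address :: "nat \<Rightarrow> nat \<Rightarrow> prog \<Rightarrow> prog" where
  "address t a c = Seq (Instr (Add t t t)) (Seq (Instr (Add t t t)) (Seq (Instr (Add t t t))
     (Seq (Instr (Add t t t)) (Seq (Instr (Const (t + 1) (64 + a)))
     (Seq (Instr (Add (t + 1) (t + 1) t)) c)))))"

text \<open>Temporaries form a stack: the value goes to \<open>t\<close> and the cells above are
  free, so the second operand of a sum is evaluated at \<open>t + 1\<close>.\<close>

fun compile_exp :: "exp \<Rightarrow> nat \<Rightarrow> prog" where
  "compile_exp (Num c) t = Instr (Const t c)"
| "compile_exp (Var x) t = Seq (Instr (Const t 0)) (Instr (Add t x t))"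
| "compile_exp (e1 \<oplus> e2) t = Seq (compile_exp e1 t) (Seq (compile_exp e2 (t + 1)) (Instr (Add t t (t + 1))))"
| "compile_exp (e1 \<ominus> e2) t = Seq (compile_exp e1 t) (Seq (compile_exp e2 (t + 1)) (Instr (Sub t t (t + 1))))"
| "compile_exp (Times b e) t = Seq (compile_exp e (t + 1))
     (Seq (Instr (Const t 0)) (Seq (Instr (Const (t + 2) 0)) (Seq (Instr (Add (t + 2) b (t + 2)))
     (WhileNZ (t + 2) (Seq (Instr (Add t t (t + 1)))
       (Seq (Instr (Const (t + 3) 1)) (Instr (Sub (t + 2) (t + 2) (t + 3)))))))))"
| "compile_exp (Arr a e) t = Seq (compile_exp e t) (address t a (Instr (Load t (t + 1))))"
| "compile_exp (Inp e) t = Seq (compile_exp e t) (Instr (Read t t))"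

text \<open>A loop keeps in \<open>t\<close> the number of iterations left, and \<open>b - t\<close>
  recovers the running index counted from 0. This is why the body must not write \<open>b\<close>
  and uses temporaries from \<open>t + 1\<close> on.\<close>

fun compile :: "com \<Rightarrow> nat \<Rightarrow> prog" where
  "compile Nop t = Skip"
| "compile (x ::= e) t =
     Seq (compile_exp e t) (Seq (Instr (Const (t + 1) 0)) (Instr (Add x t (t + 1))))"
| "compile (Update a e1 e2) t =
     Seq (compile_exp e1 t) (address t a (Seq (compile_exp e2 (t + 2)) (Instr (Store (t + 1) (t + 2)))))"
| "compile (Out e) t = Seq (compile_exp e t) (Instr (Print t))"
| "compile (c1 ;; c2) t = Seq (compile c1 t) (compile c2 t)"
| "compile (Cond e c1 c2) t = Seq (compile_exp e t) (IfNZ t (compile c1 t) (compile c2 t))"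
| "compile (For x b c) t = Seq (Instr (Const t 0)) (Seq (Instr (Add t b t))
     (WhileNZ t (Seq (Instr (Sub x b t)) (Seq (compile c (t + 1))
       (Seq (Instr (Const (t + 1) 1)) (Instr (Sub t t (t + 1))))))))"

fun wf_exp :: "exp \<Rightarrow> nat \<Rightarrow> bool" where
  "wf_exp (Num c) t = (t < 64)"
| "wf_exp (Var x) t = (x < 32 \<and> t < 64)"
| "wf_exp (e1 \<oplus> e2) t = (wf_exp e1 t \<and> wf_exp e2 (t + 1))"
| "wf_exp (e1 \<ominus> e2) t = (wf_exp e1 t \<and> wf_exp e2 (t + 1))"
| "wf_exp (Times b e) t = (b < 32 \<and> wf_exp e (t + 1) \<and> t + 3 < 64)"
| "wf_exp (Arr a e) t = (a < 16 \<and> wf_exp e t \<and> t + 1 < 64)"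
| "wf_exp (Inp e) t = wf_exp e t"

fun wf_com :: "com \<Rightarrow> nat \<Rightarrow> bool" where
  "wf_com Nop t = True"
| "wf_com (x ::= e) t = (x < 32 \<and> wf_exp e t \<and> t + 1 < 64)"
| "wf_com (Update a e1 e2) t = (a < 16 \<and> wf_exp e1 t \<and> wf_exp e2 (t + 2))"
| "wf_com (Out e) t = wf_exp e t"
| "wf_com (c1 ;; c2) t = (wf_com c1 t \<and> wf_com c2 t)"
| "wf_com (Cond e c1 c2) t = (wf_exp e t \<and> wf_com c1 t \<and> wf_com c2 t)"
| "wf_com (For x b c) t = (x < 32 \<and> b < 32 \<and> x \<noteq> b \<and> b \<notin> reg_writes c \<and> wf_com c (t + 1) \<and> t + 1 < 64)"

text \<open>The 7 counts the six instructions of \<open>address\<close> and one access. In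
  \<open>[:4, 4:]\<close> there are three initialisations, the last test and four steps per
  iteration.\<close>

fun exp_steps :: "exp \<Rightarrow> nat poly" where
  "exp_steps (Num c) = [:1:]"
| "exp_steps (Var x) = [:2:]"
| "exp_steps (e1 \<oplus> e2) = exp_steps e1 + exp_steps e2 + [:1:]"
| "exp_steps (e1 \<ominus> e2) = exp_steps e1 + exp_steps e2 + [:1:]"
| "exp_steps (Times b e) = exp_steps e + [:4, 4:]"
| "exp_steps (Arr a e) = exp_steps e + [:7:]"
| "exp_steps (Inp e) = exp_steps e + [:1:]"

text \<open>Both branches of \<open>Cond\<close> are added, which avoids a maximum of polynomials. A
  loop spends 3 steps outside its iterations, and 4 per iteration besides the body.\<close>

fun steps :: "com \<Rightarrow> nat poly" where
  "steps Nop = [:1:]"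
| "steps (x ::= e) = exp_steps e + [:2:]"
| "steps (Update a e1 e2) = exp_steps e1 + exp_steps e2 + [:7:]"
| "steps (Out e) = exp_steps e + [:1:]"
| "steps (c1 ;; c2) = steps c1 + steps c2"
| "steps (Cond e c1 c2) = exp_steps e + steps c1 + steps c2 + [:1:]"
| "steps (For x b c) = [:3:] + [:0, 1:] * (steps c + [:4:])"

definition represents :: "store \<Rightarrow> state \<Rightarrow> bool" where
  "represents s \<sigma> \<longleftrightarrow> (\<forall>x<32. fst \<sigma> x = reg s x) \<and>
     (\<forall>a<16. \<forall>i. fst \<sigma> (64 + a + 16 * i) = arr s a i) \<and> snd \<sigma> = out s"

text \<open>Unbounded arrays share one memory by interleaving: the residue modulo 16 identifies the
  array.\<close>

lemma address_eq_iff: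
  fixes a b :: nat
  assumes "a < 16" "b < 16"
  shows "64 + a + 16 * i = 64 + b + 16 * j \<longleftrightarrow> a = b \<and> i = j"
proof
  assume "64 + a + 16 * i = 64 + b + 16 * j"
  then have *: "a + 16 * i = b + 16 * j" by simp
  from arg_cong[OF *, of "\<lambda>z. z mod 16"] assms have "a = b" by simp
  with * show "a = b \<and> i = j" by simp
qed simp

text \<open>The cells below \<open>t\<close> hold registers and pending values of the enclosing
  code, those from 64 on hold the arrays; evaluating an expression must disturb neither.\<close>

definition same_outside :: "nat \<Rightarrow> state \<Rightarrow> state \<Rightarrow> bool" where
  "same_outside t \<sigma> \<sigma>' \<longleftrightarrow> (\<forall>a. a < t \<or> 64 \<le> a \<longrightarrow> fst \<sigma>' a = fst \<sigma> a) \<and> snd \<sigma>' = snd \<sigma>"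

lemma represents_same_outside:
  "represents s \<sigma> \<Longrightarrow> same_outside t \<sigma> \<sigma>' \<Longrightarrow> 32 \<le> t \<Longrightarrow> represents s \<sigma>'"
  by (auto simp: represents_def same_outside_def)

lemma runs_address:
  assumes "runs xs c (\<sigma>1, snd \<sigma>) N Q"
    and "\<sigma>1 = (fst \<sigma>)(t := 16 * fst \<sigma> t, t + 1 := 64 + a + 16 * fst \<sigma> t)"
  shows "runs xs (address t a c) \<sigma> (N + 6) Q"
proof -
  obtain m out where \<sigma>: "\<sigma> = (m, out)" by fastforce
  \<comment> \<open>The product is spelled out as the nested doublings that symbolic execution of
    \<open>address\<close> yields.\<close>
  have double: "16 * m t = m t + m t + (m t + m t) + (m t + m t + (m t + m t)) +
      (m t + m t + (m t + m t) + (m t + m t + (m t + m t)))" by simp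
  have "runs xs c (m(t := 16 * m t, t + 1 := 64 + a + 16 * m t), out) N Q"
    using assms by (simp add: \<sigma>)
  then have "runs xs (address t a c) (m, out) (Suc (Suc (Suc (Suc (Suc (Suc N)))))) Q"
    unfolding address_def double
    by (intro runs_Instr_Seq) (simp add: fun_upd_twist[of t "Suc t"] add_ac)
  then show ?thesis by (simp add: \<sigma> numeral_eq_Suc)
qed

lemma same_outside_refl [simp]: "same_outside t \<sigma> \<sigma>"
  by (simp add: same_outside_def)

lemma same_outside_trans:
  "same_outside t \<sigma> \<sigma>' \<Longrightarrow> same_outside u \<sigma>' \<sigma>'' \<Longrightarrow> t \<le> u \<Longrightarrow> same_outside t \<sigma> \<sigma>''"
  by (auto simp: same_outside_def)

lemma same_outside_upd [simp]:
  "same_outside t \<sigma> (m(a := v), out') \<longleftrightarrow> same_outside t \<sigma> (m, out')" if "t \<le> a" "a < 64"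
  using that by (auto simp: same_outside_def)

lemma runs_times_loop:
  assumes "t + 3 < 64" "m t = 0"
  shows "runs xs (WhileNZ (t + 2) (Seq (Instr (Add t t (t + 1)))
      (Seq (Instr (Const (t + 3) 1)) (Instr (Sub (t + 2) (t + 2) (t + 3)))))) (m, out')
    (4 * m (t + 2) + 1) (\<lambda>\<sigma>. same_outside t (m, out') \<sigma> \<and> fst \<sigma> t = m (t + 2) * m (t + 1))"
proof -
  define n v where "n = m (t + 2)" and "v = m (t + 1)"
  let ?I = "\<lambda>i \<sigma>. same_outside t (m, out') \<sigma> \<and> i \<le> n \<and> fst \<sigma> t = (n - i) * v \<and>
    fst \<sigma> (t + 1) = v \<and> fst \<sigma> (t + 2) = i"
  have "runs xs (WhileNZ (t + 2) (Seq (Instr (Add t t (t + 1)))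
      (Seq (Instr (Const (t + 3) 1)) (Instr (Sub (t + 2) (t + 2) (t + 3)))))) (m, out')
    (n * Suc 3 + 1) (\<lambda>\<sigma>. same_outside t (m, out') \<sigma> \<and> fst \<sigma> t = n * v)"
  proof (rule runs_While[where Inv = ?I])
    show "?I n (m, out')" using assms by (simp add: n_def v_def)
  next
    fix i and \<sigma> :: state
    assume I: "?I (Suc i) \<sigma>"
    obtain m' out'' where \<sigma>: "\<sigma> = (m', out'')" by fastforce
    have "(n - Suc i) * v + v = (n - i) * v"
      using I by (metis Suc_diff_le add.commute diff_Suc_Suc mult_Suc)
    then have "runs xs (Seq (Instr (Add t t (t + 1)))
      (Seq (Instr (Const (t + 3) 1)) (Instr (Sub (t + 2) (t + 2) (t + 3))))) \<sigma> (Suc (Suc 1)) (?I i)"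
      using I assms(1) unfolding \<sigma> by (intro runs_Instr_Seq runs_Instr) simp
    then show "fst \<sigma> (t + 2) \<noteq> 0 \<and> runs xs (Seq (Instr (Add t t (t + 1)))
      (Seq (Instr (Const (t + 3) 1)) (Instr (Sub (t + 2) (t + 2) (t + 3))))) \<sigma> 3 (?I i)"
      using I by (simp add: numeral_eq_Suc)
  qed auto
  then show ?thesis by (simp add: n_def v_def mult.commute)
qed

lemma wf_exp_less: "wf_exp e t \<Longrightarrow> t < 64"
  by (induction e arbitrary: t) auto

lemma runs_compile_exp:
  assumes "represents s \<sigma>" "wf_exp e t" "32 \<le> t" "\<forall>b \<in> exp_bounds e. reg s b \<le> N"
  shows "runs xs (compile_exp e t) \<sigma> (poly (exp_steps e) N)
    (\<lambda>\<sigma>'. same_outside t \<sigma> \<sigma>' \<and> fst \<sigma>' t = val xs e s)"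
  using assms
proof (induction e arbitrary: t \<sigma>)
  case (Num c)
  obtain m out' where \<sigma>: "\<sigma> = (m, out')" by fastforce
  show ?case using runs_Instr Num unfolding \<sigma> by (auto intro!: runs_Instr[THEN runs_mono])
next
  case (Var x)
  obtain m out' where \<sigma>: "\<sigma> = (m, out')" by fastforce
  have "runs xs (compile_exp (Var x) t) \<sigma> (Suc 1)
      (\<lambda>\<sigma>'. same_outside t \<sigma> \<sigma>' \<and> fst \<sigma>' t = val xs (Var x) s)"
    using Var unfolding \<sigma> compile_exp.simps
    by (intro runs_Instr_Seq runs_Instr) (simp add: represents_def)
  then show ?case by (rule runs_mono) auto
next
  case (Plus e1 e2)
  have "runs xs (compile_exp (e1 \<oplus> e2) t) \<sigma> (poly (exp_steps e1) N + (poly (exp_steps e2) N + 1))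
      (\<lambda>\<sigma>'. same_outside t \<sigma> \<sigma>' \<and> fst \<sigma>' t = val xs (e1 \<oplus> e2) s)"
    unfolding compile_exp.simps
  proof (rule runs_Seq, rule runs_mono[OF Plus.IH(1)])
    fix \<sigma>1 assume 1: "same_outside t \<sigma> \<sigma>1 \<and> fst \<sigma>1 t = val xs e1 s"
    then have "represents s \<sigma>1" using represents_same_outside Plus.prems by blast
    show "runs xs (Seq (compile_exp e2 (t + 1)) (Instr (Add t t (t + 1)))) \<sigma>1 (poly (exp_steps e2) N + 1)
      (\<lambda>\<sigma>'. same_outside t \<sigma> \<sigma>' \<and> fst \<sigma>' t = val xs (e1 \<oplus> e2) s)"
    proof (rule runs_Seq, rule runs_mono[OF Plus.IH(2)[of \<sigma>1 "t + 1"] order_refl])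
      fix \<sigma>2 assume 2: "same_outside (t + 1) \<sigma>1 \<sigma>2 \<and> fst \<sigma>2 (t + 1) = val xs e2 s"
      obtain m out' where \<sigma>2: "\<sigma>2 = (m, out')" by fastforce
      \<comment> \<open>The second operand was evaluated from \<open>t + 1\<close> on, so the first
        one is still in \<open>t\<close>.\<close>
      have "fst \<sigma>2 t = val xs e1 s" using 1 2 by (simp add: same_outside_def)
      moreover have "same_outside t \<sigma> \<sigma>2" using 1 2 same_outside_trans[of t \<sigma> \<sigma>1 "t + 1" \<sigma>2] by simp
      ultimately show "runs xs (Instr (Add t t (t + 1))) \<sigma>2 1
        (\<lambda>\<sigma>'. same_outside t \<sigma> \<sigma>' \<and> fst \<sigma>' t = val xs (e1 \<oplus> e2) s)"
        using 2 Plus.prems wf_exp_less[of e1 t] unfolding \<sigma>2 by (intro runs_Instr) simp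
    qed (use Plus.prems \<open>represents s \<sigma>1\<close> in auto)
  qed (use Plus.prems in auto)
  then show ?case by (rule runs_mono) auto
next
  case (Minus e1 e2)
  have "runs xs (compile_exp (e1 \<ominus> e2) t) \<sigma> (poly (exp_steps e1) N + (poly (exp_steps e2) N + 1))
      (\<lambda>\<sigma>'. same_outside t \<sigma> \<sigma>' \<and> fst \<sigma>' t = val xs (e1 \<ominus> e2) s)"
    unfolding compile_exp.simps
  proof (rule runs_Seq, rule runs_mono[OF Minus.IH(1)])
    fix \<sigma>1 assume 1: "same_outside t \<sigma> \<sigma>1 \<and> fst \<sigma>1 t = val xs e1 s"
    then have "represents s \<sigma>1" using represents_same_outside Minus.prems by blast
    show "runs xs (Seq (compile_exp e2 (t + 1)) (Instr (Sub t t (t + 1)))) \<sigma>1 (poly (exp_steps e2) N + 1)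
      (\<lambda>\<sigma>'. same_outside t \<sigma> \<sigma>' \<and> fst \<sigma>' t = val xs (e1 \<ominus> e2) s)"
    proof (rule runs_Seq, rule runs_mono[OF Minus.IH(2)[of \<sigma>1 "t + 1"] order_refl])
      fix \<sigma>2 assume 2: "same_outside (t + 1) \<sigma>1 \<sigma>2 \<and> fst \<sigma>2 (t + 1) = val xs e2 s"
      obtain m out' where \<sigma>2: "\<sigma>2 = (m, out')" by fastforce
      have "fst \<sigma>2 t = val xs e1 s" using 1 2 by (simp add: same_outside_def)
      moreover have "same_outside t \<sigma> \<sigma>2" using 1 2 same_outside_trans[of t \<sigma> \<sigma>1 "t + 1" \<sigma>2] by simp
      ultimately show "runs xs (Instr (Sub t t (t + 1))) \<sigma>2 1
        (\<lambda>\<sigma>'. same_outside t \<sigma> \<sigma>' \<and> fst \<sigma>' t = val xs (e1 \<ominus> e2) s)"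
        using 2 Minus.prems wf_exp_less[of e1 t] unfolding \<sigma>2 by (intro runs_Instr) simp
    qed (use Minus.prems \<open>represents s \<sigma>1\<close> in auto)
  qed (use Minus.prems in auto)
  then show ?case by (rule runs_mono) auto
next
  case (Times b e)
  have "runs xs (compile_exp (Times b e) t) \<sigma>
      (poly (exp_steps e) N + Suc (Suc (Suc (4 * reg s b + 1))))
      (\<lambda>\<sigma>'. same_outside t \<sigma> \<sigma>' \<and> fst \<sigma>' t = val xs (Times b e) s)"
    unfolding compile_exp.simps
  proof (rule runs_Seq, rule runs_mono[OF Times.IH[of \<sigma> "t + 1"]])
    fix \<sigma>1 assume 1: "same_outside (t + 1) \<sigma> \<sigma>1 \<and> fst \<sigma>1 (t + 1) = val xs e s"
    have rep: "represents s \<sigma>1"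
      by (rule represents_same_outside[of s \<sigma> "t + 1"]) (use 1 Times.prems in auto)
    obtain m out' where \<sigma>1: "\<sigma>1 = (m, out')" by fastforce
    have b: "m b = reg s b" "b < t" using rep Times.prems by (auto simp: represents_def \<sigma>1)
    define m2 where "m2 = m(t := 0, t + 2 := m b)"
    have so: "same_outside t \<sigma> (m2, out')"
      using same_outside_trans[of t \<sigma> \<sigma> "t + 1" \<sigma>1] 1 Times.prems unfolding m2_def \<sigma>1 by simp
    have m2: "m2 t = 0" "m2 (t + 2) = reg s b" "m2 (t + 1) = val xs e s"
      using 1 b unfolding m2_def \<sigma>1 by auto
    have "runs xs (WhileNZ (t + 2) (Seq (Instr (Add t t (t + 1)))
        (Seq (Instr (Const (t + 3) 1)) (Instr (Sub (t + 2) (t + 2) (t + 3)))))) (m2, out')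
        (4 * reg s b + 1) (\<lambda>\<sigma>'. same_outside t \<sigma> \<sigma>' \<and> fst \<sigma>' t = val xs (Times b e) s)"
      by (rule runs_mono[OF runs_times_loop])
        (use m2 Times.prems same_outside_trans[OF so] in auto)
    then show "runs xs (Seq (Instr (Const t 0)) (Seq (Instr (Const (t + 2) 0))
        (Seq (Instr (Add (t + 2) b (t + 2))) (WhileNZ (t + 2) (Seq (Instr (Add t t (t + 1)))
        (Seq (Instr (Const (t + 3) 1)) (Instr (Sub (t + 2) (t + 2) (t + 3))))))))) \<sigma>1
        (Suc (Suc (Suc (4 * reg s b + 1))))
        (\<lambda>\<sigma>'. same_outside t \<sigma> \<sigma>' \<and> fst \<sigma>' t = val xs (Times b e) s)"
      using b unfolding \<sigma>1 by (intro runs_Instr_Seq) (simp add: m2_def)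
  qed (use Times.prems in auto)
  then show ?case by (rule runs_mono) (use Times.prems in auto)
next
  case (Arr a e)
  have "runs xs (compile_exp (Arr a e) t) \<sigma> (poly (exp_steps e) N + (1 + 6))
      (\<lambda>\<sigma>'. same_outside t \<sigma> \<sigma>' \<and> fst \<sigma>' t = val xs (Arr a e) s)"
    unfolding compile_exp.simps
  proof (rule runs_Seq, rule runs_mono[OF Arr.IH])
    fix \<sigma>1 assume 1: "same_outside t \<sigma> \<sigma>1 \<and> fst \<sigma>1 t = val xs e s"
    then have rep: "represents s \<sigma>1" using represents_same_outside Arr.prems by blast
    obtain m out' where \<sigma>1: "\<sigma>1 = (m, out')" by fastforce
    show "runs xs (address t a (Instr (Load t (t + 1)))) \<sigma>1 (1 + 6)
      (\<lambda>\<sigma>'. same_outside t \<sigma> \<sigma>' \<and> fst \<sigma>' t = val xs (Arr a e) s)"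
      by (rule runs_address[OF runs_Instr refl])
        (use 1 rep Arr.prems in \<open>auto simp: \<sigma>1 represents_def\<close>)
  qed (use Arr.prems in auto)
  then show ?case by (rule runs_mono) auto
next
  case (Inp e)
  have "runs xs (compile_exp (Inp e) t) \<sigma> (poly (exp_steps e) N + 1)
      (\<lambda>\<sigma>'. same_outside t \<sigma> \<sigma>' \<and> fst \<sigma>' t = val xs (Inp e) s)"
    unfolding compile_exp.simps
  proof (rule runs_Seq, rule runs_mono[OF Inp.IH])
    fix \<sigma>1 assume 1: "same_outside t \<sigma> \<sigma>1 \<and> fst \<sigma>1 t = val xs e s"
    obtain m out' where \<sigma>1: "\<sigma>1 = (m, out')" by fastforce
    show "runs xs (Instr (Read t t)) \<sigma>1 1
      (\<lambda>\<sigma>'. same_outside t \<sigma> \<sigma>' \<and> fst \<sigma>' t = val xs (Inp e) s)"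
      using 1 Inp.prems wf_exp_less[of e t] unfolding \<sigma>1 by (intro runs_Instr) simp
  qed (use Inp.prems in auto)
  then show ?case by (rule runs_mono) auto
qed

text \<open>The conclusion about temporaries below \<open>t\<close> protects the counters of
  enclosing loops. As no bound register is ever written, the same \<open>N\<close> serves for every
  subprogram.\<close>

lemma runs_compile:
  assumes "represents s \<sigma>" "wf_com c t" "32 \<le> t" "\<forall>b \<in> bounds c. reg s b \<le> N"
    "bounds c \<inter> reg_writes c = {}"
  shows "runs xs (compile c t) \<sigma> (poly (steps c) N)
    (\<lambda>\<sigma>'. represents (den xs c s) \<sigma>' \<and> (\<forall>a. 32 \<le> a \<and> a < t \<longrightarrow> fst \<sigma>' a = fst \<sigma> a))"
  using assms
proof (induction c arbitrary: t \<sigma> s)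
  case Nop
  have "runs xs (compile Nop t) \<sigma> 1
      (\<lambda>\<sigma>'. represents (den xs Nop s) \<sigma>' \<and> (\<forall>a. 32 \<le> a \<and> a < t \<longrightarrow> fst \<sigma>' a = fst \<sigma> a))"
    unfolding compile.simps by (rule runs_Skip) (use Nop in auto)
  then show ?case by (rule runs_mono) auto
next
  case (Assign x e)
  have "runs xs (compile (x ::= e) t) \<sigma> (poly (exp_steps e) N + Suc 1)
      (\<lambda>\<sigma>'. represents (den xs (x ::= e) s) \<sigma>' \<and> (\<forall>a. 32 \<le> a \<and> a < t \<longrightarrow> fst \<sigma>' a = fst \<sigma> a))"
    unfolding compile.simps
  proof (rule runs_Seq, rule runs_mono[OF runs_compile_exp])
    fix \<sigma>1 assume 1: "same_outside t \<sigma> \<sigma>1 \<and> fst \<sigma>1 t = val xs e s"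
    then have rep: "represents s \<sigma>1" using represents_same_outside Assign.prems by blast
    obtain m out' where \<sigma>1: "\<sigma>1 = (m, out')" by fastforce
    show "runs xs (Seq (Instr (Const (t + 1) 0)) (Instr (Add x t (t + 1)))) \<sigma>1 (Suc 1)
      (\<lambda>\<sigma>'. represents (den xs (x ::= e) s) \<sigma>' \<and> (\<forall>a. 32 \<le> a \<and> a < t \<longrightarrow> fst \<sigma>' a = fst \<sigma> a))"
      using 1 rep Assign.prems unfolding \<sigma>1
      by (intro runs_Instr_Seq runs_Instr) (auto simp: represents_def same_outside_def)
  qed (use Assign.prems in auto)
  then show ?case by (rule runs_mono) auto
next
  case (Update b e1 e2)
  have "runs xs (compile (Update b e1 e2) t) \<sigma> (poly (exp_steps e1) N + (poly (exp_steps e2) N + 1 + 6))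
      (\<lambda>\<sigma>'. represents (den xs (Update b e1 e2) s) \<sigma>' \<and>
        (\<forall>a. 32 \<le> a \<and> a < t \<longrightarrow> fst \<sigma>' a = fst \<sigma> a))"
    unfolding compile.simps
  proof (rule runs_Seq, rule runs_mono[OF runs_compile_exp])
    fix \<sigma>1 assume 1: "same_outside t \<sigma> \<sigma>1 \<and> fst \<sigma>1 t = val xs e1 s"
    then have rep: "represents s \<sigma>1" using represents_same_outside Update.prems by blast
    define \<sigma>2 where
      "\<sigma>2 = ((fst \<sigma>1)(t := 16 * fst \<sigma>1 t, t + 1 := 64 + b + 16 * fst \<sigma>1 t), snd \<sigma>1)"
    have t: "t + 2 < 64" using Update.prems wf_exp_less[of e2 "t + 2"] by simp
    have 2: "same_outside t \<sigma> \<sigma>2"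
      using 1 t unfolding \<sigma>2_def by simp
    then have rep2: "represents s \<sigma>2" using represents_same_outside Update.prems by blast
    show "runs xs (address t b (Seq (compile_exp e2 (t + 2)) (Instr (Store (t + 1) (t + 2))))) \<sigma>1
      (poly (exp_steps e2) N + 1 + 6)
      (\<lambda>\<sigma>'. represents (den xs (Update b e1 e2) s) \<sigma>' \<and>
        (\<forall>a. 32 \<le> a \<and> a < t \<longrightarrow> fst \<sigma>' a = fst \<sigma> a))"
    proof (rule runs_address[OF _ refl], fold \<sigma>2_def, rule runs_Seq,
        rule runs_mono[OF runs_compile_exp[OF rep2]])
      fix \<sigma>3 assume 3: "same_outside (t + 2) \<sigma>2 \<sigma>3 \<and> fst \<sigma>3 (t + 2) = val xs e2 s"
      obtain m out' where \<sigma>3: "\<sigma>3 = (m, out')" by fastforce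
      have "represents s \<sigma>3" using 3 rep2 represents_same_outside Update.prems by fastforce
      moreover have "m (t + 1) = 64 + b + 16 * val xs e1 s"
        using 3 1 unfolding \<sigma>3 by (simp add: same_outside_def \<sigma>2_def)
      moreover have "(64 + c + 16 * i = 64 + b + 16 * j) = (c = b \<and> i = j)"
        if "c < 16" "b < 16" for c i j :: nat using that by (rule address_eq_iff)
      moreover have "\<forall>a. 32 \<le> a \<and> a < t \<longrightarrow> m a = fst \<sigma> a"
        using 3 2 unfolding \<sigma>3 by (simp add: same_outside_def)
      ultimately show "runs xs (Instr (Store (t + 1) (t + 2))) \<sigma>3 1
        (\<lambda>\<sigma>'. represents (den xs (Update b e1 e2) s) \<sigma>' \<and>
          (\<forall>a. 32 \<le> a \<and> a < t \<longrightarrow> fst \<sigma>' a = fst \<sigma> a))"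
        using 3 t Update.prems unfolding \<sigma>3 by (intro runs_Instr) (simp add: represents_def)
    qed (use Update.prems in auto)
  qed (use Update.prems in auto)
  then show ?case by (rule runs_mono) auto
next
  case (Out e)
  have "runs xs (compile (Out e) t) \<sigma> (poly (exp_steps e) N + 1)
      (\<lambda>\<sigma>'. represents (den xs (Out e) s) \<sigma>' \<and> (\<forall>a. 32 \<le> a \<and> a < t \<longrightarrow> fst \<sigma>' a = fst \<sigma> a))"
    unfolding compile.simps
  proof (rule runs_Seq, rule runs_mono[OF runs_compile_exp])
    fix \<sigma>1 assume 1: "same_outside t \<sigma> \<sigma>1 \<and> fst \<sigma>1 t = val xs e s"
    then have rep: "represents s \<sigma>1" using represents_same_outside Out.prems by blast
    obtain m out' where \<sigma>1: "\<sigma>1 = (m, out')" by fastforce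
    show "runs xs (Instr (Print t)) \<sigma>1 1
      (\<lambda>\<sigma>'. represents (den xs (Out e) s) \<sigma>' \<and> (\<forall>a. 32 \<le> a \<and> a < t \<longrightarrow> fst \<sigma>' a = fst \<sigma> a))"
      using 1 rep Out.prems unfolding \<sigma>1
      by (intro runs_Instr) (auto simp: represents_def same_outside_def)
  qed (use Out.prems in auto)
  then show ?case by (rule runs_mono) auto
next
  case (Then c1 c2)
  have disj: "bounds c1 \<inter> reg_writes c1 = {}" "bounds c2 \<inter> reg_writes c2 = {}"
    using Then.prems by auto
  have keep: "\<forall>b \<in> bounds c2. reg (den xs c1 s) b \<le> N"
    using Then.prems frame_den[of c1 s xs] by (auto simp: frame_def disjoint_iff)
  have "runs xs (compile (c1 ;; c2) t) \<sigma> (poly (steps c1) N + poly (steps c2) N)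
      (\<lambda>\<sigma>'. represents (den xs (c1 ;; c2) s) \<sigma>' \<and> (\<forall>a. 32 \<le> a \<and> a < t \<longrightarrow> fst \<sigma>' a = fst \<sigma> a))"
    unfolding compile.simps
    by (rule runs_Seq, rule runs_mono[OF Then.IH(1)[of s]],
        use Then.prems disj in \<open>simp_all\<close>)
      (rule runs_mono[OF Then.IH(2)[of "den xs c1 s"]], use Then.prems disj keep in auto)
  then show ?case by simp
next
  case (Cond e c1 c2)
  have disj: "bounds c1 \<inter> reg_writes c1 = {}" "bounds c2 \<inter> reg_writes c2 = {}"
    using Cond.prems by auto
  let ?Q = "\<lambda>\<sigma>'. represents (den xs (Cond e c1 c2) s) \<sigma>' \<and>
    (\<forall>a. 32 \<le> a \<and> a < t \<longrightarrow> fst \<sigma>' a = fst \<sigma> a)"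
  have "runs xs (compile (Cond e c1 c2) t) \<sigma>
      (poly (exp_steps e) N + Suc (poly (steps c1) N + poly (steps c2) N)) ?Q"
    unfolding compile.simps
  proof (rule runs_Seq, rule runs_mono[OF runs_compile_exp])
    fix \<sigma>1 assume 1: "same_outside t \<sigma> \<sigma>1 \<and> fst \<sigma>1 t = val xs e s"
    then have rep: "represents s \<sigma>1" using represents_same_outside Cond.prems by blast
    have "runs xs (compile c1 t) \<sigma>1 (poly (steps c1) N + poly (steps c2) N) ?Q" if "val xs e s \<noteq> 0"
      by (rule runs_mono[OF Cond.IH(1)[OF rep]])
        (use that 1 Cond.prems disj in \<open>auto simp: same_outside_def\<close>)
    moreover have "runs xs (compile c2 t) \<sigma>1 (poly (steps c1) N + poly (steps c2) N) ?Q"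
      if "val xs e s = 0"
      by (rule runs_mono[OF Cond.IH(2)[OF rep]])
        (use that 1 Cond.prems disj in \<open>auto simp: same_outside_def\<close>)
    ultimately show "runs xs (IfNZ t (compile c1 t) (compile c2 t)) \<sigma>1
        (Suc (poly (steps c1) N + poly (steps c2) N)) ?Q"
      using 1 by (intro runs_If) simp
  qed (use Cond.prems in auto)
  then show ?case by (rule runs_mono) auto
next
  case (For x b c)
  define n where "n = reg s b"
  define S where "S = (\<lambda>j. fold (\<lambda>i s. den xs c (set_reg x i s)) [0..<j] s)"
  have S: "S 0 = s" "S (Suc j) = den xs c (set_reg x j (S j))" for j
    by (simp_all add: S_def)
  have fr: "frame (For x b c) s (S j)" for j
    unfolding S_def by (rule frame_fold[OF frame_den])
  have wf_com: "x < 32" "b < 32" "x \<noteq> b" "b \<notin> reg_writes c" "wf_com c (t + 1)" "t + 1 < 64" "32 \<le> t"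
    using For.prems by auto
  have Sb: "reg (S j) b = n" for j using fr[of j] wf_com by (auto simp: frame_def n_def)
  have SN: "\<forall>b' \<in> bounds c. b' \<noteq> x \<and> reg (S j) b' \<le> N" for j
    using fr[of j] For.prems by (auto simp: frame_def)
  let ?body = "Seq (Instr (Sub x b t)) (Seq (compile c (t + 1))
    (Seq (Instr (Const (t + 1) 1)) (Instr (Sub t t (t + 1)))))"
  let ?Q = "\<lambda>\<sigma>'. represents (den xs (For x b c) s) \<sigma>' \<and>
    (\<forall>a. 32 \<le> a \<and> a < t \<longrightarrow> fst \<sigma>' a = fst \<sigma> a)"
  \<comment> \<open>With \<open>i\<close> iterations left, the store is the one after
    \<open>n - i\<close> iterations.\<close>
  let ?I = "\<lambda>i \<sigma>'. i \<le> n \<and> fst \<sigma>' t = i \<and> represents (S (n - i)) \<sigma>' \<and>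
    (\<forall>a. 32 \<le> a \<and> a < t \<longrightarrow> fst \<sigma>' a = fst \<sigma> a)"
  have loop: "runs xs (WhileNZ t ?body) \<sigma>0 (n * Suc (Suc (poly (steps c) N + Suc 1)) + 1) ?Q"
    if "?I n \<sigma>0" for \<sigma>0
  proof (rule runs_While[where Inv = ?I])
    fix i \<sigma>1
    assume I: "?I (Suc i) \<sigma>1"
    obtain m out' where \<sigma>1: "\<sigma>1 = (m, out')" by fastforce
    define \<sigma>2 where "\<sigma>2 = (m(x := n - Suc i), out')"
    have "m b = n" using I Sb[of "n - Suc i"] wf_com by (simp add: \<sigma>1 represents_def)
    then have st: "step xs (Sub x b t) \<sigma>1 = \<sigma>2" using I by (simp add: \<sigma>1 \<sigma>2_def)
    have rep2: "represents (set_reg x (n - Suc i) (S (n - Suc i))) \<sigma>2"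
      using I wf_com by (simp add: \<sigma>1 \<sigma>2_def represents_def)
    have dS: "den xs c (set_reg x (n - Suc i) (S (n - Suc i))) = S (n - i)"
      using I S(2)[of "n - Suc i"] by (simp add: Suc_diff_Suc)
    have "runs xs ?body \<sigma>1 (Suc (poly (steps c) N + Suc 1)) (?I i)"
    proof (rule runs_Instr_Seq, unfold st, rule runs_Seq, rule runs_mono[OF For.IH[OF rep2 wf_com(5)]])
      fix \<sigma>3
      assume 3: "represents (den xs c (set_reg x (n - Suc i) (S (n - Suc i)))) \<sigma>3 \<and>
        (\<forall>a. 32 \<le> a \<and> a < t + 1 \<longrightarrow> fst \<sigma>3 a = fst \<sigma>2 a)"
      obtain m3 out3 where \<sigma>3: "\<sigma>3 = (m3, out3)" by fastforce
      have "m3 t = Suc i" "\<forall>a. 32 \<le> a \<and> a < t \<longrightarrow> m3 a = fst \<sigma> a"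
        using 3 I wf_com by (auto simp: \<sigma>3 \<sigma>2_def \<sigma>1)
      moreover have "represents (S (n - i)) (m3, out3)" using 3 by (simp add: dS \<sigma>3)
      ultimately show "runs xs (Seq (Instr (Const (t + 1) 1)) (Instr (Sub t t (t + 1)))) \<sigma>3 (Suc 1) (?I i)"
        using I wf_com unfolding \<sigma>3
        by (intro runs_Instr_Seq runs_Instr) (simp add: represents_def)
    qed (use For.prems SN in auto)
    then show "fst \<sigma>1 t \<noteq> 0 \<and> runs xs ?body \<sigma>1 (Suc (poly (steps c) N + Suc 1)) (?I i)"
      using I by simp
  next
    show "fst \<sigma>1 t = 0 \<and> ?Q \<sigma>1" if "?I 0 \<sigma>1" for \<sigma>1 using that by (simp add: S_def n_def)
  qed (rule that)
  obtain m out' where \<sigma>: "\<sigma> = (m, out')" by fastforce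
  have "runs xs (compile (For x b c) t) \<sigma> (Suc (Suc (n * Suc (Suc (poly (steps c) N + Suc 1)) + 1))) ?Q"
    unfolding compile.simps
    by (intro runs_Instr_Seq loop)
      (use For.prems in \<open>auto simp: \<sigma> S represents_def n_def\<close>)
  moreover have "Suc (Suc (n * Suc (Suc (poly (steps c) N + Suc 1)) + 1)) \<le> poly (steps (For x b c)) N"
  proof -
    have "n * (poly (steps c) N + 4) \<le> N * (poly (steps c) N + 4)"
      using For.prems by (intro mult_mono) (auto simp: n_def)
    then have "n * (poly (steps c) N + 4) + 3 \<le> N * (poly (steps c) N + 4) + 3"
      by (rule add_right_mono)
    moreover have "Suc (Suc (n * Suc (Suc (poly (steps c) N + Suc 1)) + 1)) =
        n * (poly (steps c) N + 4) + 3" by (simp add: algebra_simps)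
    moreover have "poly (steps (For x b c)) N = N * (poly (steps c) N + 4) + 3" by simp
    ultimately show ?thesis by (simp only:)
  qed
  ultimately show ?case by (rule runs_mono)
qed

section \<open>Polynomial time for programs in three phases\<close>

lemma input_at_less: "input_at xs j < 2 ^ input_size xs"
proof (cases "j < length xs")
  case True
  then have "bits (xs ! j) \<le> input_size xs"
    unfolding input_size_def by (intro member_le_sum_list) auto
  then have "(2::nat) ^ bits (xs ! j) \<le> 2 ^ input_size xs" by simp
  with less_two_power_bits[of "xs ! j"] True show ?thesis
    by (simp add: input_at_def del: power_increasing_iff)
qed (simp add: input_at_def)

definition init :: store where
  "init = \<lparr>reg = \<lambda>_. 0, arr = \<lambda>_ _. 0, out = []\<rparr>"

text \<open>Since bounds and written registers are disjoint, a loop bound cannot be computed by the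
  program that uses it. Splitting the program allows loading parameters without loops, computing a
  further bound from them, and then looping up to it.\<close>

lemma poly_time_solvable_three_phases:
  fixes q :: "nat poly"
  assumes "wf_com c0 32" "bounds c0 = {}"
    and "wf_com c1 32" "bounds c1 \<inter> reg_writes c1 = {}"
    and "wf_com c2 32" "bounds c2 \<inter> reg_writes c2 = {}"
    and "\<And>x b. x \<in> Inst \<Longrightarrow> b \<in> bounds c1 \<Longrightarrow>
      reg (den (enc x) c0 init) b \<le> poly q (input_size (enc x))"
    and "\<And>x b. x \<in> Inst \<Longrightarrow> b \<in> bounds c2 \<Longrightarrow>
      reg (den (enc x) c1 (den (enc x) c0 init)) b \<le> poly q (input_size (enc x))"
    and "\<And>x. x \<in> Inst \<Longrightarrow>
      acc x (out (den (enc x) c2 (den (enc x) c1 (den (enc x) c0 init))))"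
  shows "poly_time_solvable Inst enc acc"
proof -
  define c where "c = Seq (compile c0 32) (Seq (compile c1 32) (compile c2 32))"
  \<comment> \<open>\<open>c0\<close> has no loop bounds, so its step polynomial may be evaluated at
    0.\<close>
  define P where "P = [:poly (steps c0) 0:] + (pcompose (steps c1) q + pcompose (steps c2) q)"
  define p where "p = P * ([:3:] + [:2:] * ([:1 + const_bound c, 1:] + P))"
  show ?thesis
    unfolding poly_time_solvable_def
  proof (intro exI[of _ c] exI[of _ p] ballI)
    fix x
    assume x: "x \<in> Inst"
    let ?xs = "enc x"
    let ?n = "input_size ?xs"
    have rep: "represents init (\<lambda>_. 0, [])" by (simp add: represents_def init_def)
    have "runs ?xs c (\<lambda>_. 0, []) (poly (steps c0) 0 + (poly (steps c1) (poly q ?n) +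
        poly (steps c2) (poly q ?n)))
      (represents (den ?xs c2 (den ?xs c1 (den ?xs c0 init))))"
      unfolding c_def
    proof (rule runs_Seq, rule runs_mono[OF runs_compile[OF rep]])
      fix \<sigma>1
      assume "represents (den ?xs c0 init) \<sigma>1 \<and>
        (\<forall>a. 32 \<le> a \<and> a < 32 \<longrightarrow> fst \<sigma>1 a = fst (\<lambda>_. 0, [] :: nat list) a)"
      then have 1: "represents (den ?xs c0 init) \<sigma>1" ..
      show "runs ?xs (Seq (compile c1 32) (compile c2 32)) \<sigma>1
        (poly (steps c1) (poly q ?n) + poly (steps c2) (poly q ?n))
        (represents (den ?xs c2 (den ?xs c1 (den ?xs c0 init))))"
      proof (rule runs_Seq, rule runs_mono[OF runs_compile[OF 1]])
        fix \<sigma>2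
        assume "represents (den ?xs c1 (den ?xs c0 init)) \<sigma>2 \<and>
          (\<forall>a. 32 \<le> a \<and> a < 32 \<longrightarrow> fst \<sigma>2 a = fst \<sigma>1 a)"
        then have 2: "represents (den ?xs c1 (den ?xs c0 init)) \<sigma>2" ..
        show "runs ?xs (compile c2 32) \<sigma>2 (poly (steps c2) (poly q ?n))
          (represents (den ?xs c2 (den ?xs c1 (den ?xs c0 init))))"
          by (rule runs_mono[OF runs_compile[OF 2, of _ _ "poly q ?n"]])
            (use assms x in auto)
      qed (use assms x in auto)
    qed (use assms x in auto)
    then obtain n m out' where n: "exec_unit ?xs c (\<lambda>_. 0, []) n (m, out')" "n \<le> poly P ?n"
      and out: "out' = out (den ?xs c2 (den ?xs c1 (den ?xs c0 init)))"
      unfolding runs_def by (force simp: P_def poly_pcompose represents_def)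
    \<comment> \<open>Enough bits for all constants of the program and all input numbers; with at
      most \<open>poly P ?n\<close> steps this dictates the form of \<open>p\<close>.\<close>
    define b where "b = 1 + const_bound c + ?n"
    have "const_bound c < 2 ^ b"
      unfolding b_def by (metis add.commute add.left_commute less_exp less_power_add)
    moreover have "\<forall>j. input_at ?xs j < 2 ^ b"
      unfolding b_def using input_at_less less_power_add by (metis add.commute)
    ultimately obtain t where "exec ?xs c (\<lambda>_. 0, []) t (m, out')" "t \<le> n * (3 + 2 * (b + n))"
      using exec_unit_imp_exec[OF n(1), of b] by (auto simp: b_def)
    moreover have "n * (3 + 2 * (b + n)) \<le> poly P ?n * (3 + 2 * (b + poly P ?n))"
      using n(2) by (intro mult_mono add_mono) auto
    moreover have "poly P ?n * (3 + 2 * (b + poly P ?n)) = poly p ?n"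
      by (simp add: p_def b_def mult.commute)
    ultimately show "\<exists>t m out. exec ?xs c (\<lambda>_. 0, []) t (m, out) \<and> t \<le> poly p ?n \<and> acc x out"
      using assms(9)[OF x] out by (metis le_trans)
  qed
qed

section \<open>Vectors as numbers\<close>

definition digit :: "nat \<Rightarrow> nat \<Rightarrow> nat \<Rightarrow> nat" where
  "digit B i x = x div B ^ i mod B"

definition code :: "nat \<Rightarrow> nat \<Rightarrow> (nat \<Rightarrow> nat) \<Rightarrow> nat" where
  "code B k f = (\<Sum>i<k. f i * B ^ i)"

text \<open>Decrements all positive digits.\<close>

function dec :: "nat \<Rightarrow> nat \<Rightarrow> nat" where
  "dec B x = (if x = 0 \<or> B < 2 then 0 else (x mod B - 1) + B * dec B (x div B))"
  by auto
termination by (relation "measure snd") auto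

declare dec.simps [simp del]

lemma digit_0 [simp]: "digit B i 0 = 0"
  by (simp add: digit_def)

lemma digit_zero: "digit B 0 x = x mod B"
  by (simp add: digit_def)

lemma digit_Suc: "digit B (Suc i) x = digit B i (x div B)"
  by (simp add: digit_def div_mult2_eq)

lemma code_less: "(\<And>i. i < k \<Longrightarrow> f i < B) \<Longrightarrow> code B k f < B ^ k"
proof (induction k)
  case (Suc k)
  then have "code B k f < B ^ k" by simp
  moreover have "Suc (f k) * B ^ k \<le> B * B ^ k"
    using Suc.prems[of k] by (intro mult_right_mono) auto
  ultimately show ?case by (simp add: code_def)
qed (simp add: code_def)

lemma digit_code: "(\<And>i. i < k \<Longrightarrow> f i < B) \<Longrightarrow> i < k \<Longrightarrow> digit B i (code B k f) = f i"
proof (induction k)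
  case (Suc k)
  have Suc_code: "code B (Suc k) f = code B k f + f k * B ^ k" by (simp add: code_def)
  show ?case
  proof (cases "i = k")
    case True
    have "code B k f < B ^ k" using Suc.prems by (intro code_less) simp
    then show ?thesis using Suc.prems(1)[of k] True by (simp add: Suc_code digit_def)
  next
    case False
    then have "i < k" using Suc.prems by simp
    then have "B ^ k = B ^ i * (B * B ^ (k - Suc i))"
      by (simp flip: power_Suc power_add)
    then have eq: "f k * B ^ k = B ^ i * (B * (f k * B ^ (k - Suc i)))" by simp
    have "B ^ i \<noteq> 0" using Suc.prems(1)[of k] by simp
    then have "digit B i (code B (Suc k) f) = digit B i (code B k f)"
      unfolding Suc_code digit_def eq by simp
    then show ?thesis using Suc \<open>i < k\<close> by simp
  qed
qed simp

lemma code_digit: "x < B ^ k \<Longrightarrow> code B k (\<lambda>i. digit B i x) = x"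
proof -
  have "code B k (\<lambda>i. digit B i x) = x mod B ^ k"
  proof (induction k)
    case (Suc k)
    have "x mod (B ^ k * B) = B ^ k * (x div B ^ k mod B) + x mod B ^ k"
      by (rule mod_mult2_eq)
    then show ?case using Suc by (simp add: code_def digit_def mult.commute)
  qed (simp add: code_def)
  then show "x < B ^ k \<Longrightarrow> ?thesis" by simp
qed

lemma digits_eqI:
  "x < B ^ k \<Longrightarrow> y < B ^ k \<Longrightarrow> (\<And>i. i < k \<Longrightarrow> digit B i x = digit B i y) \<Longrightarrow> x = y"
proof -
  assume "x < B ^ k" "y < B ^ k" and eq: "\<And>i. i < k \<Longrightarrow> digit B i x = digit B i y"
  then have "x = code B k (\<lambda>i. digit B i x)" "y = code B k (\<lambda>i. digit B i y)"
    by (simp_all add: code_digit)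
  moreover have "code B k (\<lambda>i. digit B i x) = code B k (\<lambda>i. digit B i y)"
    using eq by (simp add: code_def)
  ultimately show ?thesis by simp
qed

text \<open>If no position carries, the digitwise sums are themselves valid digits, so they form the
  expansion of the sum.\<close>

lemma
  assumes "x < B ^ k" "y < B ^ k" "\<forall>i<k. digit B i x + digit B i y < B"
  shows digits_add_less: "x + y < B ^ k"
    and digit_add: "i < k \<Longrightarrow> digit B i (x + y) = digit B i x + digit B i y"
proof -
  have "x + y = code B k (\<lambda>i. digit B i x) + code B k (\<lambda>i. digit B i y)"
    using assms by (simp add: code_digit)
  also have "\<dots> = code B k (\<lambda>i. digit B i x + digit B i y)"
    by (simp add: code_def add_mult_distrib sum.distrib)
  finally have eq: "x + y = code B k (\<lambda>i. digit B i x + digit B i y)" .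
  show "x + y < B ^ k" unfolding eq using assms(3) by (intro code_less) simp
  show "digit B i (x + y) = digit B i x + digit B i y" if "i < k"
    unfolding eq using assms(3) that by (intro digit_code) simp_all
qed

lemma dec_unfold: "2 \<le> B \<Longrightarrow> dec B x = (x mod B - 1) + B * dec B (x div B)"
  by (cases "x = 0") (simp_all add: dec.simps[of B x] dec.simps[of B 0])

text \<open>Truncating at every position excludes borrows, so the last digit and the quotient can be
  treated independently.\<close>

lemma digit_dec: "2 \<le> B \<Longrightarrow> digit B i (dec B x) = digit B i x - 1"
proof (induction i arbitrary: x)
  case 0
  have "x mod B - 1 < B" using 0 by (simp add: less_imp_diff_less)
  then show ?case using dec_unfold[OF 0, of x] by (simp add: digit_zero)
next
  case (Suc i)
  have "x mod B - 1 < B" using Suc.prems by (simp add: less_imp_diff_less)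
  then have "dec B x div B = dec B (x div B)" using dec_unfold[OF Suc.prems, of x] by simp
  then show ?case using Suc by (simp add: digit_Suc)
qed

lemma dec_le: "dec B x \<le> x"
proof (induction B x rule: dec.induct)
  case (1 B x)
  show ?case
  proof (cases "x = 0 \<or> B < 2")
    case False
    then have "dec B x = (x mod B - 1) + B * dec B (x div B)" by (simp add: dec.simps)
    also have "\<dots> \<le> x mod B + B * (x div B)"
      using 1 False by (intro add_mono mult_mono) auto
    finally show ?thesis by simp
  qed (simp add: dec.simps)
qed

section \<open>Dynamic programming along a growth order\<close>

text \<open>Edge number \<open>j\<close> joins the new vertex \<open>ch j\<close> to its parent \<open>pa j\<close> among \<open>reached j\<close>.\<close>

locale growth =
  fixes r m :: nat and ch pa :: "nat \<Rightarrow> nat"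
  assumes ch_neq_root: "j < m \<Longrightarrow> ch j \<noteq> r"
    and ch_neq: "j < m \<Longrightarrow> a < j \<Longrightarrow> ch a \<noteq> ch j"
    and pa_reached: "j < m \<Longrightarrow> pa j = r \<or> (\<exists>a<j. pa j = ch a)"
begin

definition reached :: "nat \<Rightarrow> nat set" where
  "reached j = insert r (ch ` {..<j})"

lemma finite_reached [simp]: "finite (reached j)"
  by (simp add: reached_def)

lemma reached_Suc: "reached (Suc j) = insert (ch j) (reached j)"
  by (auto simp: reached_def lessThan_Suc)

lemma pa_in: "j < m \<Longrightarrow> pa j \<in> reached j"
  using pa_reached[of j] by (auto simp: reached_def)

lemma ch_notin: "j < m \<Longrightarrow> ch j \<notin> reached j"
  using ch_neq_root[of j] ch_neq[of j] by (auto simp: reached_def) metis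

lemma ch_in: "a < j \<Longrightarrow> ch a \<in> reached j"
  by (auto simp: reached_def)

lemma reached_mono: "a \<le> j \<Longrightarrow> reached a \<subseteq> reached j"
  by (auto simp: reached_def)

lemma ch_inj: "a < m \<Longrightarrow> b < m \<Longrightarrow> ch a = ch b \<Longrightarrow> a = b"
  using ch_neq by (metis linorder_neqE_nat)

lemma card_reached: "j \<le> m \<Longrightarrow> card (reached j) = Suc j"
  by (induction j) (simp_all add: reached_Suc ch_notin, simp add: reached_def)

definition edge :: "nat \<Rightarrow> nat set" where
  "edge a = {ch a, pa a}"

text \<open>For \<open>a < b\<close>, both ends of edge \<open>a\<close> lie in
  \<open>reached b\<close>, while \<open>ch b\<close> does not.\<close>

lemma edge_inj: "inj_on edge {..<m}"
proof (rule linorder_inj_onI')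
  fix a b
  assume "a \<in> {..<m}" "b \<in> {..<m}" "a < b"
  then have "ch a \<in> reached b" "pa a \<in> reached b" "ch b \<notin> reached b"
    using ch_in pa_in[of a] reached_mono[of a b] ch_notin by auto
  then show "edge a \<noteq> edge b" unfolding edge_def by (auto simp: doubleton_eq_iff)
qed

text \<open>\<open>J a i\<close> says that edge \<open>a\<close> belongs to part \<open>i\<close>; \<open>joined j J v i\<close> that the first \<open>j\<close> edges
  put the vertex \<open>v\<close> into part \<open>i\<close>.\<close>

definition joined :: "nat \<Rightarrow> (nat \<Rightarrow> nat \<Rightarrow> bool) \<Rightarrow> nat \<Rightarrow> nat \<Rightarrow> bool" where
  "joined j J v i \<longleftrightarrow> v = r \<or> (\<exists>a<j. ch a = v \<and> J a i)"

end

section \<open>Tables of achievable vectors\<close>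

locale cutting = growth +
  fixes k B :: nat
  assumes B_ge_2: "2 \<le> B" and m_less_B: "m < B"
begin

text \<open>The first argument counts the edges cut off, from the last one backwards, to permit
  primitive recursion; \<open>table\<close> switches to the index of the edges that remain.\<close>

primrec merged :: "nat \<Rightarrow> nat \<Rightarrow> nat set" where
  "merged 0 v = {0}"
| "merged (Suc n) v = (if v = pa (m - Suc n)
     then {y + z | y z. y \<in> merged n v \<and> 0 < z \<and> z < B ^ k \<and> dec B z \<in> merged n (ch (m - Suc n))}
     else merged n v)"

text \<open>The vectors of numbers of edges which \<open>k\<close> parts can use, exactly, in the subtree that is
  cut off at \<open>v\<close> by removing the edges \<open>j, \<dots>, m - 1\<close>, all of these edges being covered.\<close>

definition table :: "nat \<Rightarrow> nat \<Rightarrow> nat set" where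
  "table j = merged (m - j)"

lemma table_m: "table m v = {0}"
  by (simp add: table_def)

lemma table_step: "j < m \<Longrightarrow> table j v = (if v = pa j
    then {y + z | y z. y \<in> table (Suc j) v \<and> 0 < z \<and> z < B ^ k \<and> dec B z \<in> table (Suc j) (ch j)}
    else table (Suc j) v)"
  by (simp add: table_def Suc_diff_Suc[symmetric])

text \<open>\<open>b\<close> allots a budget of edges to every vertex. As \<open>pa j\<close> and
  \<open>ch j\<close> are distinct, their budgets together with edge \<open>j\<close> fit into
  \<open>m < B\<close>, which excludes carries.\<close>

lemma table_bound_step:
  assumes "j < m"
    and b: "\<forall>v. \<forall>x \<in> table (Suc j) v. \<forall>i<k. digit B i x \<le> b v"
    and sum: "(\<Sum>v\<in>reached (Suc j). b v) + Suc j \<le> m"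
    and y: "y \<in> table (Suc j) (pa j)" and z: "dec B z \<in> table (Suc j) (ch j)" and i: "i < k"
  shows "digit B i y + digit B i z \<le> b (pa j) + b (ch j) + 1" "b (pa j) + b (ch j) + 1 < B"
proof -
  have "(\<Sum>v\<in>{pa j, ch j}. b v) \<le> (\<Sum>v\<in>reached (Suc j). b v)"
    using pa_in[OF \<open>j < m\<close>] by (intro sum_mono2) (auto simp: reached_Suc)
  moreover have "pa j \<noteq> ch j" using pa_in[OF \<open>j < m\<close>] ch_notin[OF \<open>j < m\<close>] by auto
  ultimately show "b (pa j) + b (ch j) + 1 < B" using sum m_less_B by simp
  have "digit B i (dec B z) \<le> b (ch j)" using b z i by blast
  then have "digit B i z - 1 \<le> b (ch j)" using digit_dec[OF B_ge_2] by simp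
  moreover have "digit B i y \<le> b (pa j)" using b y i by blast
  ultimately show "digit B i y + digit B i z \<le> b (pa j) + b (ch j) + 1" by simp
qed

text \<open>Think of \<open>b v\<close> as the number of edges cut off below \<open>v\<close>.
  Removing edge \<open>j\<close> passes the budget of \<open>ch j\<close> and the edge itself on to
  \<open>pa j\<close>, so budgets plus remaining edges never exceed \<open>m\<close>.\<close>

lemma table_bound:
  assumes "j \<le> m"
  shows "\<exists>b. (\<forall>v. \<forall>x \<in> table j v. x < B ^ k \<and> (\<forall>i<k. digit B i x \<le> b v)) \<and>
    (\<Sum>v\<in>reached j. b v) + j \<le> m"
  using assms
proof (induction rule: inc_induct)
  case base
  show ?case using B_ge_2 by (intro exI[of _ "\<lambda>_. 0"]) (simp add: table_m)
next
  case (step j)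
  then obtain b where b: "\<And>v x. x \<in> table (Suc j) v \<Longrightarrow> x < B ^ k"
    "\<forall>v. \<forall>x \<in> table (Suc j) v. \<forall>i<k. digit B i x \<le> b v"
    and sum: "(\<Sum>v\<in>reached (Suc j). b v) + Suc j \<le> m" by auto
  note bound = table_bound_step[OF step(2) b(2) sum]
  let ?b = "b(pa j := b (pa j) + b (ch j) + 1)"
  have "x < B ^ k \<and> (\<forall>i<k. digit B i x \<le> ?b v)" if "x \<in> table j v" for x v
  proof (cases "v = pa j")
    case True
    with that step(2) obtain y z where x: "x = y + z" "y \<in> table (Suc j) (pa j)"
      "z < B ^ k" "dec B z \<in> table (Suc j) (ch j)" by (auto simp: table_step)
    have no_carry: "\<forall>i<k. digit B i y + digit B i z < B"
      using bound[OF x(2,4)] by (meson le_less_trans)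
    show ?thesis
      using digits_add_less[OF b(1)[OF x(2)] x(3) no_carry]
        digit_add[OF b(1)[OF x(2)] x(3) no_carry] bound(1)[OF x(2,4)] x(1) True by simp
  qed (use that step(2) b in \<open>auto simp: table_step\<close>)
  moreover have "(\<Sum>v\<in>reached j. ?b v) = (\<Sum>v\<in>reached (Suc j). b v) + 1"
  proof -
    have "(\<Sum>v\<in>reached j. ?b v) = ?b (pa j) + (\<Sum>v\<in>reached j - {pa j}. ?b v)"
      using pa_in[OF step(2)] by (simp add: sum.remove)
    also have "(\<Sum>v\<in>reached j - {pa j}. ?b v) = (\<Sum>v\<in>reached j - {pa j}. b v)"
      by (intro sum.cong) auto
    finally show ?thesis
      using pa_in[OF step(2)] ch_notin[OF step(2)] by (simp add: reached_Suc sum.remove[of "reached j" "pa j"])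
  qed
  ultimately show ?case using sum by (intro exI[of _ ?b]) auto
qed

lemma table_less: "j \<le> m \<Longrightarrow> x \<in> table j v \<Longrightarrow> x < B ^ k"
  using table_bound by blast

lemma
  assumes "j < m" "y \<in> table (Suc j) (pa j)" "z < B ^ k" "dec B z \<in> table (Suc j) (ch j)"
  shows table_add_less: "y + z < B ^ k"
    and table_digit_add: "i < k \<Longrightarrow> digit B i (y + z) = digit B i y + digit B i z"
proof -
  obtain b where b: "\<forall>v. \<forall>x \<in> table (Suc j) v. \<forall>i<k. digit B i x \<le> b v"
    "(\<Sum>v\<in>reached (Suc j). b v) + Suc j \<le> m" using table_bound[of "Suc j"] assms(1) by auto
  have no_carry: "\<forall>i<k. digit B i y + digit B i z < B"
    using table_bound_step[OF assms(1) b assms(2,4)] by (meson le_less_trans)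
  have y: "y < B ^ k" using table_less[of "Suc j"] assms by auto
  show "y + z < B ^ k" using digits_add_less[OF y assms(3) no_carry] .
  show "i < k \<Longrightarrow> digit B i (y + z) = digit B i y + digit B i z"
    using digit_add[OF y assms(3) no_carry] .
qed

text \<open>A digit of the child's vector may be incremented, to account for the edge above the
  child, and still is a digit.\<close>

lemma table_digit_less:
  assumes "j < m" "x \<in> table (Suc j) (ch j)" "i < k"
  shows "digit B i x + 1 < B"
proof -
  obtain b where b: "\<forall>v. \<forall>x \<in> table (Suc j) v. \<forall>i<k. digit B i x \<le> b v"
    "(\<Sum>v\<in>reached (Suc j). b v) + Suc j \<le> m" using table_bound[of "Suc j"] assms(1) by auto
  have "b (ch j) \<le> (\<Sum>v\<in>reached (Suc j). b v)"
    by (intro member_le_sum) (auto simp: reached_Suc)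
  then show ?thesis using b(1)[rule_format, OF assms(2,3)] b(2) m_less_B by simp
qed

section \<open>Weighted cuttings and the removal of one leaf\<close>

text \<open>A cutting of the tree with edges \<open>0, \<dots>, j - 1\<close> where, additionally, each vertex \<open>v\<close> carries
  a weight vector \<open>w v\<close> from the table that is charged to the parts containing \<open>v\<close>. Cutting off the
  leaf \<open>ch (j - 1)\<close> moves its weight and its edge to the weight of its parent.\<close>

definition weighted :: "(nat \<Rightarrow> nat) \<Rightarrow> nat \<Rightarrow> (nat \<Rightarrow> nat) \<Rightarrow> (nat \<Rightarrow> nat \<Rightarrow> bool) \<Rightarrow> bool" where
  "weighted s j w J \<longleftrightarrow>
     (\<forall>v \<in> reached j. w v \<in> table j v) \<and>
     (\<forall>a<j. \<exists>i<k. J a i) \<and>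
     (\<forall>a<j. \<forall>i<k. J a i \<longrightarrow> joined a J (pa a) i) \<and>
     (\<forall>v \<in> reached j. \<forall>i<k. 0 < digit B i (w v) \<longrightarrow> joined j J v i) \<and>
     (\<forall>i<k. (\<Sum>v\<in>reached j. digit B i (w v)) + card {a. a < j \<and> J a i} = s i)"

lemma card_less_Suc: "card {a. a < Suc j \<and> P a} = card {a. a < j \<and> P a} + of_bool (P j)"
proof -
  have "{a. a < Suc j \<and> P a} = (if P j then insert j {a. a < j \<and> P a} else {a. a < j \<and> P a})"
    by (auto simp: less_Suc_eq)
  then show ?thesis by simp
qed

text \<open>Moving weight along edge \<open>j\<close> affects only its two ends; the offsets
  \<open>d\<close> and \<open>e\<close> leave room for counting the edge itself.\<close>

lemma sum_reached:
  assumes "j < m" "\<And>v. v \<in> reached j \<Longrightarrow> v \<noteq> pa j \<Longrightarrow> f v = g v"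
    and "g (pa j) + g (ch j) + d = f (pa j) + e"
  shows "(\<Sum>v\<in>reached (Suc j). g v) + d = (\<Sum>v\<in>reached j. f v) + (e :: nat)"
proof -
  have "(\<Sum>v\<in>reached j - {pa j}. g v) = (\<Sum>v\<in>reached j - {pa j}. f v)"
    using assms(2) by (intro sum.cong) auto
  then show ?thesis using assms(3) pa_in[OF assms(1)] ch_notin[OF assms(1)]
    by (simp add: reached_Suc sum.remove[of "reached j" "pa j"])
qed

text \<open>Only weights move, \<open>J\<close> stays. The summand \<open>z\<close> gets one more
  than the child's weight for each part using edge \<open>j\<close>, and 0 for the others. It is
  nonzero because the edge is covered, and its decrement is the child's weight because only parts
  using the edge are charged there.\<close>

lemma weighted_pred:
  assumes j: "j < m" and W: "weighted s (Suc j) w J"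
  shows "\<exists>w'. weighted s j w' J"
proof -
  let ?p = "pa j" and ?c = "ch j"
  have p: "?p \<in> reached j" and c: "?c \<notin> reached j" using pa_in ch_notin j by auto
  have tab: "w v \<in> table (Suc j) v" if "v \<in> reached (Suc j)" for v
    using W that by (simp add: weighted_def)
  have tabp: "w ?p \<in> table (Suc j) ?p" and tabc: "w ?c \<in> table (Suc j) ?c"
    using tab p by (auto simp: reached_Suc)
  have joined_pred: "joined j J v i" if "joined (Suc j) J v i" "v \<in> reached j" for v i
    using that c by (auto simp: joined_def less_Suc_eq)
  \<comment> \<open>A part charged at the leaf contains it, and \<open>j\<close> is the only edge
    whose child is the leaf.\<close>
  have Jc: "J j i" if "i < k" "0 < digit B i (w ?c)" for i
  proof -
    have "joined (Suc j) J ?c i" using W that by (auto simp: weighted_def reached_Suc)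
    then show ?thesis using j ch_neq_root[OF j] ch_neq[OF j] by (auto simp: joined_def less_Suc_eq)
  qed
  define f where "f = (\<lambda>i. if J j i then digit B i (w ?c) + 1 else 0)"
  define z where "z = code B k f"
  have f: "f i < B" if "i < k" for i
    using table_digit_less[OF j tabc that] B_ge_2 by (simp add: f_def)
  have zM: "z < B ^ k" unfolding z_def using f by (rule code_less)
  have dz: "digit B i z = f i" if "i < k" for i unfolding z_def using f that by (rule digit_code)
  have "dec B z = w ?c"
  proof (rule digits_eqI)
    show "dec B z < B ^ k" using dec_le zM by (rule le_less_trans)
    show "w ?c < B ^ k" using table_less[of "Suc j"] tabc j by simp
    show "digit B i (dec B z) = digit B i (w ?c)" if "i < k" for i
      using Jc[OF that] by (auto simp: digit_dec[OF B_ge_2] dz[OF that] f_def)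
  qed
  then have dec: "dec B z \<in> table (Suc j) ?c" using tabc by simp
  have z0: "0 < z"
  proof -
    obtain i where "i < k" "J j i" using W by (auto simp: weighted_def)
    then have "digit B i z \<noteq> 0" by (simp add: dz f_def)
    then show ?thesis by (metis digit_0 neq0_conv)
  qed
  have add: "digit B i (w ?p + z) = digit B i (w ?p) + f i" if "i < k" for i
    using table_digit_add[OF j tabp zM dec that] dz[OF that] by simp
  let ?w = "w(?p := w ?p + z)"
  have "?w v \<in> table j v" if "v \<in> reached j" for v
  proof (cases "v = ?p")
    case True
    then show ?thesis using j tabp z0 zM dec by (auto simp: table_step)
  next
    case False
    then show ?thesis using j tab[of v] that by (simp add: table_step reached_Suc)
  qed
  moreover have "joined j J v i" if "v \<in> reached j" "i < k" "0 < digit B i (?w v)" for v i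
  proof (cases "v = ?p \<and> J j i")
    case True
    then show ?thesis using W that by (auto simp: weighted_def)
  next
    case False
    then have "0 < digit B i (w v)" using that add by (auto simp: f_def split: if_splits)
    then show ?thesis using W that joined_pred by (auto simp: weighted_def reached_Suc)
  qed
  moreover have "(\<Sum>v\<in>reached j. digit B i (?w v)) + card {a. a < j \<and> J a i} = s i" if "i < k" for i
  proof -
    have "(\<Sum>v\<in>reached (Suc j). digit B i (w v)) + of_bool (J j i) =
        (\<Sum>v\<in>reached j. digit B i (?w v)) + 0"
      by (rule sum_reached[OF j]) (use add[OF that] Jc[OF that] in \<open>auto simp: f_def\<close>)
    moreover have "(\<Sum>v\<in>reached (Suc j). digit B i (w v)) +
        (card {a. a < j \<and> J a i} + of_bool (J j i)) = s i"
      using W that by (simp add: weighted_def card_less_Suc)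
    ultimately show ?thesis by linarith
  qed
  ultimately have "weighted s j ?w J" using W by (simp add: weighted_def)
  then show ?thesis by blast
qed

text \<open>The converse direction, used for tracing back: splitting the parent's weight decides
  which parts receive edge \<open>j\<close>. As digits add without carry, a positive digit of
  \<open>z\<close> is also positive in \<open>w (pa j)\<close>, so these parts do reach the
  parent.\<close>

lemma weighted_Suc:
  assumes j: "j < m" and W: "weighted s j w J" and wp: "w (pa j) = y + z"
    and y: "y \<in> table (Suc j) (pa j)" and z: "0 < z" "z < B ^ k"
    and dec: "dec B z \<in> table (Suc j) (ch j)"
  shows "weighted s (Suc j) (w(pa j := y, ch j := dec B z)) (J(j := \<lambda>i. 0 < digit B i z))"
    (is "weighted s (Suc j) ?w ?J")
proof -
  let ?p = "pa j" and ?c = "ch j"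
  have p: "?p \<in> reached j" and c: "?c \<notin> reached j"
    using pa_in ch_notin j by auto
  then have pc: "?p \<noteq> ?c" by auto
  have add: "digit B i (w ?p) = digit B i y + digit B i z" if "i < k" for i
    unfolding wp using table_digit_add[OF j y z(2) dec that] .
  have J_below: "joined a ?J v i = joined a J v i" if "a \<le> j" for a v i
  proof -
    have "(a' < a \<and> ch a' = v \<and> ?J a' i) = (a' < a \<and> ch a' = v \<and> J a' i)" for a'
      using that by auto
    then show ?thesis by (simp only: joined_def)
  qed
  have joined_Suc: "joined (Suc j) ?J v i" if "joined j J v i" for v i
    using that by (auto simp: joined_def less_Suc_eq)
  have supp: "joined j J v i" if "v \<in> reached j" "i < k" "0 < digit B i (w v)" for v i
    using W that by (simp add: weighted_def)
  have "?w v \<in> table (Suc j) v" if "v \<in> reached (Suc j)" for v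
  proof -
    have "v \<in> reached j \<Longrightarrow> w v \<in> table j v" using W by (simp add: weighted_def)
    then show ?thesis using that j y dec pc by (auto simp: table_step reached_Suc split: if_splits)
  qed
  moreover have "\<exists>i<k. ?J a i" if "a < Suc j" for a
  proof (cases "a = j")
    case True
    \<comment> \<open>This is where \<open>z \<noteq> 0\<close> is needed: the new edge is covered
      by some part.\<close>
    have "\<exists>i<k. digit B i z \<noteq> 0"
      using digits_eqI[of z B k 0] z by (metis digit_0 gr0I less_numeral_extra(3) order_less_trans)
    then show ?thesis using True by auto
  qed (use W that in \<open>auto simp: weighted_def\<close>)
  moreover have "joined a ?J (pa a) i" if "a < Suc j" "i < k" "?J a i" for a i
  proof (cases "a = j")
    case True
    then show ?thesis using supp[OF p] that add by (simp add: J_below)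
  qed (use W that in \<open>auto simp: weighted_def J_below\<close>)
  moreover have "joined (Suc j) ?J v i" if "v \<in> reached (Suc j)" "i < k" "0 < digit B i (?w v)" for v i
  proof (cases "v = ?c")
    case True
    then show ?thesis using that by (auto simp: joined_def digit_dec[OF B_ge_2])
  next
    case False
    then have "v \<in> reached j" "0 < digit B i (w v)"
      using that add[of i] by (auto simp: reached_Suc split: if_splits)
    then show ?thesis using supp joined_Suc that by blast
  qed
  moreover have "(\<Sum>v\<in>reached (Suc j). digit B i (?w v)) + card {a. a < Suc j \<and> ?J a i} = s i"
    if "i < k" for i
  proof -
    have "(\<Sum>v\<in>reached (Suc j). digit B i (?w v)) + of_bool (0 < digit B i z) =
        (\<Sum>v\<in>reached j. digit B i (w v)) + 0"
      by (rule sum_reached[OF j]) (use add[OF that] c pc in \<open>auto simp: digit_dec[OF B_ge_2]\<close>)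
    moreover have "{a. a < j \<and> ?J a i} = {a. a < j \<and> J a i}" by auto
    then have "card {a. a < Suc j \<and> ?J a i} = card {a. a < j \<and> J a i} + of_bool (0 < digit B i z)"
      unfolding card_less_Suc by simp
    moreover have "(\<Sum>v\<in>reached j. digit B i (w v)) + card {a. a < j \<and> J a i} = s i"
      using W that by (simp add: weighted_def)
    ultimately show ?thesis by linarith
  qed
  ultimately show ?thesis by (simp add: weighted_def)
qed

text \<open>Completeness of the tables: pushing all edges into the weight of the root turns a
  cutting into a table entry.\<close>

lemma weighted_0:
  assumes "weighted s m w J"
  obtains w' where "weighted s 0 w' J"
proof -
  have "\<exists>w'. weighted s j w' J" if "j \<le> m" for j
    using that
  proof (induction rule: inc_induct)
    case (step j)
    then show ?case using weighted_pred by blast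
  qed (use assms in blast)
  then show ?thesis using that by blast
qed

end

section \<open>Growth orders of trees\<close>

lemma edge_leaving:
  assumes "connected_graph G" "S \<subseteq> verts G" "r \<in> S" "v \<in> verts G" "v \<notin> S"
  obtains x y where "{x, y} \<in> edges G" "x \<in> S" "y \<notin> S"
proof -
  have "(r, v) \<in> {(x, y). {x, y} \<in> edges G}\<^sup>*"
    using assms by (auto simp: connected_graph_def)
  then have "\<exists>x y. {x, y} \<in> edges G \<and> x \<in> S \<and> y \<notin> S" using assms(3,5)
    by (induction rule: rtrancl_induct) auto
  then show ?thesis using that by blast
qed

lemma rtrancl_imp_distinct_path:
  assumes "(u, v) \<in> {(x, y). {x, y} \<in> E}\<^sup>*"
  shows "\<exists>vs. vs \<noteq> [] \<and> hd vs = u \<and> last vs = v \<and> distinct vs \<and>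
    (\<forall>i. Suc i < length vs \<longrightarrow> {vs ! i, vs ! Suc i} \<in> E)"
  using assms
proof (induction rule: rtrancl_induct)
  case base
  show ?case by (rule exI[of _ "[u]"]) simp
next
  case (step v w)
  then obtain vs where vs: "vs \<noteq> []" "hd vs = u" "last vs = v" "distinct vs"
    "\<And>i. Suc i < length vs \<Longrightarrow> {vs ! i, vs ! Suc i} \<in> E" by blast
  show ?case
  \<comment> \<open>If \<open>w\<close> was visited before, the path is cut back to that visit
    instead of being extended.\<close>
  proof (cases "w \<in> set vs")
    case True
    then obtain i where i: "i < length vs" "vs ! i = w" by (auto simp: in_set_conv_nth)
    have "last (take (Suc i) vs) = w" using i by (simp add: take_Suc_conv_app_nth)
    then show ?thesis using vs i by (intro exI[of _ "take (Suc i) vs"]) auto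
  next
    case False
    have "{(vs @ [w]) ! i, (vs @ [w]) ! Suc i} \<in> E" if "Suc i < length (vs @ [w])" for i
    proof (cases "Suc i < length vs")
      case True
      then show ?thesis using vs(5)[of i] by (simp add: nth_append)
    next
      case False
      then have "i = length vs - 1" using that by simp
      then show ?thesis using step(2) vs(1,3) by (simp add: nth_append last_conv_nth)
    qed
    then show ?thesis using vs False by (intro exI[of _ "vs @ [w]"]) auto
  qed
qed

lemma path_closes_cycle:
  assumes "distinct vs" "3 \<le> length vs" "{last vs, hd vs} \<in> edges G"
    and "\<And>i. Suc i < length vs \<Longrightarrow> {vs ! i, vs ! Suc i} \<in> edges G"
  shows "is_cycle G vs"
proof -
  have "{vs ! i, vs ! (Suc i mod length vs)} \<in> edges G" if "i < length vs" for i
  proof (cases "Suc i < length vs")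
    case False
    then have "i = length vs - 1" "Suc i = length vs" using that by auto
    moreover have "vs \<noteq> []" using assms(2) by auto
    ultimately show ?thesis using assms(3) by (simp add: last_conv_nth hd_conv_nth)
  qed (use assms(4) in simp)
  then show ?thesis using assms by (simp add: is_cycle_def)
qed

context growth
begin

text \<open>Unless it is the root, the parent of an edge in a part is the child of an earlier edge
  in the same part, so climbing by strong induction on the index ends in the root.\<close>

lemma part_connected:
  assumes closed: "\<And>a. a < j \<Longrightarrow> J a i \<Longrightarrow> joined a J (pa a) i" and "joined j J v i"
  shows "(v, r) \<in> {(x, y). {x, y} \<in> edge ` {a. a < j \<and> J a i}}\<^sup>*"
proof -
  let ?R = "{(x, y). {x, y} \<in> edge ` {a. a < j \<and> J a i}}"
  have "(ch a, r) \<in> ?R\<^sup>*" if "a < j" "J a i" for a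
    using that
  proof (induction a rule: less_induct)
    case (less a)
    have "(ch a, pa a) \<in> ?R" using less by (auto simp: edge_def)
    moreover have "(pa a, r) \<in> ?R\<^sup>*"
    proof (cases "pa a = r")
      case False
      then obtain b where "b < a" "ch b = pa a" "J b i"
        using closed[OF less.prems] by (auto simp: joined_def)
      then show ?thesis using less.IH[of b] less.prems(1) by simp
    qed simp
    ultimately show ?case by (rule converse_rtrancl_into_rtrancl)
  qed
  then show ?thesis using assms(2) by (auto simp: joined_def)
qed

lemma sym_edges: "sym ({(x, y). {x, y} \<in> E}\<^sup>*)"
  by (intro sym_rtrancl) (auto simp: sym_def insert_commute)

lemma part_connected_graph:
  assumes "\<And>a. a < j \<Longrightarrow> J a i \<Longrightarrow> joined a J (pa a) i"
  shows "connected_graph ({v. joined j J v i}, edge ` {a. a < j \<and> J a i})"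
  unfolding connected_graph_def
proof (intro conjI ballI)
  let ?R = "{(x, y). {x, y} \<in> edge ` {a. a < j \<and> J a i}}"
  fix u v
  assume "u \<in> verts ({v. joined j J v i}, edge ` {a. a < j \<and> J a i})"
    and "v \<in> verts ({v. joined j J v i}, edge ` {a. a < j \<and> J a i})"
  then have "joined j J u i" "joined j J v i" by simp_all
  with assms have ur: "(u, r) \<in> ?R\<^sup>*" and "(v, r) \<in> ?R\<^sup>*"
    by (blast intro: part_connected)+
  from this(2) have "(r, v) \<in> ?R\<^sup>*" using sym_edges by (rule symD[rotated])
  with ur have "(u, v) \<in> ?R\<^sup>*" by (rule rtrancl_trans)
  then show "(u, v) \<in> {(x, y). {x, y} \<in> edges ({v. joined j J v i}, edge ` {a. a < j \<and> J a i})}\<^sup>*"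
    by simp
qed (auto simp: joined_def)

text \<open>The growth edges already connect \<open>u\<close> and \<open>v\<close> by a simple path,
  which another edge would close to a cycle. The path has at least three vertices, since
  \<open>u \<noteq> v\<close> and \<open>{u, v}\<close> is not a growth edge.\<close>

lemma growth_acyclic:
  assumes T: "tree T" "edge ` {..<m} \<subseteq> edges T"
    and uv: "{u, v} \<in> edges T" "u \<in> reached m" "v \<in> reached m"
  shows "{u, v} \<in> edge ` {..<m}"
proof (rule ccontr)
  assume new: "{u, v} \<notin> edge ` {..<m}"
  \<comment> \<open>The whole growth is regarded as one part that contains every edge; the part
    number 0 is a dummy.\<close>
  have "connected_graph ({v. joined m (\<lambda>_ _. True) v 0}, edge ` {a. a < m \<and> True})"
    by (rule part_connected_graph) (use pa_reached in \<open>force simp: joined_def\<close>)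
  moreover have "{v. joined m (\<lambda>_ _. True) v 0} = reached m"
    by (auto simp: joined_def reached_def)
  moreover have "{a. a < m \<and> True} = {..<m}" by auto
  ultimately have "(u, v) \<in> {(x, y). {x, y} \<in> edge ` {..<m}}\<^sup>*"
    using uv by (auto simp: connected_graph_def)
  from rtrancl_imp_distinct_path[OF this] obtain vs where
    vs: "vs \<noteq> []" "hd vs = u" "last vs = v" "distinct vs"
    "\<And>i. Suc i < length vs \<Longrightarrow> {vs ! i, vs ! Suc i} \<in> edge ` {..<m}" by blast
  have "card {u, v} = 2" using T uv by (auto simp: tree_def simple_graph_def)
  then have "u \<noteq> v" by auto
  have "length vs \<noteq> 1" using vs \<open>u \<noteq> v\<close> by (auto simp: length_Suc_conv)
  moreover have "length vs \<noteq> 2"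
  proof
    assume "length vs = 2"
    then have "{u, v} = {vs ! 0, vs ! Suc 0}" using vs by (simp add: hd_conv_nth last_conv_nth)
    then show False using vs(5)[of 0] new \<open>length vs = 2\<close> by simp
  qed
  ultimately have "3 \<le> length vs" using vs(1) by (cases "length vs") auto
  moreover have "{last vs, hd vs} \<in> edges T" using uv vs by (simp add: insert_commute)
  ultimately have "is_cycle T vs" using vs T(2) by (intro path_closes_cycle) auto
  then show False using T by (auto simp: tree_def)
qed

text \<open>The search cannot get stuck early: if all vertices were reached, acyclicity would leave
  no further edge, contradicting the count; otherwise connectedness provides an edge leading
  out.\<close>

lemma growth_crossing:
  assumes T: "tree T" "edge ` {..<m} \<subseteq> edges T" "r \<in> verts T" and less: "m < card (edges T)"
  obtains x y where "{x, y} \<in> edges T" "x \<in> reached m" "y \<notin> reached m"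
proof (cases "verts T \<subseteq> reached m")
  case True
  have "e \<in> edge ` {..<m}" if e: "e \<in> edges T" for e
  proof -
    have "card e = 2" "e \<subseteq> verts T" using T e by (auto simp: tree_def simple_graph_def)
    then obtain u v where "e = {u, v}" by (auto simp: card_2_iff)
    then show ?thesis using growth_acyclic[OF T(1,2)] e True \<open>e \<subseteq> verts T\<close> by auto
  qed
  then have "card (edges T) \<le> card (edge ` {..<m})" by (intro card_mono) auto
  also have "\<dots> \<le> m" using card_image_le[of "{..<m}" edge] by simp
  finally show ?thesis using less by simp
next
  case False
  then obtain v where v: "v \<in> verts T" "v \<notin> reached m" by auto
  have "connected_graph T" using T by (simp add: tree_def)
  then obtain x y where xy: "{x, y} \<in> edges T" "x \<in> reached m \<inter> verts T" "y \<notin> reached m \<inter> verts T"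
    by (rule edge_leaving[of T "reached m \<inter> verts T" r v]) (use v T in \<open>auto simp: reached_def\<close>)
  moreover have "{x, y} \<subseteq> verts T" using xy(1) T by (auto simp: tree_def simple_graph_def)
  ultimately show ?thesis using that by auto
qed

lemma growth_complete:
  assumes T: "tree T" "edge ` {..<m} \<subseteq> edges T" "r \<in> verts T"
    and m: "m = card (edges T)" "finite (edges T)"
  shows "edges T = edge ` {..<m}" "verts T = reached m"
proof -
  show E: "edges T = edge ` {..<m}"
    using card_subset_eq[OF m(2) T(2)] card_image[OF edge_inj] m(1) by simp
  have "reached m \<subseteq> verts T"
    using T E unfolding tree_def simple_graph_def reached_def by (auto simp: edge_def)
  moreover have "verts T \<subseteq> reached m"
  proof
    fix v
    assume "v \<in> verts T"
    show "v \<in> reached m"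
    proof (rule ccontr)
      assume "v \<notin> reached m"
      moreover have "connected_graph T" using T by (simp add: tree_def)
      ultimately obtain x y where xy: "{x, y} \<in> edges T" "x \<in> reached m" "y \<notin> reached m"
        using \<open>reached m \<subseteq> verts T\<close> \<open>v \<in> verts T\<close>
        by (elim edge_leaving[of T "reached m" r v]) (auto simp: reached_def)
      then obtain a where "a < m" "{x, y} = edge a" using E by auto
      then have "{x, y} \<subseteq> reached m"
        using pa_in[of a] ch_in[of a m] reached_mono[of a m] by (auto simp: edge_def)
      then show False using xy by simp
    qed
  qed
  ultimately show "verts T = reached m" by auto
qed

text \<open>A path from the root to \<open>ch a\<close> has to use edge \<open>a\<close>, the only one which leaves the set of
  descendants of \<open>ch a\<close>.\<close>

lemma subgraph_uses_edge:
  assumes H: "connected_graph H" "simple_graph H" "edges H \<subseteq> edge ` {..<m}" "r \<in> verts H"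
    and a: "a < m" "ch a \<in> verts H"
  shows "edge a \<in> edges H"
proof -
  define D where "D = {v. (ch a, v) \<in> {(pa b, ch b) | b. b < m}\<^sup>*}"
  have D: "v = ch a \<or> (\<exists>b<m. v = ch b \<and> pa b \<in> D)" if "v \<in> D" for v
  proof -
    have "(ch a, v) \<in> {(pa b, ch b) | b. b < m}\<^sup>*" using that by (simp add: D_def)
    then show ?thesis by (cases rule: rtrancl.cases) (auto simp: D_def)
  qed
  have "r \<notin> D" using D[of r] ch_neq_root a(1) by metis
  have "ch a \<in> D" by (simp add: D_def)
  obtain x y where xy: "{x, y} \<in> edges H" "x \<in> verts H - D" "y \<notin> verts H - D"
    using H(1) by (rule edge_leaving[of H "verts H - D" r "ch a"])
      (use H a \<open>r \<notin> D\<close> \<open>ch a \<in> D\<close> in auto)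
  have "y \<in> verts H" using xy H(2) by (auto simp: simple_graph_def)
  then have "y \<in> D" using xy by simp
  obtain b where b: "b < m" "{x, y} = edge b" using xy H(3) by auto
  \<comment> \<open>\<open>D\<close> is closed under passing to children, so an edge crossing its
    border has the child inside and the parent outside.\<close>
  have "pa b \<in> D \<Longrightarrow> ch b \<in> D" using b(1) unfolding D_def by (auto intro: rtrancl_into_rtrancl)
  then have "y = ch b" "x = pa b" using b(2) xy \<open>y \<in> D\<close> by (auto simp: edge_def doubleton_eq_iff)
  then have "y = ch a" using D[OF \<open>y \<in> D\<close>] xy ch_inj b(1) by (metis DiffD2)
  then show ?thesis using xy b \<open>y = ch b\<close> ch_inj a(1) by metis
qed

end

section \<open>Cuttings as memberships of edges in parts\<close>

context cutting
begin

definition part :: "(nat \<Rightarrow> nat \<Rightarrow> bool) \<Rightarrow> nat \<Rightarrow> nat ugraph" where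
  "part J i = ({v. joined m J v i}, edge ` {a. a < m \<and> J a i})"

text \<open>With no edge cut off the weights vanish, and what remains describes a plain cutting in
  terms of \<open>J\<close>.\<close>

lemma weighted_m_iff: "weighted s m w J \<longleftrightarrow> (\<forall>v \<in> reached m. w v = 0) \<and>
    (\<forall>a<m. \<exists>i<k. J a i) \<and> (\<forall>a<m. \<forall>i<k. J a i \<longrightarrow> joined a J (pa a) i) \<and>
    (\<forall>i<k. card {a. a < m \<and> J a i} = s i)"
  by (auto simp: weighted_def table_m)

lemma weighted_imp_tree_cutting:
  assumes T: "edges T = edge ` {..<m}" "verts T = reached m"
    and W: "weighted (\<lambda>i. ss ! i) m w J" and k: "length ss = k"
  shows "tree_cutting T r ss (map (part J) [0..<k])"
proof -
  have "subgraph (part J i) T \<and> connected_graph (part J i) \<and> r \<in> verts (part J i) \<and>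
      card (edges (part J i)) = ss ! i" if i: "i < k" for i
  proof (intro conjI)
    have closed: "\<And>a. a < m \<Longrightarrow> J a i \<Longrightarrow> joined a J (pa a) i"
      using W i by (simp add: weighted_m_iff)
    have sub: "{v. joined m J v i} \<subseteq> reached m" by (auto simp: joined_def reached_def)
    then have fin: "finite {v. joined m J v i}" by (rule finite_subset) simp
    have "edge a \<subseteq> {v. joined m J v i} \<and> card (edge a) = 2" if "a < m" "J a i" for a
    proof
      have "joined m J (pa a) i" using closed[OF that] that by (auto simp: joined_def)
      then show "edge a \<subseteq> {v. joined m J v i}" using that by (auto simp: edge_def joined_def)
      have "ch a \<noteq> pa a" using pa_in[OF that(1)] ch_notin[OF that(1)] by auto
      then show "card (edge a) = 2" by (simp add: edge_def)
    qed
    then show "subgraph (part J i) T" using T sub fin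
      by (auto simp: subgraph_def simple_graph_def part_def)
    show "connected_graph (part J i)" unfolding part_def by (rule part_connected_graph) (rule closed)
    show "r \<in> verts (part J i)" by (simp add: part_def joined_def)
    have "inj_on edge {a. a < m \<and> J a i}" by (rule inj_on_subset[OF edge_inj]) auto
    then show "card (edges (part J i)) = ss ! i"
      using W i by (simp add: part_def card_image weighted_m_iff)
  qed
  moreover have "edges T = (\<Union>i<k. edges (part J i))"
    using W unfolding T(1) part_def weighted_m_iff by fastforce
  ultimately show ?thesis using k by (simp add: tree_cutting_def)
qed

text \<open>A part using edge \<open>a\<close> contains \<open>pa a\<close>; being connected and
  containing the root, it must also use the edge above \<open>pa a\<close>, which gives closure
  under parents.\<close>

lemma tree_cutting_imp_weighted:
  assumes T: "edges T = edge ` {..<m}" and C: "tree_cutting T r ss Ts" and k: "length ss = k"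
  shows "weighted (\<lambda>i. ss ! i) m (\<lambda>_. 0) (\<lambda>a i. edge a \<in> edges (Ts ! i))"
  unfolding weighted_m_iff
proof (intro conjI allI ballI impI refl)
  fix a
  assume "a < m"
  then have "edge a \<in> edges T" using T by simp
  then show "\<exists>i<k. edge a \<in> edges (Ts ! i)" using C k by (auto simp: tree_cutting_def)
next
  fix a i
  assume a: "a < m" "i < k" "edge a \<in> edges (Ts ! i)"
  have H: "connected_graph (Ts ! i)" "simple_graph (Ts ! i)" "edges (Ts ! i) \<subseteq> edge ` {..<m}"
    "r \<in> verts (Ts ! i)" using C k a(2) T by (auto simp: tree_cutting_def subgraph_def)
  have "pa a \<in> verts (Ts ! i)" using a(3) H(2) by (auto simp: simple_graph_def edge_def)
  then show "joined a (\<lambda>a i. edge a \<in> edges (Ts ! i)) (pa a) i"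
    using pa_reached[OF a(1)] subgraph_uses_edge[OF H] a(1)
    unfolding joined_def by (metis order_less_trans)
next
  fix i
  assume i: "i < k"
  have H: "edges (Ts ! i) \<subseteq> edge ` {..<m}" "card (edges (Ts ! i)) = ss ! i"
    using C k i T by (auto simp: tree_cutting_def subgraph_def)
  have E: "edge ` {a. a < m \<and> edge a \<in> edges (Ts ! i)} = edges (Ts ! i)" using H(1) by auto
  have "inj_on edge {a. a < m \<and> edge a \<in> edges (Ts ! i)}"
    by (rule inj_on_subset[OF edge_inj]) auto
  then have "card (edge ` {a. a < m \<and> edge a \<in> edges (Ts ! i)}) =
      card {a. a < m \<and> edge a \<in> edges (Ts ! i)}" by (rule card_image)
  then show "card {a. a < m \<and> edge a \<in> edges (Ts ! i)} = ss ! i"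
    unfolding E H(2) by simp
qed

end

section \<open>The program\<close>

abbreviation (input) rN :: nat where "rN \<equiv> 2"
abbreviation (input) rE :: nat where "rE \<equiv> 3"
abbreviation (input) rB :: nat where "rB \<equiv> 4"
abbreviation (input) rK :: nat where "rK \<equiv> 5"
abbreviation (input) rM :: nat where "rM \<equiv> 6"
abbreviation (input) rR :: nat where "rR \<equiv> 7"
abbreviation (input) ri :: nat where "ri \<equiv> 8"
abbreviation (input) rj :: nat where "rj \<equiv> 9"
abbreviation (input) ry :: nat where "ry \<equiv> 10"
abbreviation (input) rz :: nat where "rz \<equiv> 11"
abbreviation (input) rc :: nat where "rc \<equiv> 12"
abbreviation (input) rp :: nat where "rp \<equiv> 13"
abbreviation (input) re :: nat where "re \<equiv> 14"
abbreviation (input) ru :: nat where "ru \<equiv> 15"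
abbreviation (input) rv :: nat where "rv \<equiv> 16"
abbreviation (input) rS :: nat where "rS \<equiv> 17"
abbreviation (input) rok :: nat where "rok \<equiv> 18"

text \<open>\<open>aCH\<close>, \<open>aPA\<close> and \<open>aEI\<close> hold the child, the parent and the position in the input of each
  edge in the growth order, row \<open>v\<close> of \<open>aF\<close> the current table of the vertex \<open>v\<close>, and row \<open>j\<close> of
  \<open>aW\<close> a summand for every vector obtained by cutting off edge \<open>j\<close>, or \<open>0\<close>. When tracing back,
  \<open>aCUR\<close> holds the vectors still to be split; the summands found are stored in \<open>aZC\<close> under
  the child and in \<open>aZE\<close> under the position of the edge.\<close>

abbreviation (input) aDEC :: nat where "aDEC \<equiv> 2"
abbreviation (input) aDIV :: nat where "aDIV \<equiv> 3"
abbreviation (input) aMOD :: nat where "aMOD \<equiv> 4"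
abbreviation (input) aVIS :: nat where "aVIS \<equiv> 5"
abbreviation (input) aCH :: nat where "aCH \<equiv> 6"
abbreviation (input) aPA :: nat where "aPA \<equiv> 7"
abbreviation (input) aEI :: nat where "aEI \<equiv> 8"
abbreviation (input) aF :: nat where "aF \<equiv> 9"
abbreviation (input) aW :: nat where "aW \<equiv> 10"
abbreviation (input) aCUR :: nat where "aCUR \<equiv> 11"
abbreviation (input) aZC :: nat where "aZC \<equiv> 12"
abbreviation (input) aZE :: nat where "aZE \<equiv> 13"

text \<open>Straight-line code, as no loop bound is available yet; \<open>rM\<close> receives the
  empty product, from which \<open>power_loop\<close> starts.\<close>

definition read_params :: "nat \<Rightarrow> com" where
  "read_params k =
     (rN ::= Inp (Num 0) ;;
      rE ::= Inp (Num 1) ;;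
      rB ::= Var rN \<oplus> Num 1 ;;
      rK ::= Num k ;;
      rR ::= Inp (Num 2 \<oplus> Var rE \<oplus> Var rE) ;;
      rM ::= Num 1)"

definition power_loop :: com where
  "power_loop = For ri rK (rM ::= Times rB (Var rM))"

text \<open>Replaces division: instead of dividing \<open>x\<close>, all quotients and remainders
  are enumerated and the entry at \<open>B * quotient + remainder\<close> is filled. The decrement
  of the quotient is already known by then.\<close>

definition digit_tables_row :: com where
  "digit_tables_row = For rz rB
     (ru ::= Times rB (Var ry) \<oplus> Var rz ;;
      Update aDEC (Var ru) ((Var rz \<ominus> Num 1) \<oplus> Times rB (Arr aDEC (Var ry))) ;;
      Update aDIV (Var ru) (Var ry) ;;
      Update aMOD (Var ru) (Var rz))"

definition digit_tables :: com where
  "digit_tables = For ry rM digit_tables_row"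

text \<open>On 0/1 marks a truncated difference is nonzero exactly if the first end is visited and
  the second is not. There is no early exit; a later hit overwrites an earlier one.\<close>

definition find_edge :: com where
  "find_edge = For ri rE
     (ru ::= Inp (Num 2 \<oplus> (Var ri \<oplus> Var ri)) ;;
      rv ::= Inp (Num 3 \<oplus> (Var ri \<oplus> Var ri)) ;;
      Cond (Arr aVIS (Var ru) \<ominus> Arr aVIS (Var rv))
        (rc ::= Var rv ;; rp ::= Var ru ;; re ::= Var ri) Nop ;;
      Cond (Arr aVIS (Var rv) \<ominus> Arr aVIS (Var ru))
        (rc ::= Var ru ;; rp ::= Var rv ;; re ::= Var ri) Nop)"

definition grow_loop :: com where
  "grow_loop = For rj rE
     (find_edge ;;
      Update aCH (Var rj) (Var rc) ;;
      Update aPA (Var rj) (Var rp) ;;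
      Update aEI (Var rj) (Var re) ;;
      Update aVIS (Var rc) (Num 1))"

definition leaf_tables :: com where
  "leaf_tables = For ri rN (Update aF (Times rM (Var ri)) (Num 1))"

text \<open>The stored summand doubles as membership flag, as it is never 0.\<close>

definition merge_row :: com where
  "merge_row = For rz rM
     (Cond (Arr aF (Times rM (Var rp) \<oplus> Var ry))
       (Cond (Arr aF (Times rM (Var rc) \<oplus> Arr aDEC (Var rz)))
         (Cond (Var rz) (Update aW (Times rM (Var rj) \<oplus> (Var ry \<oplus> Var rz)) (Var rz)) Nop)
         Nop)
       Nop)"

definition merge_rows :: com where
  "merge_rows = For ry rM merge_row"

text \<open>The new table of the parent is collected in \<open>aW\<close> first, because the old one
  is still read while merging.\<close>

definition copy_row :: com where
  "copy_row = For ry rM (Update aF (Times rM (Var rp) \<oplus> Var ry) (Arr aW (Times rM (Var rj) \<oplus> Var ry)))"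

definition merge_loop :: com where
  "merge_loop = For ri rE
     (rj ::= Var rE \<ominus> Num 1 \<ominus> Var ri ;;
      rc ::= Arr aCH (Var rj) ;;
      rp ::= Arr aPA (Var rj) ;;
      merge_rows ;;
      copy_row)"

text \<open>Reads the sizes from the last to the first to evaluate their code by Horner's rule. A
  size of at least \<open>B\<close> is not a digit and exceeds the number of edges, so it refutes
  the instance.\<close>

definition target_loop :: com where
  "target_loop = For ri rK
     (ru ::= Inp (Num 3 \<oplus> (Var rE \<oplus> Var rE) \<oplus> (Var rK \<ominus> Num 1 \<ominus> Var ri)) ;;
      rS ::= Var ru \<oplus> Times rB (Var rS) ;;
      Cond (Var ru \<oplus> Num 1 \<ominus> Var rB) (rok ::= Num 0) Nop)"

definition traceback_loop :: com where
  "traceback_loop = For rj rE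
     (rc ::= Arr aCH (Var rj) ;;
      rp ::= Arr aPA (Var rj) ;;
      rz ::= Arr aW (Times rM (Var rj) \<oplus> Arr aCUR (Var rp)) ;;
      Update aCUR (Var rp) (Arr aCUR (Var rp) \<ominus> Var rz) ;;
      Update aCUR (Var rc) (Arr aDEC (Var rz)) ;;
      Update aZC (Var rc) (Var rz) ;;
      Update aZE (Arr aEI (Var rj)) (Var rz))"

text \<open>Each pass prints whether the lowest digit is positive and then shifts the vector, so
  pass \<open>i\<close> sees digit \<open>i\<close>. The root lies in every part but is no child of
  an edge, hence the separate case; the double difference from 1 is the sign function.\<close>

definition print_verts :: com where
  "print_verts = For rv rN
     (Cond ((Var rv \<ominus> Var rR) \<oplus> (Var rR \<ominus> Var rv))
        (Out (Num 1 \<ominus> (Num 1 \<ominus> Arr aMOD (Arr aZC (Var rv))))) (Out (Num 1)) ;;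
      Update aZC (Var rv) (Arr aDIV (Arr aZC (Var rv))))"

definition print_edges :: com where
  "print_edges = For re rE
     (Out (Num 1 \<ominus> (Num 1 \<ominus> Arr aMOD (Arr aZE (Var re)))) ;;
      Update aZE (Var re) (Arr aDIV (Arr aZE (Var re))))"

definition print_loop :: com where
  "print_loop = For ri rK (print_verts ;; print_edges)"

definition solve :: com where
  "solve =
     (digit_tables ;;
      Update aVIS (Var rR) (Num 1) ;;
      grow_loop ;;
      leaf_tables ;;
      merge_loop ;;
      rS ::= Num 0 ;;
      rok ::= Num 1 ;;
      target_loop ;;
      Cond (Var rok)
        (Cond (Arr aF (Times rM (Var rR) \<oplus> Var rS))
          (Out (Num 1) ;; Update aCUR (Var rR) (Var rS) ;; traceback_loop ;; print_loop)
          (Out (Num 0)))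
        (Out (Num 0)))"

lemmas loop_defs = digit_tables_row_def digit_tables_def find_edge_def grow_loop_def leaf_tables_def
  merge_row_def merge_rows_def copy_row_def merge_loop_def target_loop_def traceback_loop_def
  print_verts_def print_edges_def print_loop_def

lemma wf_programs:
  "wf_com (read_params k) 32" "bounds (read_params k) = {}"
  "wf_com power_loop 32" "bounds power_loop \<inter> reg_writes power_loop = {}"
  "wf_com solve 32" "bounds solve \<inter> reg_writes solve = {}"
  by (simp_all add: read_params_def power_loop_def solve_def loop_defs)

lemma bounds_programs:
  "bounds power_loop = {rK, rB}" "bounds solve = {rN, rE, rB, rK, rM}"
  by (auto simp: power_loop_def solve_def loop_defs)

section \<open>Correctness\<close>

lemma den_unchanged:
  "x \<notin> reg_writes c \<Longrightarrow> reg (den xs c s) x = reg s x"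
  "a \<notin> arr_writes c \<Longrightarrow> arr (den xs c s) a = arr s a"
  "silent c \<Longrightarrow> out (den xs c s) = out s"
  using frame_den[of c s xs] by (auto simp: frame_def)

lemma concat_pairs_nth:
  "e < length ps \<Longrightarrow> concat (map (\<lambda>(u, v). [u, v]) ps) ! (2 * e) = fst (ps ! e) \<and>
     concat (map (\<lambda>(u, v). [u, v]) ps) ! Suc (2 * e) = snd (ps ! e)"
proof (induction ps arbitrary: e)
  case (Cons p ps)
  then show ?case by (cases e) (auto split: prod.splits)
qed simp

lemma length_concat_pairs: "length (concat (map (\<lambda>(u, v). [u, v]) ps)) = 2 * length ps"
  by (induction ps) (auto split: prod.splits)

lemma row_eq_iff:
  fixes M v v' x x' :: nat
  assumes "x < M" "x' < M"
  shows "M * v + x = M * v' + x' \<longleftrightarrow> v = v' \<and> x = x'"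
proof
  assume eq: "M * v + x = M * v' + x'"
  from arg_cong[OF eq, of "\<lambda>z. z mod M"] arg_cong[OF eq, of "\<lambda>z. z div M"] assms
  show "v = v' \<and> x = x'" by simp
qed simp

lemma code_shift: "code B (Suc k) f = f 0 + B * code B k (\<lambda>i. f (Suc i))"
  unfolding code_def by (subst sum.lessThan_Suc_shift) (simp add: sum_distrib_left mult_ac)

lemma growth_extend:
  assumes "growth r j ch pa" "c \<notin> insert r (ch ` {..<j})" "p \<in> insert r (ch ` {..<j})"
  shows "growth r (Suc j) (ch(j := c)) (pa(j := p))"
proof -
  interpret growth r j ch pa by (fact assms(1))
  show ?thesis
  proof
    fix i a
    assume i: "i < Suc j"
    show "(ch(j := c)) i \<noteq> r" using i ch_neq_root assms(2) by (auto simp: less_Suc_eq)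
    show "a < i \<Longrightarrow> (ch(j := c)) a \<noteq> (ch(j := c)) i"
      using i ch_neq[of i a] assms(2) by (auto simp: less_Suc_eq)
    show "(pa(j := p)) i = r \<or> (\<exists>a<i. (pa(j := p)) i = (ch(j := c)) a)"
    proof (cases "i = j")
      case True
      then show ?thesis using assms(3) by auto
    next
      case False
      then show ?thesis using i pa_reached[of i] by (metis fun_upd_other less_Suc_eq less_irrefl order_less_trans)
    qed
  qed
qed

section \<open>Instances, parameters and digit tables\<close>

locale tcp =
  fixes k :: nat and I :: tcp_input
  assumes instance_I: "I \<in> tcp_instances k"
begin

abbreviation "n \<equiv> nverts I"
abbreviation "m \<equiv> length (edge_list I)"
abbreviation "r \<equiv> root I"
abbreviation "T \<equiv> input_graph I"
text \<open>A base larger than the number of edges lets one digit count any set of edges;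
  \<open>n + 1\<close> is at least 2 even for a single vertex.\<close>

abbreviation "B \<equiv> Suc n"
abbreviation "M \<equiv> B ^ k"
abbreviation "xs \<equiv> encode_input I"

definition ith_edge :: "nat \<Rightarrow> nat set" where
  "ith_edge e = (\<lambda>(u, v). {u, v}) (edge_list I ! e)"

lemma tree_T: "tree T" and root_less: "r < n" and length_sizes: "length (sizes I) = k"
  using instance_I by (auto simp: tcp_instances_def)

lemma verts_T: "verts T = {..<n}"
  by (simp add: input_graph_def)

lemma edges_T: "edges T = ith_edge ` {..<m}"
proof -
  have "set (edge_list I) = (\<lambda>e. edge_list I ! e) ` {..<m}"
    by (force simp: set_conv_nth)
  then show ?thesis by (simp add: input_graph_def ith_edge_def image_image)
qed

lemma ith_edge_inj: "e < m \<Longrightarrow> e' < m \<Longrightarrow> ith_edge e = ith_edge e' \<Longrightarrow> e = e'"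
  using instance_I nth_eq_iff_index_eq[of "map (\<lambda>(u, v). {u, v}) (edge_list I)" e e']
  by (simp add: tcp_instances_def ith_edge_def)

lemma card_edges_T: "card (edges T) = m" and finite_edges_T: "finite (edges T)"
  unfolding edges_T using ith_edge_inj by (auto intro!: card_image[THEN trans] inj_onI)

lemma input_at_simps:
  "input_at xs 0 = n" "input_at xs (Suc 0) = m" "input_at xs (2 + (m + m)) = r"
  "e < m \<Longrightarrow> input_at xs (2 + (e + e)) = fst (edge_list I ! e)"
  "e < m \<Longrightarrow> input_at xs (3 + (e + e)) = snd (edge_list I ! e)"
  "i < k \<Longrightarrow> input_at xs (3 + (m + m) + i) = sizes I ! i"
proof -
  let ?ps = "concat (map (\<lambda>(u, v). [u, v]) (edge_list I))"
  have xs: "xs = n # m # ?ps @ r # sizes I" by (simp add: encode_input_def)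
  have len: "length ?ps = m + m" using length_concat_pairs[of "edge_list I"] by simp
  show "input_at xs 0 = n" "input_at xs (Suc 0) = m" by (simp_all add: input_at_def xs)
  show "input_at xs (2 + (m + m)) = r" using len by (simp add: input_at_def xs nth_append)
  show "input_at xs (2 + (e + e)) = fst (edge_list I ! e)"
    "input_at xs (3 + (e + e)) = snd (edge_list I ! e)" if "e < m"
    using len that concat_pairs_nth[OF that]
    by (simp_all add: input_at_def xs nth_append mult_2 eval_nat_numeral)
  show "input_at xs (3 + (m + m) + i) = sizes I ! i" if "i < k"
    using len that length_sizes by (simp add: input_at_def xs nth_append eval_nat_numeral)
qed

definition params :: "store \<Rightarrow> bool" where
  "params s \<longleftrightarrow> reg s rN = n \<and> reg s rE = m \<and> reg s rB = B \<and> reg s rK = k \<and> reg s rM = M \<and>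
     reg s rR = r"

lemma paramsD:
  assumes "params s"
  shows "reg s rN = n" "reg s rE = m" "reg s rB = B" "reg s rK = k" "reg s rM = M" "reg s rR = r"
  using assms by (auto simp: params_def)

lemma params_frame:
  "params s \<Longrightarrow> frame c s s' \<Longrightarrow> reg_writes c \<inter> {rN, rE, rB, rK, rM, rR} = {} \<Longrightarrow> params s'"
  by (auto simp: params_def frame_def)

lemma params_set_reg:
  "params s \<Longrightarrow> x \<notin> {rN, rE, rB, rK, rM, rR} \<Longrightarrow> params (set_reg x v s)"
  by (simp add: params_def)

lemma read_params: "params (den xs power_loop (den xs (read_params k) init))"
    "reg (den xs (read_params k) init) rK = k" "reg (den xs (read_params k) init) rB = B"
    "arr (den xs power_loop (den xs (read_params k) init)) = (\<lambda>_ _. 0)"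
    "out (den xs power_loop (den xs (read_params k) init)) = []"
proof -
  let ?s = "den xs (read_params k) init"
  have s: "reg ?s rN = n" "reg ?s rE = m" "reg ?s rB = B" "reg ?s rK = k" "reg ?s rR = r"
    "reg ?s rM = 1" "arr ?s = (\<lambda>_ _. 0)" "out ?s = []"
    using input_at_simps(3)
    by (simp_all add: read_params_def init_def input_at_simps(1,2) add.assoc)
  then show "reg ?s rK = k" "reg ?s rB = B" by simp_all
  let ?C = "rM ::= Times rB (Var rM)"
  have "reg (den xs (For ri rK ?C) ?s) rM = B ^ reg ?s rK"
    by (rule den_For_invariant[where I = "\<lambda>i s'. reg s' rM = B ^ i"])
      (use s in \<open>auto simp: frame_def\<close>)
  then show "params (den xs power_loop ?s)" "arr (den xs power_loop ?s) = (\<lambda>_ _. 0)"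
    "out (den xs power_loop ?s) = []"
    using frame_den[of power_loop ?s xs] s by (simp_all add: params_def power_loop_def frame_def fun_eq_iff)
qed

text \<open>The value at 0 is required even for \<open>b = 0\<close>, because the first entry of
  \<open>aDEC\<close> is computed from itself.\<close>

definition tables :: "nat \<Rightarrow> store \<Rightarrow> bool" where
  "tables b s \<longleftrightarrow> arr s aDEC 0 = 0 \<and>
     (\<forall>x<b. arr s aDEC x = dec B x \<and> arr s aDIV x = x div B \<and> arr s aMOD x = x mod B)"

lemma n_pos: "0 < n" and two_le_B: "2 \<le> B" and M_pos: "0 < M"
  using root_less by auto

lemma digit_tables_row:
  assumes "params s" "tables (B * reg s ry) s"
  shows "tables (B * Suc (reg s ry)) (den xs digit_tables_row s)"
proof -
  have "tables (B * reg s ry + reg s rB) (den xs digit_tables_row s)"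
    unfolding digit_tables_row_def
  proof (rule den_For_invariant[where I = "\<lambda>d s'. tables (B * reg s ry + d) s'"])
    fix d s'
    assume d: "d < reg s rB" and tab: "tables (B * reg s ry + d) s'"
      and fr: "frame (For rz rB (ru ::= Times rB (Var ry) \<oplus> Var rz ;;
        Update aDEC (Var ru) ((Var rz \<ominus> Num 1) \<oplus> Times rB (Arr aDEC (Var ry))) ;;
        Update aDIV (Var ru) (Var ry) ;; Update aMOD (Var ru) (Var rz))) s s'"
    define q where "q = reg s ry"
    have q: "reg s' ry = q" "reg s' rB = B" using fr paramsD[OF assms(1)] by (auto simp: frame_def q_def)
    have dB: "d < B" using d paramsD[OF assms(1)] by simp
    have "arr s' aDEC q = dec B q"
    proof (cases "q = 0")
      case True
      then show ?thesis using tab by (simp add: tables_def dec.simps)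
    next
      case False
      \<comment> \<open>A positive quotient is smaller than the entries of its row, so its own
        decrement has been tabulated earlier.\<close>
      then have "q < B * q" using n_pos by simp
      then show ?thesis using tab by (simp add: tables_def q_def trans_less_add1)
    qed
    moreover have "dec B (B * q + d) = d - 1 + B * dec B q"
      using dec_unfold[OF two_le_B, of "B * q + d"] dB by (simp del: mult_Suc)
    moreover have "(B * q + d) div B = q" "(B * q + d) mod B = d" using dB by (simp_all del: mult_Suc)
    moreover have "B * q + d = 0 \<Longrightarrow> q = 0 \<and> d = 0" by simp
    ultimately show "tables (B * reg s ry + Suc d) (den xs (ru ::= Times rB (Var ry) \<oplus> Var rz ;;
        Update aDEC (Var ru) ((Var rz \<ominus> Num 1) \<oplus> Times rB (Arr aDEC (Var ry))) ;;
        Update aDIV (Var ru) (Var ry) ;; Update aMOD (Var ru) (Var rz)) (set_reg rz d s'))"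
      using tab q unfolding q_def[symmetric]
      by (auto simp: tables_def less_Suc_eq simp del: mult_Suc)
  qed (use assms in simp)
  then show ?thesis using paramsD[OF assms(1)] by (simp add: add.commute)
qed

lemma digit_tables:
  assumes "params s" "arr s = (\<lambda>_ _. 0)"
  shows "tables M (den xs digit_tables s)"
proof -
  have "tables (B * reg s rM) (den xs digit_tables s)"
    unfolding digit_tables_def
  proof (rule den_For_invariant[where I = "\<lambda>q. tables (B * q)"])
    fix q s'
    assume "tables (B * q) s'" and fr: "frame (For ry rM digit_tables_row) s s'"
    have "params s'" by (rule params_frame[OF assms(1) fr]) (simp add: loop_defs)
    then have "params (set_reg ry q s')" by (rule params_set_reg) simp
    moreover have "tables (B * reg (set_reg ry q s') ry) (set_reg ry q s')"
      using \<open>tables (B * q) s'\<close> by (simp add: tables_def)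
    ultimately show "tables (B * Suc q) (den xs digit_tables_row (set_reg ry q s'))"
      using digit_tables_row[of "set_reg ry q s'"] by simp
  qed (use assms in \<open>simp add: tables_def\<close>)
  \<comment> \<open>The rows fill \<open>B * M\<close> entries, at least the \<open>M\<close> ones
    that are needed.\<close>
  moreover have "M \<le> B * reg s rM" using paramsD[OF assms(1)] by simp
  ultimately show ?thesis by (auto simp: tables_def)
qed

section \<open>Computing a growth order\<close>

lemma find_edge:
  assumes s: "params s" "\<And>v. arr s aVIS v = of_bool (v \<in> S)"
    and ex: "e < m" "ith_edge e = {x, y}" "x \<in> S" "y \<notin> S"
  defines "s' \<equiv> den xs find_edge s"
  shows "reg s' re < m" "ith_edge (reg s' re) = {reg s' rc, reg s' rp}"
    "reg s' rp \<in> S" "reg s' rc \<notin> S"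
proof -
  let ?P = "\<lambda>s. reg s re < m \<and> ith_edge (reg s re) = {reg s rc, reg s rp} \<and>
    reg s rp \<in> S \<and> reg s rc \<notin> S"
  define body where "body = (ru ::= Inp (Num 2 \<oplus> (Var ri \<oplus> Var ri)) ;;
      rv ::= Inp (Num 3 \<oplus> (Var ri \<oplus> Var ri)) ;;
      Cond (Arr aVIS (Var ru) \<ominus> Arr aVIS (Var rv))
        (rc ::= Var rv ;; rp ::= Var ru ;; re ::= Var ri) Nop ;;
      Cond (Arr aVIS (Var rv) \<ominus> Arr aVIS (Var ru))
        (rc ::= Var ru ;; rp ::= Var rv ;; re ::= Var ri) Nop)"
  have "(\<exists>e<reg s rE. \<exists>x y. ith_edge e = {x, y} \<and> x \<in> S \<and> y \<notin> S) \<longrightarrow> ?P (den xs find_edge s)"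
    unfolding find_edge_def body_def[symmetric]
  \<comment> \<open>The invariant is conditional: as soon as a crossing edge has been scanned, the
    registers describe some crossing edge.\<close>
  proof (rule den_For_invariant[where
        I = "\<lambda>i s'. (\<exists>e<i. \<exists>x y. ith_edge e = {x, y} \<and> x \<in> S \<and> y \<notin> S) \<longrightarrow> ?P s'"])
    fix i s'
    assume i: "i < reg s rE"
      and IH: "(\<exists>e<i. \<exists>x y. ith_edge e = {x, y} \<and> x \<in> S \<and> y \<notin> S) \<longrightarrow> ?P s'"
      and fr: "frame (For ri rE body) s s'"
    have i: "i < m" using i paramsD[OF s(1)] by simp
    have vis: "arr s' aVIS v = of_bool (v \<in> S)" for v
      using fr s(2) by (simp add: frame_def body_def)
    obtain u v where uv: "edge_list I ! i = (u, v)" by fastforce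
    then have e: "ith_edge i = {u, v}" by (simp add: ith_edge_def)
    have inp: "input_at xs (2 + (i + i)) = u" "input_at xs (3 + (i + i)) = v"
      using input_at_simps(4,5)[OF i] uv by simp_all
    have "den xs body (set_reg ri i s') =
      (let s2 = set_reg rv v (set_reg ru u (set_reg ri i s')) in
        if u \<in> S \<and> v \<notin> S then set_reg re i (set_reg rp u (set_reg rc v s2))
        else if v \<in> S \<and> u \<notin> S then set_reg re i (set_reg rp v (set_reg rc u s2)) else s2)"
      by (simp add: body_def inp[simplified] vis Let_def)
    then show "(\<exists>e<Suc i. \<exists>x y. ith_edge e = {x, y} \<and> x \<in> S \<and> y \<notin> S) \<longrightarrow>
        ?P (den xs body (set_reg ri i s'))"
      using IH e i by (auto simp: Let_def less_Suc_eq doubleton_eq_iff)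
  qed simp
  moreover have "\<exists>e<reg s rE. \<exists>x y. ith_edge e = {x, y} \<and> x \<in> S \<and> y \<notin> S"
    using ex paramsD(2)[OF s(1)] by metis
  ultimately have "?P s'" unfolding s'_def by simp
  then show "reg s' re < m" "ith_edge (reg s' re) = {reg s' rc, reg s' rp}"
    "reg s' rp \<in> S" "reg s' rc \<notin> S" by simp_all
qed

definition grown :: "nat \<Rightarrow> store \<Rightarrow> bool" where
  "grown j s \<longleftrightarrow> growth r j (arr s aCH) (arr s aPA) \<and>
     (\<forall>a<j. arr s aEI a < m \<and> ith_edge (arr s aEI a) = growth.edge (arr s aCH) (arr s aPA) a)"

lemma growth_edge_eq: "growth r j ch pa \<Longrightarrow> growth.edge ch pa a = {ch a, pa a}"
  by (rule growth.edge_def)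

text \<open>The marks always describe the reached vertices, and as long as \<open>j < m\<close>,
  \<open>growth_crossing\<close> supplies the edge that the search needs.\<close>

lemma grow_loop:
  assumes s: "params s" "\<And>v. arr s aVIS v = of_bool (v = r)"
  shows "grown m (den xs grow_loop s)"
proof -
  let ?I = "\<lambda>j s. grown j s \<and> (\<forall>v. arr s aVIS v = of_bool (v \<in> insert r (arr s aCH ` {..<j})))"
  have "?I (reg s rE) (den xs grow_loop s)"
    unfolding grow_loop_def
  proof (rule den_For_invariant[where I = ?I])
    show "?I 0 s" using s by (simp add: grown_def growth_def)
  next
    fix j s1
    assume "j < reg s rE" and I: "?I j s1"
      and fr: "frame (For rj rE (find_edge ;; Update aCH (Var rj) (Var rc) ;;
        Update aPA (Var rj) (Var rp) ;; Update aEI (Var rj) (Var re) ;;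
        Update aVIS (Var rc) (Num 1))) s s1"
    have j: "j < m" using \<open>j < reg s rE\<close> paramsD[OF s(1)] by simp
    define S where "S = insert r (arr s1 aCH ` {..<j})"
    have "params s1" by (rule params_frame[OF s(1) fr]) (simp add: loop_defs)
    then have par: "params (set_reg rj j s1)" by (rule params_set_reg) simp
    have vis: "arr (set_reg rj j s1) aVIS v = of_bool (v \<in> S)" for v using I by (simp add: S_def)
    interpret g: growth r j "arr s1 aCH" "arr s1 aPA" using I by (simp add: grown_def)
    have "g.edge ` {..<j} \<subseteq> edges T" using I unfolding edges_T grown_def by force
    then obtain x y where "{x, y} \<in> edges T" "x \<in> g.reached j" "y \<notin> g.reached j"
      by (rule g.growth_crossing[OF tree_T])
        (use root_less verts_T j card_edges_T in simp_all)
    then obtain e where e: "e < m" "ith_edge e = {x, y}" "x \<in> S" "y \<notin> S"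
      unfolding edges_T S_def g.reached_def by auto
    define s2 where "s2 = den xs find_edge (set_reg rj j s1)"
    note found = find_edge[OF par vis e, folded s2_def]
    have s2: "reg s2 rj = j" "arr s2 = arr s1"
      using frame_den[of find_edge "set_reg rj j s1" xs]
      by (auto simp: s2_def frame_def find_edge_def)
    let ?ch = "(arr s1 aCH)(j := reg s2 rc)" and ?pa = "(arr s1 aPA)(j := reg s2 rp)"
    have ext: "growth r (Suc j) ?ch ?pa"
      using growth_extend[OF g.growth_axioms, folded S_def, OF found(4,3)] .
    define s3 where "s3 = den xs (find_edge ;; Update aCH (Var rj) (Var rc) ;;
        Update aPA (Var rj) (Var rp) ;; Update aEI (Var rj) (Var re) ;;
        Update aVIS (Var rc) (Num 1)) (set_reg rj j s1)"
    have s3: "arr s3 aCH = ?ch" "arr s3 aPA = ?pa" "arr s3 aEI = (arr s1 aEI)(j := reg s2 re)"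
      "arr s3 aVIS = (arr s1 aVIS)(reg s2 rc := 1)"
      using s2 by (simp_all add: s3_def s2_def[symmetric])
    have "grown (Suc j) s3"
      using I found ext g.growth_axioms unfolding grown_def s3
      by (auto simp: growth_edge_eq less_Suc_eq)
    moreover have "arr s3 aVIS v = of_bool (v \<in> insert r (arr s3 aCH ` {..<Suc j}))" for v
    proof -
      have "insert r (?ch ` {..<Suc j}) = insert (reg s2 rc) S"
        by (auto simp: S_def lessThan_Suc)
      then show ?thesis unfolding s3 using vis[of v] by simp
    qed
    ultimately show "?I (Suc j) s3" by blast
  qed
  then show ?thesis using paramsD[OF s(1)] by simp
qed

lemma leaf_tables:
  assumes s: "params s" "arr s aF = (\<lambda>_. 0)"
  shows "\<forall>v<n. \<forall>x<M. arr (den xs leaf_tables s) aF (M * v + x) \<noteq> 0 \<longleftrightarrow> x = 0"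
proof -
  have "\<forall>v x. x < M \<longrightarrow> (arr (den xs leaf_tables s) aF (M * v + x) \<noteq> 0 \<longleftrightarrow> v < reg s rN \<and> x = 0)"
    unfolding leaf_tables_def
  proof (rule den_For_invariant[where
        I = "\<lambda>i s'. \<forall>v x. x < M \<longrightarrow> (arr s' aF (M * v + x) \<noteq> 0 \<longleftrightarrow> v < i \<and> x = 0)"])
    fix i s'
    assume I: "\<forall>v x. x < M \<longrightarrow> (arr s' aF (M * v + x) \<noteq> 0 \<longleftrightarrow> v < i \<and> x = 0)"
      and fr: "frame (For ri rN (Update aF (Times rM (Var ri)) (Num 1))) s s'"
    have "reg s' rM = M" using fr paramsD[OF s(1)] by (simp add: frame_def)
    moreover have "x < M \<Longrightarrow> M * v + x = M * i \<longleftrightarrow> v = i \<and> x = 0" for v x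
      using row_eq_iff[of x M 0 v i] by simp
    ultimately show "\<forall>v x. x < M \<longrightarrow>
        (arr (den xs (Update aF (Times rM (Var ri)) (Num 1)) (set_reg ri i s')) aF (M * v + x) \<noteq> 0
          \<longleftrightarrow> v < Suc i \<and> x = 0)"
      using I by (auto simp: less_Suc_eq)
  qed (use s in simp)
  then show ?thesis using paramsD[OF s(1)] by simp
qed

end

text \<open>Abstracts from the store: \<open>ch\<close>, \<open>pa\<close> and \<open>ei\<close>
  stand for the arrays left by the search, with \<open>ei\<close> translating the growth order into
  positions in the input.\<close>

locale tcp_grown = tcp k I + growth "root I" "length (edge_list I)" ch pa
  for k I and ch pa :: "nat \<Rightarrow> nat" +
  fixes ei :: "nat \<Rightarrow> nat"
  assumes ei: "a < length (edge_list I) \<Longrightarrow>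
    ei a < length (edge_list I) \<and> ith_edge (ei a) = edge a"
begin

lemma edges_T_edge: "edges T = edge ` {..<m}" and reached_m: "reached m = {..<n}"
proof -
  have "edge ` {..<m} \<subseteq> edges T" unfolding edges_T using ei by force
  note complete = growth_complete[OF tree_T this _ card_edges_T[symmetric] finite_edges_T]
  show "edges T = edge ` {..<m}" "reached m = {..<n}"
    using complete root_less verts_T by auto
qed

lemma n_eq: "n = Suc m"
  using card_reached[of m] reached_m by simp

sublocale cutting "root I" "length (edge_list I)" ch pa k "Suc (nverts I)"
  by unfold_locales (use n_eq in auto)

lemma ch_less: "j < m \<Longrightarrow> ch j < n" and pa_less: "j < m \<Longrightarrow> pa j < n"
  using ch_in[of j m] pa_in[of j] reached_mono[of j m] reached_m by auto

lemma ei_surj: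
  assumes "e < m"
  obtains a where "a < m" "ei a = e"
proof -
  have "ith_edge e \<in> edges T" using assms by (simp add: edges_T)
  then obtain a where "a < m" "ith_edge e = edge a" by (auto simp: edges_T_edge)
  then show ?thesis using that ei[of a] ith_edge_inj[of "ei a" e] assms by auto
qed

lemma ei_inj: "a < m \<Longrightarrow> b < m \<Longrightarrow> ei a = ei b \<Longrightarrow> a = b"
  using ei edge_inj by (metis inj_onD lessThan_iff)

section \<open>Merging the tables\<close>

definition holds_tables :: "nat \<Rightarrow> store \<Rightarrow> bool" where
  "holds_tables j s \<longleftrightarrow> (\<forall>v<n. \<forall>x<M. arr s aF (M * v + x) \<noteq> 0 \<longleftrightarrow> x \<in> table j v)"

text \<open>Says that \<open>z\<close> is a summand of \<open>x\<close> usable for tracing back;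
  \<open>z \<le> x\<close> makes the truncated difference \<open>x - z\<close> a genuine
  one.\<close>

definition valid_step :: "nat \<Rightarrow> nat \<Rightarrow> nat \<Rightarrow> bool" where
  "valid_step j x z \<longleftrightarrow> 0 < z \<and> z < M \<and> z \<le> x \<and> x - z \<in> table (Suc j) (pa j) \<and>
     dec B z \<in> table (Suc j) (ch j)"

lemma table_iff_valid_step: "j < m \<Longrightarrow> x \<in> table j (pa j) \<longleftrightarrow> (\<exists>z. valid_step j x z)"
proof
  assume j: "j < m" and "\<exists>z. valid_step j x z"
  then obtain z where z: "valid_step j x z" by blast
  then have "x = (x - z) + z" by (simp add: valid_step_def)
  with z show "x \<in> table j (pa j)" unfolding valid_step_def table_step[OF j] by auto
qed (auto simp: table_step valid_step_def)

definition witnessed :: "nat \<Rightarrow> store \<Rightarrow> bool" where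
  "witnessed j s \<longleftrightarrow> (\<forall>x<M. (arr s aW (M * j + x) \<noteq> 0 \<longleftrightarrow> x \<in> table j (pa j)) \<and>
     (arr s aW (M * j + x) \<noteq> 0 \<longrightarrow> valid_step j x (arr s aW (M * j + x))))"

text \<open>\<open>P\<close> is the set of pairs processed so far. A valid pair only leaves a
  nonzero entry, not necessarily its own \<open>z\<close>, since another pair with the same sum may
  overwrite it by an equally valid summand.\<close>

definition merging :: "nat \<Rightarrow> (nat \<times> nat) set \<Rightarrow> store \<Rightarrow> store \<Rightarrow> bool" where
  "merging j P s s' \<longleftrightarrow>
     (\<forall>(y, z) \<in> P. valid_step j (y + z) z \<longrightarrow> arr s' aW (M * j + (y + z)) \<noteq> 0) \<and>
     (\<forall>x<M. arr s' aW (M * j + x) \<noteq> 0 \<longrightarrow> valid_step j x (arr s' aW (M * j + x))) \<and>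
     (\<forall>j' x. j' \<noteq> j \<longrightarrow> x < M \<longrightarrow> arr s' aW (M * j' + x) = arr s aW (M * j' + x))"

definition merge_ready :: "nat \<Rightarrow> store \<Rightarrow> bool" where
  "merge_ready j s \<longleftrightarrow> params s \<and> tables M s \<and> holds_tables (Suc j) s \<and>
     reg s rj = j \<and> reg s rc = ch j \<and> reg s rp = pa j"

lemma merge_ready_frame:
  assumes "merge_ready j s" "frame c s s'"
    and "reg_writes c \<subseteq> {ry, rz}" "arr_writes c \<subseteq> {aW}"
  shows "merge_ready j s'"
proof -
  have "x \<notin> {ry, rz} \<Longrightarrow> reg s' x = reg s x" "a \<noteq> aW \<Longrightarrow> arr s' a = arr s a" for x a
    using assms(2-4) unfolding frame_def by blast+
  then show ?thesis
    using assms(1) by (simp add: merge_ready_def params_def tables_def holds_tables_def)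
qed

lemma merge_row:
  assumes j: "j < m" and s: "merge_ready j s1" and y: "reg s1 ry = y" "y < M"
    and P: "merging j P s s1"
  shows "merging j (P \<union> {y} \<times> {..<M}) s (den xs merge_row s1)"
proof -
  define body where "body = Cond (Arr aF (Times rM (Var rp) \<oplus> Var ry))
       (Cond (Arr aF (Times rM (Var rc) \<oplus> Arr aDEC (Var rz)))
         (Cond (Var rz) (Update aW (Times rM (Var rj) \<oplus> (Var ry \<oplus> Var rz)) (Var rz)) Nop)
         Nop) Nop"
  have "merging j (P \<union> {y} \<times> {..<reg s1 rM}) s (den xs merge_row s1)"
    unfolding merge_row_def body_def[symmetric]
  proof (rule den_For_invariant[where I = "\<lambda>i. merging j (P \<union> {y} \<times> {..<i}) s"])
    fix i s2
    assume i: "i < reg s1 rM" and I: "merging j (P \<union> {y} \<times> {..<i}) s s2"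
      and fr: "frame (For rz rM body) s1 s2"
    have "params s1" using s by (simp add: merge_ready_def)
    then have i: "i < M" using i paramsD by simp
    have s2: "merge_ready j s2" by (rule merge_ready_frame[OF s fr]) (simp_all add: body_def)
    then have regs: "reg s2 rM = M" "reg s2 rp = pa j" "reg s2 rc = ch j" "reg s2 rj = j"
      "arr s2 aDEC i = dec B i" using i paramsD by (auto simp: merge_ready_def tables_def)
    have ry: "reg s2 ry = y" using fr y by (simp add: frame_def body_def)
    have "dec B i < M" using dec_le[of B i] i by simp
    then have F: "arr s2 aF (M * pa j + y) \<noteq> 0 \<longleftrightarrow> y \<in> table (Suc j) (pa j)"
      "arr s2 aF (M * ch j + dec B i) \<noteq> 0 \<longleftrightarrow> dec B i \<in> table (Suc j) (ch j)"
      using s2 y ch_less[OF j] pa_less[OF j] by (auto simp: merge_ready_def holds_tables_def)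
    have valid: "valid_step j (y + i) i \<longleftrightarrow>
        y \<in> table (Suc j) (pa j) \<and> dec B i \<in> table (Suc j) (ch j) \<and> 0 < i"
      using i by (auto simp: valid_step_def)
    have body: "den xs body (set_reg rz i s2) = (if valid_step j (y + i) i
        then set_arr aW (M * j + (y + i)) i (set_reg rz i s2) else set_reg rz i s2)"
      unfolding valid F[symmetric] by (simp add: body_def regs ry)
    show "merging j (P \<union> {y} \<times> {..<Suc i}) s (den xs body (set_reg rz i s2))"
    proof (cases "valid_step j (y + i) i")
      case True
      \<comment> \<open>Without this bound the entry could land in another row of
        \<open>aW\<close>.\<close>
      then have "y + i < M" using table_add_less[OF j] i by (simp add: valid_step_def)
      then have row: "M * j' + x = M * j + (y + i) \<longleftrightarrow> j' = j \<and> x = y + i" if "x < M" for j' x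
        using that by (intro row_eq_iff)
      define s3 where "s3 = set_arr aW (M * j + (y + i)) i (set_reg rz i s2)"
      have s3: "arr s3 aW = (arr s2 aW)(M * j + (y + i) := i)" by (simp add: s3_def)
      have "0 < i" using True by (simp add: valid_step_def)
      have keep: "arr s3 aW a \<noteq> 0" if "arr s2 aW a \<noteq> 0" for a
        using that \<open>0 < i\<close> by (simp add: s3)
      have "arr s3 aW (M * j + (y' + z)) \<noteq> 0"
        if "(y', z) \<in> P \<union> {y} \<times> {..<Suc i}" "valid_step j (y' + z) z" for y' z
      proof (cases "(y', z) \<in> P \<union> {y} \<times> {..<i}")
        case True
        then show ?thesis using I that(2) keep unfolding merging_def by blast
      next
        case False
        then have "y' = y" "z = i" using that by auto
        then show ?thesis using \<open>0 < i\<close> by (simp add: s3)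
      qed
      moreover have "valid_step j x (arr s3 aW (M * j + x))"
        if "x < M" "arr s3 aW (M * j + x) \<noteq> 0" for x
        using I True row[OF that(1), of j] that by (auto simp: merging_def s3)
      moreover have "arr s3 aW (M * j' + x) = arr s aW (M * j' + x)" if "j' \<noteq> j" "x < M" for j' x
        using I row[OF that(2), of j'] that by (auto simp: merging_def s3)
      ultimately show ?thesis
        unfolding body if_P[OF True] s3_def[symmetric] merging_def by blast
    next
      case False
      then show ?thesis unfolding body if_not_P[OF False]
        using I by (auto simp: merging_def less_Suc_eq)
    qed
  qed (use P in simp)
  moreover have "reg s1 rM = M" using s paramsD by (simp add: merge_ready_def)
  ultimately show ?thesis by simp
qed

lemma merge_rows:
  assumes j: "j < m" and s: "merge_ready j s" and W: "\<forall>x<M. arr s aW (M * j + x) = 0"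
  defines "s' \<equiv> den xs merge_rows s"
  shows "witnessed j s'"
    "\<forall>j' x. j' \<noteq> j \<longrightarrow> x < M \<longrightarrow> arr s' aW (M * j' + x) = arr s aW (M * j' + x)"
proof -
  have M: "reg s rM = M" using s paramsD by (simp add: merge_ready_def)
  have "merging j ({..<reg s rM} \<times> {..<M}) s s'"
    unfolding s'_def merge_rows_def
  proof (rule den_For_invariant[where I = "\<lambda>i. merging j ({..<i} \<times> {..<M}) s"])
    show "merging j ({..<0} \<times> {..<M}) s s" using W by (simp add: merging_def)
  next
    fix i s1
    assume i: "i < reg s rM" and I: "merging j ({..<i} \<times> {..<M}) s s1"
      and fr: "frame (For ry rM merge_row) s s1"
    have "merge_ready j s1" by (rule merge_ready_frame[OF s fr]) (simp_all add: merge_row_def)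
    then have "merge_ready j (set_reg ry i s1)"
      by (simp add: merge_ready_def params_def tables_def holds_tables_def)
    moreover have "merging j ({..<i} \<times> {..<M}) s (set_reg ry i s1)"
      using I by (simp add: merging_def)
    ultimately have "merging j ({..<i} \<times> {..<M} \<union> {i} \<times> {..<M}) s (den xs merge_row (set_reg ry i s1))"
      using i M by (intro merge_row[OF j]) simp_all
    moreover have "{..<i} \<times> {..<M} \<union> {i} \<times> {..<M} = {..<Suc i} \<times> {..<M}" by auto
    ultimately show "merging j ({..<Suc i} \<times> {..<M}) s (den xs merge_row (set_reg ry i s1))"
      by simp
  qed
  then have mg: "merging j ({..<M} \<times> {..<M}) s s'" by (simp add: M)
  then show "\<forall>j' x. j' \<noteq> j \<longrightarrow> x < M \<longrightarrow> arr s' aW (M * j' + x) = arr s aW (M * j' + x)"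
    by (simp add: merging_def)
  show "witnessed j s'"
    unfolding witnessed_def table_iff_valid_step[OF j]
  proof (intro allI impI conjI iffI)
    fix x
    assume x: "x < M"
    show "valid_step j x (arr s' aW (M * j + x))" if "arr s' aW (M * j + x) \<noteq> 0"
      using mg that x by (simp add: merging_def)
    then show "\<exists>z. valid_step j x z" if "arr s' aW (M * j + x) \<noteq> 0" using that by blast
    assume "\<exists>z. valid_step j x z"
    then obtain z where z: "valid_step j x z" by blast
    then have x_eq: "(x - z) + z = x" and "(x - z, z) \<in> {..<M} \<times> {..<M}"
      using x by (auto simp: valid_step_def)
    with mg have "valid_step j ((x - z) + z) z \<longrightarrow> arr s' aW (M * j + ((x - z) + z)) \<noteq> 0"
      unfolding merging_def by blast
    with z show "arr s' aW (M * j + x) \<noteq> 0" unfolding x_eq by simp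
  qed
qed

lemma copy_row:
  assumes s: "params s" "reg s rp = p" "reg s rj = j"
  shows "\<forall>v x. x < M \<longrightarrow> arr (den xs copy_row s) aF (M * v + x) =
    (if v = p then arr s aW (M * j + x) else arr s aF (M * v + x))"
proof -
  have "\<forall>v x. x < M \<longrightarrow> arr (den xs copy_row s) aF (M * v + x) =
    (if v = p \<and> x < reg s rM then arr s aW (M * j + x) else arr s aF (M * v + x))"
    unfolding copy_row_def
  proof (rule den_For_invariant[where I = "\<lambda>i s'. \<forall>v x. x < M \<longrightarrow> arr s' aF (M * v + x) =
      (if v = p \<and> x < i then arr s aW (M * j + x) else arr s aF (M * v + x))"])
    fix i s'
    assume i: "i < reg s rM" and I: "\<forall>v x. x < M \<longrightarrow> arr s' aF (M * v + x) =
        (if v = p \<and> x < i then arr s aW (M * j + x) else arr s aF (M * v + x))"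
      and fr: "frame (For ry rM (Update aF (Times rM (Var rp) \<oplus> Var ry)
        (Arr aW (Times rM (Var rj) \<oplus> Var ry)))) s s'"
    have "reg s' rM = M" "reg s' rp = p" "reg s' rj = j" "arr s' aW = arr s aW"
      using fr s paramsD by (simp_all add: frame_def)
    moreover have "x < M \<Longrightarrow> M * v + x = M * p + i \<longleftrightarrow> v = p \<and> x = i" for v x
      using row_eq_iff i paramsD[OF s(1)] by simp
    ultimately show "\<forall>v x. x < M \<longrightarrow> arr (den xs (Update aF (Times rM (Var rp) \<oplus> Var ry)
        (Arr aW (Times rM (Var rj) \<oplus> Var ry))) (set_reg ry i s')) aF (M * v + x) =
        (if v = p \<and> x < Suc i then arr s aW (M * j + x) else arr s aF (M * v + x))"
      using I by (auto simp: less_Suc_eq)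
  qed simp
  then show ?thesis using paramsD[OF s(1)] by simp
qed

lemma merge_loop:
  assumes s: "params s" "tables M s" "arr s aCH = ch" "arr s aPA = pa" "arr s aW = (\<lambda>_. 0)"
    and F: "holds_tables m s"
  defines "s' \<equiv> den xs merge_loop s"
  shows "holds_tables 0 s'" "\<forall>j<m. witnessed j s'"
proof -
  define body where "body = (rj ::= Var rE \<ominus> Num 1 \<ominus> Var ri ;; rc ::= Arr aCH (Var rj) ;;
      rp ::= Arr aPA (Var rj) ;; merge_rows ;; copy_row)"
  \<comment> \<open>Edges are processed from the last to the first, so after \<open>i\<close> rounds
    \<open>m - i\<close> edges remain. Their rows of \<open>aW\<close> must still be blank, as
    merging treats any nonzero entry as a summand.\<close>
  let ?I = "\<lambda>i s. i \<le> m \<longrightarrow> holds_tables (m - i) s \<and> (\<forall>j<m. m - i \<le> j \<longrightarrow> witnessed j s) \<and>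
    (\<forall>j x. j < m - i \<longrightarrow> x < M \<longrightarrow> arr s aW (M * j + x) = 0)"
  have "?I (reg s rE) s'"
    unfolding s'_def merge_loop_def body_def[symmetric]
  proof (rule den_For_invariant[where I = ?I])
    fix i s1
    assume "i < reg s rE" and I: "?I i s1" and fr: "frame (For ri rE body) s s1"
    have i: "i < m" using \<open>i < reg s rE\<close> paramsD[OF s(1)] by simp
    define j where "j = m - Suc i"
    have j: "j < m" "Suc j = m - i" using i by (auto simp: j_def)
    have par: "params s1" by (rule params_frame[OF s(1) fr]) (simp add: body_def loop_defs)
    have tab: "tables M s1" and arrs: "arr s1 aCH = ch" "arr s1 aPA = pa"
      using fr s by (auto simp: frame_def body_def loop_defs tables_def)
    define s2 where "s2 = set_reg rp (pa j) (set_reg rc (ch j) (set_reg rj j (set_reg ri i s1)))"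
    have ready: "merge_ready j s2"
      using par tab I j i by (simp add: merge_ready_def s2_def params_def tables_def holds_tables_def)
    have W0: "\<forall>x<M. arr s2 aW (M * j + x) = 0" using I i j by (simp add: s2_def)
    define s3 where "s3 = den xs merge_rows s2"
    note rows = merge_rows[OF j(1) ready W0, folded s3_def]
    have fr3: "frame merge_rows s2 s3" unfolding s3_def by (rule frame_den)
    have ready3: "merge_ready j s3"
      by (rule merge_ready_frame[OF ready fr3]) (simp_all add: loop_defs)
    define s4 where "s4 = den xs copy_row s3"
    have copy: "\<forall>v x. x < M \<longrightarrow> arr s4 aF (M * v + x) =
        (if v = pa j then arr s3 aW (M * j + x) else arr s3 aF (M * v + x))"
      unfolding s4_def by (rule copy_row) (use ready3 in \<open>auto simp: merge_ready_def\<close>)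
    have W4: "arr s4 aW = arr s3 aW"
      using frame_den[of copy_row s3 xs] by (simp add: s4_def frame_def copy_row_def)
    have s4: "den xs body (set_reg ri i s1) = s4"
      using paramsD[OF par] arrs
      by (simp add: body_def s4_def s3_def s2_def j_def)
    have "holds_tables j s4"
      unfolding holds_tables_def
    proof (intro allI impI)
      fix v x
      assume vx: "v < n" "x < M"
      show "arr s4 aF (M * v + x) \<noteq> 0 \<longleftrightarrow> x \<in> table j v"
      proof (cases "v = pa j")
        case True
        then have "arr s4 aF (M * v + x) = arr s3 aW (M * j + x)" using copy vx by simp
        then show ?thesis using rows(1) vx True by (simp add: witnessed_def)
      next
        case False
        then have "arr s4 aF (M * v + x) = arr s3 aF (M * v + x)" using copy vx by simp
        moreover have "table j v = table (Suc j) v" using False j(1) by (simp add: table_step)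
        ultimately show ?thesis using ready3 vx by (simp add: merge_ready_def holds_tables_def)
      qed
    qed
    moreover have "witnessed j' s4" if "j' < m" "j \<le> j'" for j'
    proof (cases "j' = j")
      case True
      then show ?thesis using rows(1) by (simp add: witnessed_def W4)
    next
      case False
      then have "witnessed j' s1" using I i that j by simp
      then show ?thesis using rows(2) False by (simp add: witnessed_def W4 s2_def)
    qed
    moreover have "arr s4 aW (M * j' + x) = 0" if "j' < j" "x < M" for j' x
      using rows(2) that I i j by (simp add: W4 s2_def)
    ultimately show "?I (Suc i) (den xs body (set_reg ri i s1))" unfolding s4 j_def by auto
  qed (use F s in simp)
  then show "holds_tables 0 s'" "\<forall>j<m. witnessed j s'" using paramsD[OF s(1)] by simp_all
qed

end

section \<open>Target vector and output\<close>

context tcp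
begin

lemma params_den:
  "params s \<Longrightarrow> reg_writes c \<inter> {rN, rE, rB, rK, rM, rR} = {} \<Longrightarrow> params (den xs c s)"
  by (rule params_frame[OF _ frame_den])

lemma target_loop:
  assumes s: "params s" "reg s rok = 1" "reg s rS = 0"
  defines "s' \<equiv> den xs target_loop s"
  shows "reg s' rok \<noteq> 0 \<longleftrightarrow> (\<forall>i<k. sizes I ! i < B)" "reg s' rS = code B k (\<lambda>i. sizes I ! i)"
proof -
  define body where "body =
     (ru ::= Inp (Num 3 \<oplus> (Var rE \<oplus> Var rE) \<oplus> (Var rK \<ominus> Num 1 \<ominus> Var ri)) ;;
      rS ::= Var ru \<oplus> Times rB (Var rS) ;;
      Cond (Var ru \<oplus> Num 1 \<ominus> Var rB) (rok ::= Num 0) Nop)"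
  \<comment> \<open>After \<open>i\<close> rounds exactly the last \<open>i\<close> sizes have been
    read, starting at position \<open>k - i\<close>.\<close>
  let ?I = "\<lambda>i s. i \<le> k \<longrightarrow> reg s rS = code B i (\<lambda>a. sizes I ! (k - i + a)) \<and>
    (reg s rok \<noteq> 0 \<longleftrightarrow> (\<forall>a<k. k - i \<le> a \<longrightarrow> sizes I ! a < B))"
  have "?I (reg s rK) s'"
    unfolding s'_def target_loop_def body_def[symmetric]
  proof (rule den_For_invariant[where I = ?I])
    show "?I 0 s" using s by (simp add: code_def)
  next
    fix i s1
    assume "i < reg s rK" and I: "?I i s1" and fr: "frame (For ri rK body) s s1"
    have i: "i < k" using \<open>i < reg s rK\<close> paramsD[OF s(1)] by simp
    have par: "params s1" by (rule params_frame[OF s(1) fr]) (simp add: body_def)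
    define a where "a = k - Suc i"
    have a: "a < k" "k - i = Suc a" using i by (auto simp: a_def)
    have inp: "input_at xs (3 + (m + m) + (k - Suc i)) = sizes I ! a"
      using input_at_simps(6)[OF a(1)] by (simp add: a_def)
    define s2 where "s2 = den xs body (set_reg ri i s1)"
    have s2: "reg s2 rS = sizes I ! a + B * reg s1 rS"
      "reg s2 rok = (if sizes I ! a < B then reg s1 rok else 0)"
      using paramsD[OF par] inp by (simp_all add: s2_def body_def not_less)
    have "sizes I ! a + B * reg s1 rS = code B (Suc i) (\<lambda>b. sizes I ! (a + b))"
      using I i a by (simp add: code_shift)
    moreover have "(\<forall>b<k. a \<le> b \<longrightarrow> sizes I ! b < B) \<longleftrightarrow>
        sizes I ! a < B \<and> (\<forall>b<k. Suc a \<le> b \<longrightarrow> sizes I ! b < B)"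
      using a by (metis le_eq_less_or_eq Suc_le_eq)
    moreover have "reg s1 rok \<noteq> 0 \<longleftrightarrow> (\<forall>b<k. Suc a \<le> b \<longrightarrow> sizes I ! b < B)"
      using I i a by simp
    ultimately have "?I (Suc i) s2" unfolding s2 a_def[symmetric] by simp
    then show "?I (Suc i) (den xs body (set_reg ri i s1))" by (simp add: s2_def)
  qed
  then show "reg s' rok \<noteq> 0 \<longleftrightarrow> (\<forall>i<k. sizes I ! i < B)" "reg s' rS = code B k (\<lambda>i. sizes I ! i)"
    using paramsD[OF s(1)] by simp_all
qed

lemma print_verts:
  assumes s: "params s" "tables M s" "\<forall>v<n. arr s aZC v < M"
  defines "s' \<equiv> den xs print_verts s"
  shows "out s' = out s @ map (\<lambda>v. of_bool (v = r \<or> 0 < arr s aZC v mod B)) [0..<n]"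
    "\<forall>v<n. arr s' aZC v = arr s aZC v div B"
proof -
  define body where "body = (Cond ((Var rv \<ominus> Var rR) \<oplus> (Var rR \<ominus> Var rv))
        (Out (Num 1 \<ominus> (Num 1 \<ominus> Arr aMOD (Arr aZC (Var rv))))) (Out (Num 1)) ;;
      Update aZC (Var rv) (Arr aDIV (Arr aZC (Var rv))))"
  let ?I = "\<lambda>i s'. out s' = out s @ map (\<lambda>v. of_bool (v = r \<or> 0 < arr s aZC v mod B)) [0..<i] \<and>
    (\<forall>v. arr s' aZC v = (if v < i then arr s aZC v div B else arr s aZC v))"
  have "?I (reg s rN) s'"
    unfolding s'_def print_verts_def body_def[symmetric]
  proof (rule den_For_invariant[where I = ?I])
    fix i s1
    assume "i < reg s rN" and I: "?I i s1" and fr: "frame (For rv rN body) s s1"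
    have i: "i < n" using \<open>i < reg s rN\<close> paramsD[OF s(1)] by simp
    have par: "params s1" by (rule params_frame[OF s(1) fr]) (simp add: body_def)
    have "arr s1 aMOD = arr s aMOD" "arr s1 aDIV = arr s aDIV"
      using fr by (simp_all add: frame_def body_def)
    then have tab: "arr s1 aMOD (arr s aZC i) = arr s aZC i mod B"
      "arr s1 aDIV (arr s aZC i) = arr s aZC i div B"
      using s i by (simp_all add: tables_def)
    show "?I (Suc i) (den xs body (set_reg rv i s1))"
      using I tab paramsD[OF par] by (auto simp: body_def less_Suc_eq)
  qed simp
  then show "out s' = out s @ map (\<lambda>v. of_bool (v = r \<or> 0 < arr s aZC v mod B)) [0..<n]"
    "\<forall>v<n. arr s' aZC v = arr s aZC v div B"
    using paramsD[OF s(1)] by simp_all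
qed

lemma print_edges:
  assumes s: "params s" "tables M s" "\<forall>e<m. arr s aZE e < M"
  defines "s' \<equiv> den xs print_edges s"
  shows "out s' = out s @ map (\<lambda>e. of_bool (0 < arr s aZE e mod B)) [0..<m]"
    "\<forall>e<m. arr s' aZE e = arr s aZE e div B"
proof -
  define body where "body = (Out (Num 1 \<ominus> (Num 1 \<ominus> Arr aMOD (Arr aZE (Var re)))) ;;
      Update aZE (Var re) (Arr aDIV (Arr aZE (Var re))))"
  let ?I = "\<lambda>i s'. out s' = out s @ map (\<lambda>e. of_bool (0 < arr s aZE e mod B)) [0..<i] \<and>
    (\<forall>e. arr s' aZE e = (if e < i then arr s aZE e div B else arr s aZE e))"
  have "?I (reg s rE) s'"
    unfolding s'_def print_edges_def body_def[symmetric]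
  proof (rule den_For_invariant[where I = ?I])
    fix i s1
    assume "i < reg s rE" and I: "?I i s1" and fr: "frame (For re rE body) s s1"
    have i: "i < m" using \<open>i < reg s rE\<close> paramsD[OF s(1)] by simp
    have "arr s1 aMOD = arr s aMOD" "arr s1 aDIV = arr s aDIV"
      using fr by (simp_all add: frame_def body_def)
    then have tab: "arr s1 aMOD (arr s aZE i) = arr s aZE i mod B"
      "arr s1 aDIV (arr s aZE i) = arr s aZE i div B"
      using s i by (simp_all add: tables_def)
    show "?I (Suc i) (den xs body (set_reg re i s1))"
      using I tab by (auto simp: body_def less_Suc_eq)
  qed simp
  then show "out s' = out s @ map (\<lambda>e. of_bool (0 < arr s aZE e mod B)) [0..<m]"
    "\<forall>e<m. arr s' aZE e = arr s aZE e div B"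
    using paramsD[OF s(1)] by simp_all
qed

lemma print_loop:
  assumes s: "params s" "tables M s" "\<forall>v<n. arr s aZC v < M" "\<forall>e<m. arr s aZE e < M"
  shows "out (den xs print_loop s) = out s @ concat (map (\<lambda>i.
     map (\<lambda>v. of_bool (v = r \<or> 0 < digit B i (arr s aZC v))) [0..<n] @
     map (\<lambda>e. of_bool (0 < digit B i (arr s aZE e))) [0..<m]) [0..<k])"
proof -
  \<comment> \<open>Before pass \<open>i\<close> the vectors are divided by \<open>B ^ i\<close>, so
    their remainder modulo \<open>B\<close> is digit \<open>i\<close>.\<close>
  let ?I = "\<lambda>i s'. out s' = out s @ concat (map (\<lambda>i.
     map (\<lambda>v. of_bool (v = r \<or> 0 < digit B i (arr s aZC v))) [0..<n] @
     map (\<lambda>e. of_bool (0 < digit B i (arr s aZE e))) [0..<m]) [0..<i]) \<and>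
     (\<forall>v<n. arr s' aZC v = arr s aZC v div B ^ i) \<and> (\<forall>e<m. arr s' aZE e = arr s aZE e div B ^ i)"
  have "?I (reg s rK) (den xs print_loop s)"
    unfolding print_loop_def
  proof (rule den_For_invariant[where I = ?I])
    fix i s1
    assume I: "?I i s1" and fr: "frame (For ri rK (print_verts ;; print_edges)) s s1"
    define s2 where "s2 = set_reg ri i s1"
    have "params s1" by (rule params_frame[OF s(1) fr]) (simp add: loop_defs)
    then have par2: "params s2" by (simp add: s2_def params_def)
    have "arr s1 aMOD = arr s aMOD" "arr s1 aDIV = arr s aDIV" "arr s1 aDEC = arr s aDEC"
      using fr by (simp_all add: frame_def loop_defs)
    then have tab2: "tables M s2" using s(2) by (simp add: tables_def s2_def)
    have Z: "\<forall>v<n. arr s2 aZC v = arr s aZC v div B ^ i" "\<forall>e<m. arr s2 aZE e = arr s aZE e div B ^ i"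
      using I by (simp_all add: s2_def)
    then have less: "\<forall>v<n. arr s2 aZC v < M" "\<forall>e<m. arr s2 aZE e < M"
      using s(3,4) by (simp_all add: le_less_trans[OF div_le_dividend])
    define s3 where "s3 = den xs print_verts s2"
    note verts = print_verts[OF par2 tab2 less(1), folded s3_def]
    have same: "arr s3 aMOD = arr s2 aMOD" "arr s3 aDIV = arr s2 aDIV" "arr s3 aDEC = arr s2 aDEC"
      "arr s3 aZE = arr s2 aZE"
      unfolding s3_def by (simp_all add: den_unchanged loop_defs del: den.simps)
    have par3: "params s3" unfolding s3_def by (rule params_den[OF par2]) (simp add: loop_defs)
    have tab3: "tables M s3" using tab2 same by (simp add: tables_def)
    define s4 where "s4 = den xs print_edges s3"
    have "\<forall>e<m. arr s3 aZE e < M" using less same by simp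
    note edges = print_edges[OF par3 tab3 this, folded s4_def]
    have zc: "arr s4 aZC = arr s3 aZC"
      unfolding s4_def by (simp add: den_unchanged loop_defs del: den.simps)
    have row: "map (\<lambda>v. of_bool (v = r \<or> 0 < arr s2 aZC v mod B)) [0..<n] =
        map (\<lambda>v. of_bool (v = r \<or> 0 < digit B i (arr s aZC v)) :: nat) [0..<n]"
      "map (\<lambda>e. of_bool (0 < arr s2 aZE e mod B)) [0..<m] =
        map (\<lambda>e. of_bool (0 < digit B i (arr s aZE e)) :: nat) [0..<m]"
      using Z by (auto simp: digit_def)
    have "out s2 = out s1" by (simp add: s2_def)
    then have "?I (Suc i) s4"
      using I verts edges Z same zc unfolding row
      by (simp add: row div_mult2_eq[symmetric] mult.commute)
    then show "?I (Suc i) (den xs (print_verts ;; print_edges) (set_reg ri i s1))"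
      by (simp add: s4_def s3_def s2_def)
  qed simp
  then show ?thesis using paramsD[OF s(1)] by simp
qed

end

section \<open>Tracing a solution back\<close>

context tcp_grown
begin

text \<open>Soundness: \<open>aCUR\<close> plays the role of the weights, and every round performs
  \<open>weighted_Suc\<close> with the summand stored in \<open>aW\<close>. Summands already
  recorded survive, since children and input positions are distinct for distinct edges.\<close>

lemma traceback_loop:
  assumes s: "params s" "tables M s" "arr s aCH = ch" "arr s aPA = pa" "arr s aEI = ei"
    and W: "\<forall>j<m. witnessed j s" and Z: "\<forall>v. arr s aZC v < M"
    and w0: "weighted ss 0 (arr s aCUR) J"
  defines "s' \<equiv> den xs traceback_loop s"
  shows "\<exists>w. weighted ss m w (\<lambda>a i. 0 < digit B i (arr s' aZC (ch a)))"
    "\<forall>v. arr s' aZC v < M" "\<forall>a<m. arr s' aZE (ei a) = arr s' aZC (ch a)"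
proof -
  define body where "body = (rc ::= Arr aCH (Var rj) ;;
      rp ::= Arr aPA (Var rj) ;;
      rz ::= Arr aW (Times rM (Var rj) \<oplus> Arr aCUR (Var rp)) ;;
      Update aCUR (Var rp) (Arr aCUR (Var rp) \<ominus> Var rz) ;;
      Update aCUR (Var rc) (Arr aDEC (Var rz)) ;;
      Update aZC (Var rc) (Var rz) ;;
      Update aZE (Arr aEI (Var rj)) (Var rz))"
  let ?I = "\<lambda>j s. (\<exists>J. weighted ss j (arr s aCUR) J \<and>
      (\<forall>a<j. J a = (\<lambda>i. 0 < digit B i (arr s aZC (ch a))))) \<and>
    (\<forall>v. arr s aZC v < M) \<and> (\<forall>a<j. arr s aZE (ei a) = arr s aZC (ch a))"
  have "j \<le> m \<longrightarrow> ?I j s'" if "j = reg s rE" for j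
    unfolding that s'_def traceback_loop_def body_def[symmetric]
  proof (rule den_For_invariant[where I = "\<lambda>j s. j \<le> m \<longrightarrow> ?I j s"])
    show "0 \<le> m \<longrightarrow> ?I 0 s" using Z w0 by auto
  next
    fix j s1
    assume "j < reg s rE" and "j \<le> m \<longrightarrow> ?I j s1" and fr: "frame (For rj rE body) s s1"
    then have j: "j < m" and I: "?I j s1" using paramsD[OF s(1)] by auto
    then obtain J where J: "weighted ss j (arr s1 aCUR) J"
      "\<forall>a<j. J a = (\<lambda>i. 0 < digit B i (arr s1 aZC (ch a)))" by blast
    have par: "params s1" by (rule params_frame[OF s(1) fr]) (simp add: body_def)
    have same: "arr s1 aCH = ch" "arr s1 aPA = pa" "arr s1 aEI = ei" "arr s1 aW = arr s aW"
      "arr s1 aDEC = arr s aDEC" using fr s by (simp_all add: frame_def body_def)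
    define x where "x = arr s1 aCUR (pa j)"
    define z where "z = arr s aW (M * j + x)"
    have x: "x \<in> table j (pa j)" using J(1) pa_in[OF j] by (simp add: weighted_def x_def)
    then have "x < M" using j table_less[of j] by simp
    then have z: "valid_step j x z" using W j x by (simp add: witnessed_def z_def)
    have dec_z: "arr s aDEC z = dec B z" using s(2) z by (simp add: tables_def valid_step_def)
    have weighted: "weighted ss (Suc j) ((arr s1 aCUR)(pa j := x - z, ch j := dec B z))
        (J(j := \<lambda>i. 0 < digit B i z))"
      using z by (intro weighted_Suc[OF j J(1)]) (auto simp: valid_step_def x_def)
    define s2 where "s2 = den xs body (set_reg rj j s1)"
    have s2: "arr s2 aCUR = (arr s1 aCUR)(pa j := x - z, ch j := dec B z)"
      "arr s2 aZC = (arr s1 aZC)(ch j := z)" "arr s2 aZE = (arr s1 aZE)(ei j := z)"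
      using paramsD[OF par] dec_z
      by (simp_all add: s2_def body_def same x_def[symmetric] z_def[symmetric])
    have "ch a \<noteq> ch j" "ei a \<noteq> ei j" if "a < j" for a
      using that ch_neq[OF j that] ei_inj[of a j] j by auto
    then have "?I (Suc j) s2"
      using weighted J(2) I z unfolding s2
      by (intro conjI exI[of _ "J(j := \<lambda>i. 0 < digit B i z)"])
        (auto simp: less_Suc_eq valid_step_def)
    then show "Suc j \<le> m \<longrightarrow> ?I (Suc j) (den xs body (set_reg rj j s1))" by (simp add: s2_def)
  qed
  from this[of m] obtain J where J: "weighted ss m (arr s' aCUR) J"
    "\<forall>a<m. J a = (\<lambda>i. 0 < digit B i (arr s' aZC (ch a)))"
    and rest: "\<forall>v. arr s' aZC v < M" "\<forall>a<m. arr s' aZE (ei a) = arr s' aZC (ch a)"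
    using paramsD[OF s(1)] by auto
  \<comment> \<open>The recorded summands determine \<open>J\<close> only on the edges
    \<open>a < m\<close>, and \<open>weighted\<close> looks at no others; so \<open>J\<close> may be
    replaced by what is read off the store.\<close>
  let ?J = "\<lambda>a i. 0 < digit B i (arr s' aZC (ch a))"
  have eq: "J a i = ?J a i" if "a < m" for a i using J(2) that by simp
  have "joined a J v i = joined a ?J v i" if "a \<le> m" for a v i
    using that eq by (auto simp: joined_def)
  then have "weighted ss m (arr s' aCUR) ?J"
    using J(1) eq unfolding weighted_m_iff by (simp cong: conj_cong)
  then show "\<exists>w. weighted ss m w ?J" by blast
  show "\<forall>v. arr s' aZC v < M" "\<forall>a<m. arr s' aZE (ei a) = arr s' aZC (ch a)" by (fact rest)+
qed

text \<open>A vertex other than the root is the child of exactly one edge, so the vector of this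
  edge also decides whether a part contains the vertex.\<close>

lemma encode_part:
  assumes J: "\<And>a i. J a i \<longleftrightarrow> 0 < digit B i (zc (ch a))" and ze: "\<forall>a<m. ze (ei a) = zc (ch a)"
  shows "encode_subgraph I (part J i) =
    map (\<lambda>v. of_bool (v = r \<or> 0 < digit B i (zc v))) [0..<n] @
    map (\<lambda>e. of_bool (0 < digit B i (ze e))) [0..<m]"
proof -
  have "joined m J v i \<longleftrightarrow> v = r \<or> 0 < digit B i (zc v)" if "v < n" for v
  proof -
    have "v \<in> reached m" using that reached_m by simp
    then show ?thesis using J by (auto simp: joined_def reached_def)
  qed
  then have verts: "map (\<lambda>v. of_bool (v \<in> verts (part J i))) [0..<n] =
      map (\<lambda>v. of_bool (v = r \<or> 0 < digit B i (zc v)) :: nat) [0..<n]"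
    by (auto simp: part_def)
  have mem: "ith_edge e \<in> edges (part J i) \<longleftrightarrow> 0 < digit B i (ze e)" if e: "e < m" for e
  proof -
    obtain a where a: "a < m" "ei a = e" using ei_surj[OF e] .
    have "ith_edge e = edge a" using ei[OF a(1)] a(2) by simp
    moreover have "edge a \<in> edge ` {b. b < m \<and> J b i} \<longleftrightarrow> J a i"
      using a(1) edge_inj by (auto simp: inj_on_def)
    ultimately show ?thesis using J ze a by (auto simp: part_def)
  qed
  have "map (\<lambda>(u, v). of_bool ({u, v} \<in> edges (part J i)) :: nat) (edge_list I) =
      map (\<lambda>e. of_bool (ith_edge e \<in> edges (part J i))) [0..<m]"
    by (rule nth_equalityI) (auto simp: ith_edge_def split: prod.split)
  also have "\<dots> = map (\<lambda>e. of_bool (0 < digit B i (ze e))) [0..<m]"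
    using mem by simp
  finally show ?thesis using verts by (simp add: encode_subgraph_def)
qed

text \<open>When all edges are cut off, only the root remains and no edge is counted separately; its
  weight must have the sizes as digits. Each size is at most \<open>m\<close>, which justifies
  rejecting sizes beyond the base.\<close>

lemma solution_imp_table:
  assumes "tcp_solution I Ts"
  shows "\<forall>i<k. sizes I ! i < B" "code B k (\<lambda>i. sizes I ! i) \<in> table 0 r"
proof -
  have C: "tree_cutting T r (sizes I) Ts" using assms by (simp add: tcp_solution_def)
  show less: "\<forall>i<k. sizes I ! i < B"
  proof (intro allI impI)
    fix i
    assume "i < k"
    then have "edges (Ts ! i) \<subseteq> edges T" "card (edges (Ts ! i)) = sizes I ! i"
      using C length_sizes by (auto simp: tree_cutting_def subgraph_def)
    moreover from this(1) have "card (edges (Ts ! i)) \<le> card (edges T)"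
      by (rule card_mono[OF finite_edges_T])
    ultimately show "sizes I ! i < B" using card_edges_T n_eq by simp
  qed
  obtain w where w: "weighted (\<lambda>i. sizes I ! i) 0 w (\<lambda>a i. edge a \<in> edges (Ts ! i))"
    using weighted_0[OF tree_cutting_imp_weighted[OF edges_T_edge C length_sizes]] .
  then have root: "w r \<in> table 0 r" "\<And>i. i < k \<Longrightarrow> digit B i (w r) = sizes I ! i"
    by (auto simp: weighted_def reached_def)
  have "w r = code B k (\<lambda>i. digit B i (w r))" using table_less[OF _ root(1)] by (simp add: code_digit)
  also have "\<dots> = code B k (\<lambda>i. sizes I ! i)" using root(2) by (simp add: code_def)
  finally show "code B k (\<lambda>i. sizes I ! i) \<in> table 0 r" using root(1) by simp
qed

text \<open>The conditions on \<open>J\<close> concern edges below index 0 and are vacuous, so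
  tracing back can start from any \<open>J\<close>.\<close>

lemma weighted_start:
  assumes "\<forall>i<k. sizes I ! i < B" "w r = code B k (\<lambda>i. sizes I ! i)" "w r \<in> table 0 r"
  shows "weighted (\<lambda>i. sizes I ! i) 0 w J"
  using assms by (simp add: weighted_def reached_def joined_def digit_code)

lemma traceback_answer:
  assumes s: "params s" "tables M s" "arr s aCH = ch" "arr s aPA = pa" "arr s aEI = ei"
    and W: "\<forall>j<m. witnessed j s" and Z: "arr s aZC = (\<lambda>_. 0)"
    and w0: "weighted (\<lambda>i. sizes I ! i) 0 (arr s aCUR) (\<lambda>_ _. False)"
  obtains Ts where "tcp_solution I Ts"
    "out (den xs (traceback_loop ;; print_loop) s) = out s @ concat (map (encode_subgraph I) Ts)"
proof -
  define s1 where "s1 = den xs traceback_loop s"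
  define J where "J = (\<lambda>a i. 0 < digit B i (arr s1 aZC (ch a)))"
  have Z: "\<forall>v. arr s aZC v < M" using Z n_pos by simp
  note tb = traceback_loop[OF s W Z w0, folded s1_def]
  obtain w where "weighted (\<lambda>i. sizes I ! i) m w J" using tb(1) by (auto simp: J_def)
  then have "tcp_solution I (map (part J) [0..<k])"
    unfolding tcp_solution_def
    by (intro weighted_imp_tree_cutting)
      (use edges_T_edge reached_m verts_T length_sizes in simp_all)
  moreover have par: "params s1" unfolding s1_def by (rule params_den[OF s(1)]) (simp add: loop_defs)
  have tab: "tables M s1"
    using s(2) by (simp add: s1_def tables_def den_unchanged loop_defs del: den.simps)
  have ze: "\<forall>e<m. arr s1 aZE e < M" using tb(2,3) ei_surj by metis
  have "out (den xs (traceback_loop ;; print_loop) s) =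
      out s @ concat (map (encode_subgraph I) (map (part J) [0..<k]))"
  proof -
    have "out s1 = out s" by (simp add: s1_def den_unchanged loop_defs del: den.simps)
    moreover have "encode_subgraph I (part J i) =
        map (\<lambda>v. of_bool (v = r \<or> 0 < digit B i (arr s1 aZC v))) [0..<n] @
        map (\<lambda>e. of_bool (0 < digit B i (arr s1 aZE e))) [0..<m]" for i
      by (rule encode_part) (use tb(3) in \<open>simp_all add: J_def\<close>)
    ultimately show ?thesis
      using print_loop[OF par tab _ ze] tb(2) by (simp add: s1_def comp_def)
  qed
  ultimately show ?thesis using that by blast
qed

end

section \<open>Correctness of the whole program\<close>

context tcp
begin

lemma solve_correct:
  assumes s0: "params s0" "arr s0 = (\<lambda>_ _. 0)" "out s0 = []"
  shows "tcp_answer I (out (den xs solve s0))"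
proof -
  define s1 where "s1 = den xs digit_tables s0"
  define s2 where "s2 = set_arr aVIS r 1 s1"
  define s3 where "s3 = den xs grow_loop s2"
  define s4 where "s4 = den xs leaf_tables s3"
  define s5 where "s5 = den xs merge_loop s4"
  define s6 where "s6 = set_reg rok 1 (set_reg rS 0 s5)"
  define s7 where "s7 = den xs target_loop s6"
  have p1: "params s1" unfolding s1_def by (rule params_den[OF s0(1)]) (simp add: loop_defs)
  then have p2: "params s2" by (simp add: s2_def params_def)
  have p3: "params s3" unfolding s3_def by (rule params_den[OF p2]) (simp add: loop_defs)
  have p4: "params s4" unfolding s4_def by (rule params_den[OF p3]) (simp add: loop_defs)
  have p5: "params s5" unfolding s5_def by (rule params_den[OF p4]) (simp add: loop_defs)
  then have p6: "params s6" by (simp add: s6_def params_def)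
  have p7: "params s7" unfolding s7_def by (rule params_den[OF p6]) (simp add: loop_defs)
  have a1: "a \<notin> {aDEC, aDIV, aMOD} \<Longrightarrow> arr s1 a = (\<lambda>_. 0)" for a
    using s0(2) by (simp add: s1_def den_unchanged loop_defs del: den.simps)
  have a3: "a \<notin> {aCH, aPA, aEI, aVIS} \<Longrightarrow> arr s3 a = arr s2 a" for a
    by (simp add: s3_def den_unchanged loop_defs del: den.simps)
  have a4: "a \<noteq> aF \<Longrightarrow> arr s4 a = arr s3 a" for a
    by (simp add: s4_def den_unchanged loop_defs del: den.simps)
  have a5: "a \<notin> {aF, aW} \<Longrightarrow> arr s5 a = arr s4 a" for a
    by (simp add: s5_def den_unchanged loop_defs del: den.simps)
  have a7: "arr s7 = arr s5"
    by (rule ext) (simp add: s7_def s6_def den_unchanged loop_defs del: den.simps)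
  have "out s7 = out s0"
    by (simp add: s7_def s6_def s5_def s4_def s3_def s2_def s1_def den_unchanged loop_defs del: den.simps)
  then have out7: "out s7 = []" using s0(3) by simp
  have t1: "tables M s1" unfolding s1_def by (rule digit_tables[OF s0(1,2)])
  have t4: "tables M s4" using t1 by (simp add: tables_def a4 a3 s2_def)
  have t7: "tables M s7" using t4 by (simp add: tables_def a7 a5)
  have "arr s2 aVIS v = of_bool (v = r)" for v using a1[of aVIS] by (simp add: s2_def)
  from grow_loop[OF p2 this] have g: "grown m s3" by (simp add: s3_def)
  \<comment> \<open>From here on the growth order is the one found by the search and kept in the
    arrays of \<open>s3\<close>.\<close>
  interpret tcp_grown k I "arr s3 aCH" "arr s3 aPA" "arr s3 aEI"
    using g unfolding grown_def tcp_grown_def tcp_grown_axioms_def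
    by (simp add: tcp_axioms)
  have "\<forall>v<n. \<forall>x<M. arr s4 aF (M * v + x) \<noteq> 0 \<longleftrightarrow> x = 0"
    unfolding s4_def by (rule leaf_tables[OF p3]) (simp add: a3 s2_def a1)
  then have "holds_tables m s4" by (simp add: holds_tables_def table_m)
  then have merged: "holds_tables 0 s5" "\<forall>j<m. witnessed j s5"
    using merge_loop[OF p4 t4] by (simp_all add: s5_def a4 a3 s2_def a1)
  define S where "S = code B k (\<lambda>i. sizes I ! i)"
  have ok: "reg s7 rok \<noteq> 0 \<longleftrightarrow> (\<forall>i<k. sizes I ! i < B)" "reg s7 rS = S"
    using target_loop[OF p6] by (simp_all add: s6_def s7_def S_def)
  have S: "S < M" if "reg s7 rok \<noteq> 0"
    using that ok(1) unfolding S_def by (intro code_less) simp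
  have hit: "arr s7 aF (M * r + S) \<noteq> 0 \<longleftrightarrow> S \<in> table 0 r" if "reg s7 rok \<noteq> 0"
    using merged(1) S[OF that] root_less by (simp add: a7 holds_tables_def)
  let ?s8 = "set_arr aCUR r S (emit 1 s7)"
  have solve_s7: "den xs solve s0 = den xs (Cond (Var rok)
      (Cond (Arr aF (Times rM (Var rR) \<oplus> Var rS))
        (Out (Num 1) ;; Update aCUR (Var rR) (Var rS) ;; traceback_loop ;; print_loop)
        (Out (Num 0)))
      (Out (Num 0))) s7"
    unfolding s7_def s6_def s5_def s4_def s3_def s2_def s1_def
    by (simp only: solve_def den.simps val.simps paramsD(6)[OF p1, unfolded s1_def])
  have out_solve: "out (den xs solve s0) =
      (if reg s7 rok \<noteq> 0 \<and> arr s7 aF (M * r + S) \<noteq> 0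
       then out (den xs (traceback_loop ;; print_loop) ?s8) else [0])"
    unfolding solve_s7 using paramsD[OF p7] ok(2) out7 by simp
  show ?thesis
  proof (cases "reg s7 rok \<noteq> 0 \<and> S \<in> table 0 r")
    case True
    then have "\<forall>i<k. sizes I ! i < B" "S \<in> table 0 r" using ok(1) by simp_all
    then have w0: "weighted (\<lambda>i. sizes I ! i) 0 (arr ?s8 aCUR) (\<lambda>_ _. False)"
      by (intro weighted_start) (simp_all add: S_def)
    have pre: "params ?s8" "tables M ?s8" "arr ?s8 aCH = arr s3 aCH" "arr ?s8 aPA = arr s3 aPA"
      "arr ?s8 aEI = arr s3 aEI" "\<forall>j<m. witnessed j ?s8" "arr ?s8 aZC = (\<lambda>_. 0)"
      using p7 t7 merged(2)
      by (simp_all add: params_def tables_def witnessed_def a7 a5 a4 a3 s2_def a1)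
    obtain Ts where "tcp_solution I Ts" "out (den xs (traceback_loop ;; print_loop) ?s8) =
        out ?s8 @ concat (map (encode_subgraph I) Ts)"
      using traceback_answer[OF pre w0] .
    then show ?thesis using out_solve True hit out7 by (auto simp: tcp_answer_def)
  next
    case False
    then have "\<nexists>Ts. tcp_solution I Ts"
      using ok(1) solution_imp_table unfolding S_def by blast
    then show ?thesis using out_solve False hit by (auto simp: tcp_answer_def)
  qed
qed

section \<open>Polynomial bounds for the loop registers\<close>

lemma grown_imp_tcp_grown: "grown m s \<Longrightarrow> tcp_grown k I (arr s aCH) (arr s aPA) (arr s aEI)"
  unfolding grown_def tcp_grown_def tcp_grown_axioms_def by (simp add: tcp_axioms)

text \<open>The existence of a growth order comes from running the verified search on the instance,
  and the order adds one vertex per edge to the root.\<close>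

lemma n_eq_Suc_m: "n = Suc m"
proof -
  define s where "s = set_arr aVIS r 1 (den xs power_loop (den xs (read_params k) init))"
  have "params s" "arr s aVIS v = of_bool (v = r)" for v
    using read_params by (simp_all add: s_def params_def)
  from grow_loop[OF this] have "grown m (den xs grow_loop s)" .
  from tcp_grown.n_eq[OF grown_imp_tcp_grown[OF this]] show ?thesis .
qed

text \<open>The number \<open>n\<close> itself occupies only logarithmically many bits; the bound
  comes from the list of the \<open>n - 1\<close> edges.\<close>

lemma n_le_input_size: "n \<le> input_size xs + 1"
proof -
  have "length ys \<le> input_size ys" for ys
    unfolding input_size_def by (induction ys) (simp_all add: bits_def)
  from this[of xs] have "m \<le> input_size xs"
    by (simp add: encode_input_def length_concat_pairs del: length_concat)
  then show ?thesis using n_eq_Suc_m by simp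
qed

text \<open>The base \<open>2 + k + input_size xs\<close> dominates \<open>B\<close> and
  \<open>k\<close>; its power \<open>k\<close> dominates \<open>M\<close>, and one more factor makes
  the power nontrivial also for \<open>k = 0\<close>.\<close>

lemma params_le:
  defines "N \<equiv> poly ([:2 + k, 1:] ^ Suc k) (input_size xs)"
  shows "n \<le> N" "m \<le> N" "B \<le> N" "k \<le> N" "M \<le> N"
proof -
  let ?b = "2 + k + input_size xs"
  have N: "N = ?b ^ Suc k" by (simp only: N_def poly_power) simp
  have le: "x \<le> N" if "x \<le> ?b" for x
  proof -
    have "?b ^ 1 \<le> ?b ^ Suc k" by (rule power_increasing) auto
    then show ?thesis using that by (simp only: N power_one_right)
  qed
  show "n \<le> N" "m \<le> N" "B \<le> N" "k \<le> N"
    using n_le_input_size n_eq_Suc_m by (simp_all add: le)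
  have "M \<le> ?b ^ k" using n_le_input_size by (intro power_mono) auto
  also have "\<dots> \<le> N" unfolding N by (rule power_increasing) auto
  finally show "M \<le> N" .
qed

end

theorem theorem12:
  fixes k :: nat
  shows "poly_time_solvable (tcp_instances k) encode_input tcp_answer"
proof (rule poly_time_solvable_three_phases[OF wf_programs(1)[of k] wf_programs(2-6)])
  fix I b
  assume "I \<in> tcp_instances k"
  then interpret tcp k I by unfold_locales
  let ?s = "den (encode_input I) (read_params k) init"
  show "b \<in> bounds power_loop \<Longrightarrow>
      reg ?s b \<le> poly ([:2 + k, 1:] ^ Suc k) (input_size (encode_input I))"
    using read_params params_le unfolding bounds_programs by auto
  show "b \<in> bounds solve \<Longrightarrow> reg (den (encode_input I) power_loop ?s) b \<le>
      poly ([:2 + k, 1:] ^ Suc k) (input_size (encode_input I))"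
    using paramsD[OF read_params(1)] params_le unfolding bounds_programs by auto
next
  fix I
  assume "I \<in> tcp_instances k"
  then interpret tcp k I by unfold_locales
  show "tcp_answer I (out (den (encode_input I) solve
      (den (encode_input I) power_loop (den (encode_input I) (read_params k) init))))"
    using read_params by (intro solve_correct)
qed

end
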